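(* Let $(K,v)$ be a valued field, $\overline v$ a fixed extension of $v$ to an algebraic closure $\overline K$ of $K$, and $K^h\subseteq\overline K$ the henselization of $K$ with respect to $\overline v$. Let $(K(X)|K,w)$ be a value transcendental extension of $(K,v)$ and $E=\{z_\nu\}_{\nu<\lambda}$ a pseudo convergent sequence of algebraic type in $(K,v)$. Take associated minimal polynomials $Q(X)\in K[X]$ and $Q^h(X)\in K^h[X]$ of $E$ over $K$ and over $K^h$ respectively. Assume that $X$ is a limit of $E$ (with respect to $w$). Then $$\deg\mathrm{dom}_E(Q^h)=\deg Q^h.$$ Consider the following statements: (i) $w=v_E$. (ii) There exists some common extension $\overline w$ of $\overline v$ and $w$ to $\overline K(X)$ such that, for $a\in\overline K$, $a$ is a limit of $E$ if and only if $(a,\overline w(X-a))$ is a pair of definition for $w$ over $K$. (iii) Whenever $(a,\overline w(X-a))$ is a pair of definition for $w$ over $K$, where $\overline w$ is some common extension of $w$ and $\overline v$ to $\overline K(X)$, then for all $\beta\in\overline v\overline K$: $\beta>\overline w(X-a)$ if and only if $\beta>\delta_\nu$ for all $\nu<\lambda$. (iv) $(a,\overline w(X-a))$ is a minimal pair of definition for $w$ over $K$ for some root $a$ of $Q$, where $\overline w$ is some common extension of $w$ and $\overline v$ to $\overline K(X)$. (v) $(a,\overline w(X-a))$ is a pair of definition for $w$ over $K$ for some root $a$ of $Q$, where $\overline w$ is some common extension of $w$ and $\overline v$ to $\overline K(X)$. (vi) $w(Q)\notin\overline v\overline K$. (vii) $IC(K(X)|K,w)=K^h$, where an extension of $w$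 to $\overline{K(X)}$ is fixed. Then the following relations hold: $$(i)\Longleftrightarrow(ii)\Longleftrightarrow(iii)\Longrightarrow(iv)\Longleftrightarrow(v)\Longleftrightarrow(vi),$$ $$(i)\Longleftrightarrow(ii)\Longleftrightarrow(iii)\Longrightarrow(vii).$$
   Context: Conventions. A valued field $(K,v)$ is a field with a (Krull) valuation, value group $vK$ (written additively). Valuations with the same valuation ring are identified, and if $w$ extends $v$ then $vK$ is regarded as a subgroup of the value group of $w$. $\overline v\overline K$ is the divisible hull of $vK$; for a common extension $\overline w$ of $w$ and $\overline v$, all values are compared in $\overline w\,\overline K(X)$. $(K(X)|K,w)$ is value transcendental if $\dim_{\mathbb Q}\bigl(\mathbb Q\otimes_{\mathbb Z}(wK(X)/vK)\bigr)=1$. Pseudo convergent sequences. Let $\lambda$ be a limit ordinal. $E=\{z_\nu\}_{\nu<\lambda}\subseteq K$ is pseudo convergent (pcs) if $v(z_{\nu_1}-z_{\nu_2})<v(z_{\nu_2}-z_{\nu_3})$ for all $\nu_1<\nu_2<\nu_3<\lambda$; put $\delta_\nu:=v(z_\nu-z_{\nu+1})$. An element $y$ of a valued extension field is a limit of $E$ if the value of $y-z_\nu$ is $\delta_\nu$ for all sufficiently large $\nu$; for $y\in\overline K$ this is with respect to $\overline v$. For $f\in K[X]$ the sequence $\{vf(z_\nu)\}_{\nu<\lambda}$ is either ultimately constant or ultimately strictly increasing; $E$ is of algebraic type if it is not ultimately constant for some $f\in K[X]$. Then an associated minimal polynomial of $E$ over $K$ is a monic $Q\in K[X]$ of minimal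 degree such that $\{vQ(z_\nu)\}_{\nu<\lambda}$ is ultimately strictly increasing; over $K^h$ it is defined in the same way, viewing $E$ in $(K^h,\overline v)$. Dominating degree. For a nonzero polynomial $f$ over $K$ (or over $K^h$), $\deg\mathrm{dom}_E(f)$ is the number (with multiplicity) of roots of $f$ in $\overline K$ that are limits of $E$. Induced valuation. $v_E$ is the valuation of $K(X)$ with valuation ring $\{\phi\in K(X)\mid v\phi(z_\nu)\ge 0$ for all sufficiently large $\nu\}$ (maximal ideal given by $v\phi(z_\nu)>0$ for all sufficiently large $\nu$); it extends $v$. Pairs of definition. For $a\in\overline K$ and $\alpha$ in an ordered abelian group containing $\overline v\overline K$, $\overline v_{a,\alpha}$ is the valuation of $\overline K(X)$ with $\overline v_{a,\alpha}(\sum_i c_i(X-a)^i)=\min_i\{\overline v c_i+i\alpha\}$ ($c_i\in\overline K$). Given a common extension $\overline w$ of $w$ and $\overline v$ to $\overline K(X)$, a pair $(a,\alpha)\in\overline K\times\overline w\,\overline K(X)$ is a pair of definition for $w$ over $K$ (with respect to $\overline w$) if $\overline w=\overline v_{a,\alpha}$; equivalently, $\alpha=\overline w(X-a)=\max\{\overline w(X-c)\mid c\in\overline K\}$. It is a minimal pair of definition for $w$ over $K$ if moreover, for all $b\in\overline K$, $\overline v(a-b)\ge\alpha$ implies $[K(b):K]\ge[K(a):K]$. Implicit constant field. $\overline{K(X)}$ is an algebraic closure of $K(X)$ containing $\overline K$. Given an extension of $w$ to $\overline{K(X)}$, $IC(K(X)|K,w)$ is the relative algebraic closure of $K$ in the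 henselization $K(X)^h\subseteq\overline{K(X)}$; in (vii), both $K^h$ and $K(X)^h$ are taken with respect to this fixed extension. *)

theory Defs
  imports
    "HOL-Algebra.Algebra"
    "HOL-Algebra.Algebraic_Closure_Type"
    "HOL-Library.Extended"
    "HOL-Library.FuncSet"
begin

section \<open>Fields and rational functions\<close>

text \<open>
  The algebraic closure of \<open>K\<close> is an algebraically closed type \<open>'a\<close> that is algebraic over a
  subfield \<open>K\<close>.  Then \<open>K(X)\<close> is a subfield of \<open>'a poly fract\<close>, and \<open>'a poly fract alg_closure\<close> is
  an algebraic closure of \<open>K(X)\<close> containing (copies of) \<open>'a\<close> and \<open>'a(X)\<close>.
\<close>

abbreviation is_subfield :: "'b::field set \<Rightarrow> bool"
  where "is_subfield F \<equiv> subfield F (ring_of_type_algebra :: 'b ring)"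

definition polys :: "'b::field set \<Rightarrow> 'b poly set"
  where "polys F = {f. \<forall>i. poly.coeff f i \<in> F}"

definition algebraic_over :: "'b::field set \<Rightarrow> 'b \<Rightarrow> bool"
  where "algebraic_over F x \<longleftrightarrow> (\<exists>f \<in> polys F. f \<noteq> 0 \<and> poly f x = 0)"

text \<open>\<open>[F(b) : F]\<close>, for \<open>b\<close> algebraic over \<open>F\<close>.\<close>

definition ext_degree :: "'b::field set \<Rightarrow> 'b \<Rightarrow> nat"
  where "ext_degree F b =
    ring.dim (ring_of_type_algebra :: 'b ring) F
      (generate_field (ring_of_type_algebra :: 'b ring) (insert b F))"

abbreviation ratC :: "'a::field \<Rightarrow> 'a poly fract"
  where "ratC c \<equiv> to_fract [:c:]"

abbreviation ratX :: "'a::field poly fract"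
  where "ratX \<equiv> to_fract [:0, 1:]"

definition ratfuns :: "'a::field set \<Rightarrow> 'a poly fract set"
  where "ratfuns F = {Fract f g | f g. f \<in> polys F \<and> g \<in> polys F \<and> g \<noteq> 0}"


section \<open>Valuations\<close>

text \<open>
  Valuations take their values in \<open>'g extended\<close>, where \<open>'g\<close> is an ambient ordered abelian group that
  need not be the value group, and \<open>v 0 = \<infinity>\<close>.  The ambient group is taken to be divisible: this is no
  restriction on the given valuations, since an ordered abelian group embeds into its divisible hull,
  and it makes it possible to quantify over all extensions of a valuation to an algebraic extension,
  because up to equivalence such an extension has its values in the divisible hull of the original
  value group.  All comparisons between values of different valuations take place in \<open>'g\<close>.
\<close>

class divisible_ordered_ab_group = linordered_ab_group_add +
  assumes divisible: "(n::nat) > 0 \<Longrightarrow> \<exists>h. (\<Sum>i<n. h) = g"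

text \<open>Only the restriction of \<open>v\<close> to the subfield \<open>F\<close> is constrained.\<close>

definition valuation_on :: "'b::field set \<Rightarrow> ('b \<Rightarrow> 'g::linordered_ab_group_add extended) \<Rightarrow> bool"
  where "valuation_on F v \<longleftrightarrow>
    v 0 = \<infinity> \<and> (\<forall>x\<in>F. x \<noteq> 0 \<longrightarrow> v x \<in> range Fin) \<and>
    (\<forall>x\<in>F. \<forall>y\<in>F. v (x * y) = v x + v y) \<and>
    (\<forall>x\<in>F. \<forall>y\<in>F. min (v x) (v y) \<le> v (x + y))"

definition value_group :: "'b::field set \<Rightarrow> ('b \<Rightarrow> 'g::linordered_ab_group_add extended) \<Rightarrow> 'g set"
  where "value_group F v = {\<gamma>. \<exists>x\<in>F. v x = Fin \<gamma>}"

definition valuation_ring :: "'b::field set \<Rightarrow> ('b \<Rightarrow> 'g::linordered_ab_group_add extended) \<Rightarrow> 'b set"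
  where "valuation_ring F v = {x \<in> F. 0 \<le> v x}"

text \<open>\<open>wb\<close> is a common extension of \<open>w\<close> (on \<open>K(X)\<close>) and \<open>vb\<close> (on \<open>'a\<close>) to \<open>'a(X)\<close>.\<close>

definition common_extension ::
    "'a::field set \<Rightarrow> ('a poly fract \<Rightarrow> 'g::linordered_ab_group_add extended) \<Rightarrow>
     ('a \<Rightarrow> 'g extended) \<Rightarrow> ('a poly fract \<Rightarrow> 'g extended) \<Rightarrow> bool"
  where "common_extension K w vb wb \<longleftrightarrow>
    valuation_on UNIV wb \<and> (\<forall>\<phi> \<in> ratfuns K. wb \<phi> = w \<phi>) \<and> (\<forall>c. wb (ratC c) = vb c)"


section \<open>Value transcendental extensions\<close>

definition additive_group :: "'g::ab_group_add set \<Rightarrow> 'g monoid"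
  where "additive_group G = \<lparr>carrier = G, monoid.mult = (+), one = 0\<rparr>"

text \<open>
  For an abelian group \<open>A\<close>, the tensor product of \<open>\<rat>\<close> and \<open>A\<close> over \<open>\<int>\<close> is the free abelian group on
  \<open>\<rat> \<times> A\<close> modulo the subgroup \<open>rat_tensor_null A\<close>, with \<open>\<rat>\<close> acting through \<open>rat_tensor_scale\<close>.
\<close>

definition rat_tensor_free :: "('c, 'm) monoid_scheme \<Rightarrow> ((rat \<times> 'c) \<Rightarrow>\<^sub>0 int) monoid"
  where "rat_tensor_free A = free_Abelian_group (UNIV \<times> carrier A)"

definition rat_tensor_null :: "('c, 'm) monoid_scheme \<Rightarrow> ((rat \<times> 'c) \<Rightarrow>\<^sub>0 int) set"
  where "rat_tensor_null A = generate (rat_tensor_free A)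
    ({frag_of (q + r, a) - frag_of (q, a) - frag_of (r, a) | q r a. a \<in> carrier A} \<union>
     {frag_of (q, a \<otimes>\<^bsub>A\<^esub> b) - frag_of (q, a) - frag_of (q, b) | q a b.
        a \<in> carrier A \<and> b \<in> carrier A})"

definition rat_tensor_scale :: "rat \<Rightarrow> ((rat \<times> 'c) \<Rightarrow>\<^sub>0 int) \<Rightarrow> ((rat \<times> 'c) \<Rightarrow>\<^sub>0 int)"
  where "rat_tensor_scale q t = frag_extend (\<lambda>(r, a). frag_of (q * r, a)) t"

text \<open>The \<open>\<rat>\<close>-dimension of the tensor product is \<open>n\<close>: some \<open>n\<close> elements represent a basis.\<close>

definition rat_tensor_dim :: "('c, 'm) monoid_scheme \<Rightarrow> nat \<Rightarrow> bool"
  where "rat_tensor_dim A n \<longleftrightarrow>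
    (\<exists>B \<subseteq> carrier (rat_tensor_free A). finite B \<and> card B = n \<and>
      (\<forall>t \<in> carrier (rat_tensor_free A).
        \<exists>!c. c \<in> B \<rightarrow>\<^sub>E UNIV \<and> t - (\<Sum>b\<in>B. rat_tensor_scale (c b) b) \<in> rat_tensor_null A))"

definition value_transcendental ::
    "'a::field set \<Rightarrow> ('a \<Rightarrow> 'g::linordered_ab_group_add extended) \<Rightarrow>
     ('a poly fract \<Rightarrow> 'g extended) \<Rightarrow> bool"
  where "value_transcendental K v w \<longleftrightarrow>
    rat_tensor_dim (additive_group (value_group (ratfuns K) w) Mod value_group K v) 1"


section \<open>Henselizations and implicit constant fields\<close>

text \<open>Henselian in the sense of Hensel's Lemma: simple roots modulo the maximal ideal lift.\<close>

definition henselian :: "'b::field set \<Rightarrow> ('b \<Rightarrow> 'g::linordered_ab_group_add extended) \<Rightarrow> bool"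
  where "henselian F v \<longleftrightarrow>
    (\<forall>f \<in> polys F. \<forall>a \<in> valuation_ring F v.
      Polynomial.lead_coeff f = 1 \<and> (\<forall>i. 0 \<le> v (poly.coeff f i)) \<and>
      0 < v (poly f a) \<and> v (poly (pderiv f) a) = 0
      \<longrightarrow> (\<exists>b\<in>F. poly f b = 0 \<and> 0 < v (b - a)))"

text \<open>
  The henselization of \<open>F\<close> inside an algebraically closed valued field \<open>('b, v)\<close>: the smallest
  henselian subfield containing \<open>F\<close>.
\<close>

definition henselization ::
    "'b::alg_closed_field set \<Rightarrow> ('b \<Rightarrow> 'g::linordered_ab_group_add extended) \<Rightarrow> 'b set"
  where "henselization F v = \<Inter>{H. is_subfield H \<and> F \<subseteq> H \<and> henselian H v}"

definition IC ::
    "'a::field set \<Rightarrow> ('a poly fract alg_closure \<Rightarrow> 'g::linordered_ab_group_add extended) \<Rightarrow>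
     'a poly fract alg_closure set"
  where "IC K u =
    {y \<in> henselization (to_ac ` ratfuns K) u. algebraic_over ((\<lambda>c. to_ac (ratC c)) ` K) y}"


section \<open>Pseudo convergent sequences\<close>

text \<open>
  A sequence indexed by a limit ordinal is a function on a well-ordered type without greatest element;
  \<open>at_top\<close> is the filter of all sufficiently large indices.
\<close>

definition index_succ :: "'i::wellorder \<Rightarrow> 'i"
  where "index_succ \<nu> = (LEAST \<mu>. \<nu> < \<mu>)"

definition pseudo_convergent ::
    "('b::field \<Rightarrow> 'g::linordered_ab_group_add extended) \<Rightarrow> ('i::wellorder \<Rightarrow> 'b) \<Rightarrow> bool"
  where "pseudo_convergent v z \<longleftrightarrow>
    (\<forall>\<nu>1 \<nu>2 \<nu>3. \<nu>1 < \<nu>2 \<and> \<nu>2 < \<nu>3 \<longrightarrow> v (z \<nu>1 - z \<nu>2) < v (z \<nu>2 - z \<nu>3))"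

definition pcs_delta ::
    "('b::field \<Rightarrow> 'g::linordered_ab_group_add extended) \<Rightarrow> ('i::wellorder \<Rightarrow> 'b) \<Rightarrow> 'i \<Rightarrow> 'g extended"
  where "pcs_delta v z \<nu> = v (z \<nu> - z (index_succ \<nu>))"

definition pcs_limit ::
    "('b::field \<Rightarrow> 'g::linordered_ab_group_add extended) \<Rightarrow> ('i::wellorder \<Rightarrow> 'b) \<Rightarrow> 'b \<Rightarrow> bool"
  where "pcs_limit v z y \<longleftrightarrow> (\<forall>\<^sub>F \<nu> in at_top. v (y - z \<nu>) = pcs_delta v z \<nu>)"

definition ultimately_constant :: "('i::wellorder \<Rightarrow> 'c) \<Rightarrow> bool"
  where "ultimately_constant s \<longleftrightarrow> (\<exists>c. \<forall>\<^sub>F \<nu> in at_top. s \<nu> = c)"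

definition ultimately_strict_mono :: "('i::wellorder \<Rightarrow> 'c::order) \<Rightarrow> bool"
  where "ultimately_strict_mono s \<longleftrightarrow> (\<exists>\<nu>0. strict_mono_on {\<nu>0..} s)"

definition algebraic_type ::
    "'b::field set \<Rightarrow> ('b \<Rightarrow> 'g::linordered_ab_group_add extended) \<Rightarrow> ('i::wellorder \<Rightarrow> 'b) \<Rightarrow> bool"
  where "algebraic_type F v z \<longleftrightarrow>
    (\<exists>f \<in> polys F. \<not> ultimately_constant (\<lambda>\<nu>. v (poly f (z \<nu>))))"

definition assoc_min_poly ::
    "'b::field set \<Rightarrow> ('b \<Rightarrow> 'g::linordered_ab_group_add extended) \<Rightarrow> ('i::wellorder \<Rightarrow> 'b) \<Rightarrow>
     'b poly \<Rightarrow> bool"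
  where "assoc_min_poly F v z = is_arg_min Polynomial.degree
    (\<lambda>f. f \<in> polys F \<and> Polynomial.lead_coeff f = 1 \<and>
      ultimately_strict_mono (\<lambda>\<nu>. v (poly f (z \<nu>))))"

definition degdom ::
    "('b::field \<Rightarrow> 'g::linordered_ab_group_add extended) \<Rightarrow> ('i::wellorder \<Rightarrow> 'b) \<Rightarrow> 'b poly \<Rightarrow> nat"
  where "degdom v z f = size (filter_mset (pcs_limit v z) (proots f))"

text \<open>The valuation ring of \<open>v\<^sub>E\<close>.\<close>

definition vE_ring ::
    "'a::field set \<Rightarrow> ('a \<Rightarrow> 'g::linordered_ab_group_add extended) \<Rightarrow> ('i::wellorder \<Rightarrow> 'a) \<Rightarrow>
     'a poly fract set"
  where "vE_ring K v z =
    {Fract f g | f g. f \<in> polys K \<and> g \<in> polys K \<and> g \<noteq> 0 \<and>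
      (\<forall>\<^sub>F \<nu> in at_top. poly g (z \<nu>) \<noteq> 0 \<and> 0 \<le> v (poly f (z \<nu>) / poly g (z \<nu>)))}"


section \<open>Pairs of definition\<close>

text \<open>
  \<open>wb\<close> is the valuation of \<open>'a(X)\<close> given on polynomials by the minimum formula with respect to
  \<open>(a, \<alpha>)\<close>; its values on quotients are then determined.  The inner sum is \<open>i\<close> times \<open>\<alpha>\<close>.
\<close>

definition pair_of_definition ::
    "('a::field \<Rightarrow> 'g::linordered_ab_group_add extended) \<Rightarrow> ('a poly fract \<Rightarrow> 'g extended) \<Rightarrow>
     'a \<Rightarrow> 'g extended \<Rightarrow> bool"
  where "pair_of_definition vb wb a \<alpha> \<longleftrightarrow>
    (\<forall>(c :: nat \<Rightarrow> 'a) n.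
      wb (\<Sum>i\<le>n. ratC (c i) * (ratX - ratC a) ^ i) = (MIN i\<in>{..n}. vb (c i) + (\<Sum>j<i. \<alpha>)))"

definition minimal_pair_of_definition ::
    "'a::field set \<Rightarrow> ('a \<Rightarrow> 'g::linordered_ab_group_add extended) \<Rightarrow>
     ('a poly fract \<Rightarrow> 'g extended) \<Rightarrow> 'a \<Rightarrow> 'g extended \<Rightarrow> bool"
  where "minimal_pair_of_definition K vb wb a \<alpha> \<longleftrightarrow>
    pair_of_definition vb wb a \<alpha> \<and>
    (\<forall>b. \<alpha> \<le> vb (a - b) \<longrightarrow> ext_degree K a \<le> ext_degree K b)"

end

theory Submission
  imports Defs
begin

text \<open>
  Let \<open>\<Gamma>\<close> be the value group of \<open>vb\<close>.  Since \<open>w\<close> is value transcendental, a common extension \<open>wb\<close> of \<open>w\<close> and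
  \<open>vb\<close> is monomial at some \<open>a\<close> with \<open>\<alpha> = wb (X - a) \<notin> \<Gamma>\<close>, and \<open>b\<close> belongs to a pair of definition if and only
  if \<open>wb (X - b) \<notin> \<Gamma>\<close>; such \<open>b\<close> are limits of \<open>E\<close>.  If a polynomial \<open>f\<close> has \<open>m\<close> roots that are limits, then
  \<open>v (f (z \<nu>)) = C + m \<delta> \<nu>\<close> eventually, whereas \<open>wb f\<close> is \<open>C\<close> plus the sum of \<open>wb (X - r)\<close> over these roots \<open>r\<close>.
  Hence each of (i), (ii), (iii) says that \<open>\<alpha>\<close> fills the cut defined by the \<open>\<delta> \<nu>\<close>, for one or
  equivalently for all \<open>wb\<close>, and each of (iv), (v), (vi) says that some root \<open>r\<close> of \<open>Q\<close> has \<open>wb (X - r) \<notin> \<Gamma>\<close>.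

  That \<open>wb\<close> exists, that the roots of \<open>Q\<^sup>h\<close> are all limits, and (vii) rest on conjugacy.  Every extension of a
  valuation to a simple algebraic extension is induced by an embedding into the algebraic closure, and
  embeddings over a henselian field preserve the valuation.  For (vii), a constant in the henselization
  of \<open>K(X)\<close> outside \<open>K\<^sup>h\<close> would either be moved by a valuation preserving embedding over \<open>K(X)\<close>, which is
  impossible since Hensel roots are unique, or be purely inseparable over \<open>K\<^sup>h\<close>.
\<close>

text \<open>(i) mentions no common extension, (iii) quantifies over all of them, and (ii), (iv), (v)
  ask for one. The cut condition \<open>tight\<close> is therefore tied to (i) for each
  \<open>wb\<close> separately; this makes it independent of \<open>wb\<close> and of the extension
  of \<open>v\<close> to the algebraic closure. The latter matters in (vii), where \<open>u\<close>
  brings along its own.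

  Values outside \<open>\<Gamma>\<close> are manageable because \<open>\<Gamma>\<close>, the value
  group of an algebraically closed field, is closed under division: for
  \<open>\<alpha> \<notin> \<Gamma>\<close>, terms of different degree in \<open>X - a\<close> never
  have equal finite values, so a minimum is attained once and nothing cancels.

  The obstacle is conjugacy. Henselian means only that simple residual roots lift, and fields are
  sets inside a fixed type. Partial embeddings are kept as graphs and enlarged by Zorn's Lemma, with
  the zero test or the valuation as invariant. Inseparability is met by passing to a power with
  separable minimal polynomial, or, for elements without other conjugates, by a separate
  argument.\<close>

abbreviation deg :: "'b::zero poly \<Rightarrow> nat" where "deg \<equiv> Polynomial.degree"
abbreviation cf :: "'b::zero poly \<Rightarrow> nat \<Rightarrow> 'b" where "cf \<equiv> Polynomial.coeff"
abbreviation lcf :: "'b::zero poly \<Rightarrow> 'b" where "lcf \<equiv> Polynomial.lead_coeff"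

section \<open>Subfields and polynomials over them\<close>

text \<open>Elementwise form of \<open>subfield\<close>. Since \<open>inverse 0 = 0\<close>, closure
  under inverses can be stated for all elements.\<close>

locale subfield_set =
  fixes F :: "'b::field set"
  assumes zero_mem [simp]: "0 \<in> F" and one_mem [simp]: "1 \<in> F"
    and add_mem [simp]: "x \<in> F \<Longrightarrow> y \<in> F \<Longrightarrow> x + y \<in> F"
    and uminus_mem [simp]: "x \<in> F \<Longrightarrow> - x \<in> F"
    and mult_mem [simp]: "x \<in> F \<Longrightarrow> y \<in> F \<Longrightarrow> x * y \<in> F"
    and inverse_mem [simp]: "x \<in> F \<Longrightarrow> inverse x \<in> F"

lemma ring_of_type_algebra_simps [simp]:
  "carrier ring_of_type_algebra = UNIV"
  "x \<otimes>\<^bsub>ring_of_type_algebra\<^esub> y = x * y"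
  "x \<oplus>\<^bsub>ring_of_type_algebra\<^esub> y = x + y"
  "\<one>\<^bsub>ring_of_type_algebra\<^esub> = 1"
  "\<zero>\<^bsub>ring_of_type_algebra\<^esub> = 0"
  by (simp_all add: ring_of_type_algebra_def)

lemma a_inv_ring_of_type_algebra [simp]:
  "\<ominus>\<^bsub>ring_of_type_algebra\<^esub> x = - (x :: 'b::field)"
proof -
  interpret R: field "ring_of_type_algebra :: 'b ring" by (rule field_from_type_algebra)
  show ?thesis using R.add.inv_equality[of "- x" x] by simp
qed

lemma m_inv_ring_of_type_algebra:
  assumes "x \<noteq> 0"
  shows "inv\<^bsub>ring_of_type_algebra\<^esub> x = inverse (x :: 'b::field)"
proof -
  interpret R: field "ring_of_type_algebra :: 'b ring" by (rule field_from_type_algebra)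
  show ?thesis using R.comm_inv_char[of x "inverse x"] assms by simp
qed

lemma subfield_iff_subfield_set: "is_subfield F \<longleftrightarrow> subfield_set (F :: 'b::field set)"
proof -
  interpret R: field "ring_of_type_algebra :: 'b ring" by (rule field_from_type_algebra)
  show ?thesis
  proof
    assume sf: "is_subfield F"
    note sr = R.subring_props[OF sf]
    show "subfield_set F"
    proof
      fix x assume x: "x \<in> F"
      show "- x \<in> F" using sr(5)[OF x] by simp
      show "inverse x \<in> F"
      proof (cases "x = 0")
        case False
        then show ?thesis
          using R.subfield_m_inv(1)[OF sf, of x] x m_inv_ring_of_type_algebra[of x] by auto
      qed (use x in simp)
    qed (use sr in auto)
  next
    assume "subfield_set F"
    then interpret subfield_set F .
    show "is_subfield F"
    proof (rule R.subfieldI')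
      show "subring F (ring_of_type_algebra :: 'b ring)"
        by (rule R.subringI) auto
    qed (auto simp: m_inv_ring_of_type_algebra)
  qed
qed

lemma subfield_set_UNIV [simp]: "subfield_set UNIV"
  by unfold_locales auto

lemma subfield_set_Inter:
  assumes "\<And>F. F \<in> A \<Longrightarrow> subfield_set F"
  shows "subfield_set (\<Inter>A)"
  using assms by unfold_locales
    (auto intro: subfield_set.zero_mem subfield_set.one_mem subfield_set.add_mem
      subfield_set.uminus_mem subfield_set.mult_mem subfield_set.inverse_mem)

context subfield_set
begin

lemma diff_mem [simp]: "x \<in> F \<Longrightarrow> y \<in> F \<Longrightarrow> x - y \<in> F"
  using add_mem[of x "- y"] by simp

lemma divide_mem [simp]: "x \<in> F \<Longrightarrow> y \<in> F \<Longrightarrow> x / y \<in> F"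
  by (simp add: divide_inverse)

lemma power_mem [simp]: "x \<in> F \<Longrightarrow> x ^ n \<in> F"
  by (induction n) auto

lemma sum_mem: "(\<And>i. i \<in> A \<Longrightarrow> f i \<in> F) \<Longrightarrow> sum f A \<in> F"
  by (induction A rule: infinite_finite_induct) auto

lemma of_nat_mem [simp]: "of_nat n \<in> F"
  by (induction n) auto

lemma polys_0 [simp]: "0 \<in> polys F" and polys_1 [simp]: "1 \<in> polys F"
  by (auto simp: polys_def coeff_1)

lemma polys_const [simp]: "[:c:] \<in> polys F \<longleftrightarrow> c \<in> F"
  by (auto simp: polys_def coeff_pCons split: nat.splits)

lemma polys_pCons [simp]: "pCons c p \<in> polys F \<longleftrightarrow> c \<in> F \<and> p \<in> polys F"
proof
  assume *: "pCons c p \<in> polys F"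
  have "cf p i \<in> F" for i using * by (auto simp: polys_def dest: spec[of _ "Suc i"])
  moreover have "c \<in> F" using * by (auto simp: polys_def dest: spec[of _ 0])
  ultimately show "c \<in> F \<and> p \<in> polys F" by (auto simp: polys_def)
qed (auto simp: polys_def coeff_pCons split: nat.splits)

lemma polys_add [simp]: "p \<in> polys F \<Longrightarrow> q \<in> polys F \<Longrightarrow> p + q \<in> polys F"
  by (auto simp: polys_def)

lemma polys_diff [simp]: "p \<in> polys F \<Longrightarrow> q \<in> polys F \<Longrightarrow> p - q \<in> polys F"
  by (auto simp: polys_def)

lemma polys_uminus [simp]: "p \<in> polys F \<Longrightarrow> - p \<in> polys F"
  by (auto simp: polys_def)

lemma polys_mult [simp]: "p \<in> polys F \<Longrightarrow> q \<in> polys F \<Longrightarrow> p * q \<in> polys F"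
  by (auto simp: polys_def coeff_mult intro!: sum_mem)

lemma polys_smult [simp]: "c \<in> F \<Longrightarrow> q \<in> polys F \<Longrightarrow> Polynomial.smult c q \<in> polys F"
  by (auto simp: polys_def)

lemma polys_monom [simp]: "c \<in> F \<Longrightarrow> Polynomial.monom c n \<in> polys F"
  by (auto simp: polys_def coeff_monom)

lemma polys_power [simp]: "p \<in> polys F \<Longrightarrow> p ^ n \<in> polys F"
  by (induction n) auto

lemma polys_pderiv [simp]: "p \<in> polys F \<Longrightarrow> pderiv p \<in> polys F"
  by (auto simp: polys_def coeff_pderiv simp del: of_nat_Suc)

lemma poly_mem: "p \<in> polys F \<Longrightarrow> x \<in> F \<Longrightarrow> poly p x \<in> F"
  by (auto simp: poly_altdef polys_def intro!: sum_mem)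

lemma coeff_mem: "p \<in> polys F \<Longrightarrow> cf p i \<in> F"
  by (auto simp: polys_def)

lemma polys_pcompose: "p \<in> polys F \<Longrightarrow> q \<in> polys F \<Longrightarrow> pcompose p q \<in> polys F"
  by (induction p) (auto simp: pcompose_pCons)

text \<open>The leading coefficient of \<open>g\<close> is invertible in \<open>F\<close>, so long
  division does not leave \<open>F\<close>. The zero remainder is listed separately because
  \<open>deg 0 = 0\<close>.\<close>

lemma polys_division:
  assumes "g \<in> polys F" "g \<noteq> 0" "f \<in> polys F"
  shows "\<exists>q\<in>polys F. \<exists>r\<in>polys F. f = q * g + r \<and> (r = 0 \<or> deg r < deg g)"
  using assms(3)
proof (induction "deg f" arbitrary: f rule: less_induct)
  case less
  show ?case
  proof (cases "f = 0 \<or> deg f < deg g")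
    case True
    then show ?thesis using less.prems by (intro bexI[of _ 0] bexI[of _ f]) auto
  next
    case False
    define m where "m = Polynomial.monom (lcf f / lcf g) (deg f - deg g)"
    have m: "m \<in> polys F" using less.prems assms by (auto simp: m_def coeff_mem)
    have m0: "m \<noteq> 0" using False assms by (auto simp: m_def)
    have deg_m: "deg m = deg f - deg g" using False assms by (auto simp: m_def degree_monom_eq)
    define f' where "f' = f - m * g"
    have deg_mg: "deg (m * g) = deg f" using False m0 assms deg_m by (simp add: degree_mult_eq)
    have lc_mg: "lcf (m * g) = lcf f"
      using assms False deg_m by (simp add: lead_coeff_mult) (simp add: m_def)
    have f': "f' \<in> polys F" using less.prems m assms by (auto simp: f'_def)
    show ?thesis
    proof (cases "deg f = 0")
      \<comment> \<open>For constant \<open>f\<close> the degree cannot drop, so the induction does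
        not apply; \<open>g\<close> is then constant too and nothing remains.\<close>
      case True
      then have "f' = 0"
        using lc_mg deg_mg by (auto simp: f'_def intro!: poly_eqI)
           (metis coeff_eq_0 gr_zeroI)
      then show ?thesis using m by (intro bexI[of _ m] bexI[of _ 0]) (auto simp: f'_def)
    next
      case df: False
      have "deg f' < deg f"
      proof (rule le_neq_implies_less)
        show "deg f' \<le> deg f" unfolding f'_def using deg_mg by (metis degree_diff_le order_refl)
        show "deg f' \<noteq> deg f"
        proof
          assume "deg f' = deg f"
          moreover have "cf f' (deg f) = 0" using lc_mg deg_mg by (simp add: f'_def)
          ultimately show False using df by (metis degree_0 leading_coeff_0_iff)
        qed
      qed
      from less.hyps[OF this f'] obtain q r where "q\<in>polys F" "r\<in>polys F"
        "f' = q * g + r" "r = 0 \<or> deg r < deg g" by auto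
      then show ?thesis
        using m by (intro bexI[of _ "q + m"] bexI[of _ r]) (auto simp: f'_def algebra_simps)
    qed
  qed
qed

lemma polys_dvd_factor:
  assumes "g \<in> polys F" "g \<noteq> 0" "f \<in> polys F" "g dvd f"
  obtains q where "q \<in> polys F" "f = g * q"
proof -
  obtain q r where qr: "q \<in> polys F" "f = q * g + r" "r = 0 \<or> deg r < deg g"
    using polys_division[OF assms(1-3)] by blast
  have "g dvd r" using assms(4) qr(2) by (simp add: dvd_add_right_iff)
  then have "r = 0" using qr(3) by (metis dvd_imp_degree_le leD)
  then show thesis using that qr by (simp add: mult.commute)
qed

end

lemma polys_mono: "F \<subseteq> F' \<Longrightarrow> polys F \<subseteq> polys F'"
  by (auto simp: polys_def)

lemma algebraic_over_mono: "F \<subseteq> F' \<Longrightarrow> algebraic_over F x \<Longrightarrow> algebraic_over F' x"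
  using polys_mono unfolding algebraic_over_def by blast

text \<open>Defined through least degree; irreducibility is not recorded, its consequences are
  derived from minimality where they occur.\<close>

definition minpoly :: "'b::field set \<Rightarrow> 'b \<Rightarrow> 'b poly" where
  "minpoly F x = (ARG_MIN deg f. f \<in> polys F \<and> lcf f = 1 \<and> poly f x = 0)"

context subfield_set
begin

lemma minpoly:
  assumes "algebraic_over F x"
  shows "minpoly F x \<in> polys F" "lcf (minpoly F x) = 1" "poly (minpoly F x) x = 0"
    and minpoly_min: "f \<in> polys F \<Longrightarrow> f \<noteq> 0 \<Longrightarrow> poly f x = 0 \<Longrightarrow> deg (minpoly F x) \<le> deg f"
proof -
  define P where "P = (\<lambda>f. f \<in> polys F \<and> lcf f = 1 \<and> poly f x = 0)"
  have monic: "P (Polynomial.smult (inverse (lcf f)) f)"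
    if "f \<in> polys F" "f \<noteq> 0" "poly f x = 0" for f
    using that by (auto simp: P_def coeff_mem)
  obtain f where f: "P f" using assms monic unfolding algebraic_over_def by blast
  have m: "P (minpoly F x)"
    unfolding minpoly_def P_def[symmetric] using arg_min_natI[where P = P and m = deg, OF f] .
  then show "minpoly F x \<in> polys F" "lcf (minpoly F x) = 1" "poly (minpoly F x) x = 0"
    by (auto simp: P_def)
  fix g assume g: "g \<in> polys F" "g \<noteq> 0" "poly g x = 0"
  have "deg (minpoly F x) \<le> deg (Polynomial.smult (inverse (lcf g)) g)"
    unfolding minpoly_def P_def[symmetric]
    using arg_min_nat_le[where P = P and m = deg, OF monic[OF g]] .
  also have "\<dots> = deg g" using g by simp
  finally show "deg (minpoly F x) \<le> deg g" .
qed

lemma minpoly_nonzero: "algebraic_over F x \<Longrightarrow> minpoly F x \<noteq> 0"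
  using minpoly(2) by force

lemma minpoly_dvd:
  assumes "algebraic_over F x" "f \<in> polys F" "poly f x = 0"
  shows "minpoly F x dvd f"
proof -
  note m = minpoly[OF assms(1)]
  obtain q r where qr: "q \<in> polys F" "r \<in> polys F" "f = q * minpoly F x + r"
      "r = 0 \<or> deg r < deg (minpoly F x)"
    using polys_division[OF m(1) minpoly_nonzero[OF assms(1)] assms(2)] by blast
  have "poly r x = 0" using qr(3) m(3) assms(3) by simp
  then have "r = 0" using minpoly_min[OF assms(1) qr(2)] qr(4) by force
  then show ?thesis using qr by simp
qed

lemma minpoly_deg_pos: "algebraic_over F x \<Longrightarrow> 0 < deg (minpoly F x)"
proof (rule ccontr)
  assume alg: "algebraic_over F x" and "\<not> 0 < deg (minpoly F x)"
  then obtain c where c: "minpoly F x = [:c:]" by (auto elim: degree_eq_zeroE)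
  then show False using minpoly(3)[OF alg] minpoly_nonzero[OF alg] by simp
qed

text \<open>The minimal polynomial of \<open>y\<close> divides that of \<open>x\<close>. If
  \<open>x\<close> were a root of the cofactor, the cofactor would have too small a degree; hence
  \<open>x\<close> is a root of \<open>minpoly F y\<close> and the cofactor is constant.\<close>

lemma minpoly_conjugate:
  assumes "algebraic_over F x" "poly (minpoly F x) y = 0"
  shows "algebraic_over F y" "minpoly F y = minpoly F x"
proof -
  note m = minpoly[OF assms(1)]
  show y: "algebraic_over F y"
    unfolding algebraic_over_def using m assms minpoly_nonzero by blast
  note n = minpoly[OF y]
  obtain q where q: "q \<in> polys F" "minpoly F x = minpoly F y * q"
    using polys_dvd_factor[OF n(1) minpoly_nonzero[OF y] m(1) minpoly_dvd[OF y m(1) assms(2)]] .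
  have q0: "q \<noteq> 0" using q minpoly_nonzero[OF assms(1)] by auto
  have d: "deg (minpoly F x) = deg (minpoly F y) + deg q"
    unfolding q(2) using q0 minpoly_nonzero[OF y] by (simp add: degree_mult_eq)
  have "poly (minpoly F y) x = 0"
  proof (rule ccontr)
    assume "poly (minpoly F y) x \<noteq> 0"
    then have "poly q x = 0" using m(3) q(2) by simp
    then show False using minpoly_min[OF assms(1) q(1) q0] d minpoly_deg_pos[OF y] by simp
  qed
  then have "deg q = 0" using minpoly_min[OF assms(1) n(1) minpoly_nonzero[OF y]] d by simp
  then obtain c where "q = [:c:]" by (auto elim: degree_eq_zeroE)
  then have "c = 1" using m(2) n(2) unfolding q(2) lead_coeff_mult by simp
  then show "minpoly F y = minpoly F x" using q(2) \<open>q = [:c:]\<close> by simp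
qed

text \<open>Euclidean descent on \<open>deg p\<close>: with \<open>minpoly F x = k * p + r\<close>,
  the value of \<open>r\<close> at \<open>x\<close> is minus that of \<open>k * p\<close>, so an
  inverse for \<open>r\<close> yields one for \<open>p\<close>.\<close>

lemma poly_inverse_mod:
  assumes "algebraic_over F x" "p \<in> polys F" "poly p x \<noteq> 0"
  shows "\<exists>q\<in>polys F. poly p x * poly q x = 1"
  using assms(2,3)
proof (induction "deg p" arbitrary: p rule: less_induct)
  case less
  note m = minpoly[OF assms(1)]
  have p0: "p \<noteq> 0" using less.prems by auto
  obtain k r where kr: "k \<in> polys F" "r \<in> polys F" "minpoly F x = k * p + r"
      "r = 0 \<or> deg r < deg p"
    using polys_division[OF less.prems(1) p0 m(1)] by blast
  have rx: "poly r x = - poly p x * poly k x" using m(3) kr(3) by (simp add: eq_neg_iff_add_eq_0 algebra_simps)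
  show ?case
  proof (cases "poly r x = 0")
    case False
    then have "deg r < deg p" using kr(4) by auto
    from less.hyps[OF this kr(2) False] obtain s where s: "s \<in> polys F" "poly r x * poly s x = 1"
      by auto
    show ?thesis
      by (rule bexI[of _ "- (k * s)"]) (use s rx kr in \<open>auto simp: algebra_simps\<close>)
  next
    \<comment> \<open>Then \<open>k\<close> vanishes at \<open>x\<close> too. By minimality
      \<open>p\<close> is a constant, or its degree is at least that of the minimal polynomial and
      it can be reduced modulo the latter.\<close>
    case True
    then have kx: "poly k x = 0" using rx less.prems by simp
    have mod: "\<not> deg p < deg (minpoly F x) \<or> r = 0"
    proof (cases "r = 0")
      case False
      then show ?thesis using kr(4) minpoly_min[OF assms(1) kr(2) False True] by auto
    qed simp
    have "\<not> (r = 0 \<and> deg p > 0)"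
    proof
      assume *: "r = 0 \<and> deg p > 0"
      then have "minpoly F x = k * p" using kr by simp
      moreover have "k \<noteq> 0" using calculation minpoly_nonzero[OF assms(1)] by auto
      ultimately show False
        using minpoly_min[OF assms(1) kr(1) _ kx] * p0 by (simp add: degree_mult_eq)
    qed
    then consider "deg p = 0" | "r \<noteq> 0" by auto
    then show ?thesis
    proof cases
      case 1
      then obtain c where c: "p = [:c:]" by (auto elim: degree_eq_zeroE)
      then show ?thesis using less.prems by (intro bexI[of _ "[:inverse c:]"]) auto
    next
      case 2
      have dp: "deg p \<ge> deg (minpoly F x)" using mod 2 by auto
      obtain k' r' where kr': "k' \<in> polys F" "r' \<in> polys F" "p = k' * minpoly F x + r'"
        "r' = 0 \<or> deg r' < deg (minpoly F x)"
        using polys_division[OF m(1) minpoly_nonzero[OF assms(1)] less.prems(1)] by blast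
      have "poly r' x = poly p x" using kr'(3) m(3) by simp
      moreover from this have "deg r' < deg p" using kr'(4) dp less.prems by fastforce
      ultimately show ?thesis using less.hyps[of r'] less.prems kr'(2) by auto
    qed
  qed
qed

lemma simple_extension_superset: "F \<subseteq> {poly p x |p. p \<in> polys F}"
proof
  fix c assume "c \<in> F"
  then have "c = poly [:c:] x" "[:c:] \<in> polys F" by auto
  then show "c \<in> {poly p x |p. p \<in> polys F}" by blast
qed

lemma simple_extension_generator: "x \<in> {poly p x |p. p \<in> polys F}"
proof -
  have "x = poly [:0, 1:] x" "[:0, 1:] \<in> polys F" by auto
  then show ?thesis by blast
qed

lemma subfield_set_simple_extension:
  assumes "algebraic_over F x"
  shows "subfield_set {poly p x |p. p \<in> polys F}"
proof
  fix y z assume "y \<in> {poly p x |p. p \<in> polys F}" "z \<in> {poly p x |p. p \<in> polys F}"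
  then obtain p q where p: "p \<in> polys F" "y = poly p x" and q: "q \<in> polys F" "z = poly q x" by auto
  show "y + z \<in> {poly p x |p. p \<in> polys F}" using p q poly_add polys_add
    by (metis (mono_tags, lifting) mem_Collect_eq)
  show "y * z \<in> {poly p x |p. p \<in> polys F}" using p q poly_mult polys_mult
    by (metis (mono_tags, lifting) mem_Collect_eq)
  show "- y \<in> {poly p x |p. p \<in> polys F}" using p poly_minus polys_uminus
    by (metis (mono_tags, lifting) mem_Collect_eq)
  show "inverse y \<in> {poly p x |p. p \<in> polys F}"
  proof (cases "y = 0")
    case True
    then show ?thesis using p by auto
  next
    case False
    then obtain q where "q \<in> polys F" "y * poly q x = 1"
      using poly_inverse_mod[OF assms p(1)] p(2) by auto
    then show ?thesis by (auto dest: inverse_unique)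
  qed
qed (use poly_0 poly_1 polys_0 polys_1 in \<open>metis (mono_tags, lifting) mem_Collect_eq\<close>)+

end

section \<open>Roots counted with multiplicity\<close>

lemma proots_prod_linear: "proots (\<Prod>r\<in>#A. [:-r, 1:]) = (A :: 'b::field multiset)"
proof (induction A)
  case (add x A)
  have "(\<Prod>x\<in>#A. [:-x, 1:]) \<noteq> 0" by (auto simp: prod_mset_zero_iff)
  then show ?case using add by (simp only: image_mset_add_mset prod_mset.add_mset)
     (subst proots_mult, auto)
qed auto

lemma poly_splits:
  fixes p :: "'b::alg_closed_field poly"
  assumes "p \<noteq> 0"
  shows "p = Polynomial.smult (lcf p) (\<Prod>x\<in>#proots p. [:-x, 1:])" "size (proots p) = deg p"
proof -
  obtain A where A: "size A = deg p" "p = Polynomial.smult (lcf p) (\<Prod>x\<in>#A. [:-x, 1:])"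
    using alg_closed_imp_factorization[OF assms] by blast
  have "proots p = proots (\<Prod>x\<in>#A. [:-x, 1:])"
    by (subst A(2)) (use assms in simp)
  then have "proots p = A" by (simp only: proots_prod_linear)
  with A show "p = Polynomial.smult (lcf p) (\<Prod>x\<in>#proots p. [:-x, 1:])" "size (proots p) = deg p"
    by simp_all
qed

lemma poly_eq_prod_roots:
  fixes p :: "'b::alg_closed_field poly"
  assumes "p \<noteq> 0"
  shows "poly p y = lcf p * (\<Prod>x\<in>#proots p. y - x)"
proof -
  have "poly p y = poly (Polynomial.smult (lcf p) (\<Prod>x\<in>#proots p. [:-x, 1:])) y"
    using poly_splits(1)[OF assms] by simp
  also have "\<dots> = lcf p * (\<Prod>x\<in>#proots p. y - x)"
    by (simp add: poly_prod_mset image_mset.compositionality o_def)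
  finally show ?thesis .
qed

section \<open>Extension of field embeddings\<close>

locale field_emb =
  fixes \<sigma> :: "'b::field \<Rightarrow> 'c::field"
  assumes hom_one [simp]: "\<sigma> 1 = 1"
    and hom_add [simp]: "\<sigma> (x + y) = \<sigma> x + \<sigma> y"
    and hom_mult [simp]: "\<sigma> (x * y) = \<sigma> x * \<sigma> y"
begin

lemma hom_zero [simp]: "\<sigma> 0 = 0"
  using hom_add[of 0 0] by (metis add.right_neutral add_left_cancel)

lemma hom_uminus [simp]: "\<sigma> (- x) = - \<sigma> x"
  using hom_add[of x "- x"] by (simp add: eq_neg_iff_add_eq_0 add.commute)

lemma hom_diff [simp]: "\<sigma> (x - y) = \<sigma> x - \<sigma> y"
  using hom_add[of x "- y"] by simp

lemma hom_eq_0_iff [simp]: "\<sigma> x = 0 \<longleftrightarrow> x = 0"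
proof
  assume "\<sigma> x = 0"
  then have "\<sigma> (x * inverse x) = 0" by simp
  then show "x = 0" by (metis hom_one right_inverse zero_neq_one)
qed simp

lemma hom_eq_iff [simp]: "\<sigma> x = \<sigma> y \<longleftrightarrow> x = y"
  using hom_eq_0_iff[of "x - y"] by simp

lemma hom_inverse [simp]: "\<sigma> (inverse x) = inverse (\<sigma> x)"
proof (cases "x = 0")
  case False
  then have "\<sigma> x * \<sigma> (inverse x) = 1" using hom_mult[of x "inverse x"] by simp
  then show ?thesis by (metis inverse_unique)
qed simp

lemma hom_divide [simp]: "\<sigma> (x / y) = \<sigma> x / \<sigma> y"
  by (simp add: divide_inverse)

lemma hom_power [simp]: "\<sigma> (x ^ n) = \<sigma> x ^ n"
  by (induction n) auto

lemma hom_sum: "\<sigma> (sum f A) = (\<Sum>i\<in>A. \<sigma> (f i))"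
  by (induction A rule: infinite_finite_induct) auto

lemma hom_prod_mset: "\<sigma> (prod_mset A) = (\<Prod>x\<in>#A. \<sigma> x)"
  by (induction A) auto

lemma deg_map_poly [simp]: "deg (map_poly \<sigma> p) = deg p"
  by (rule degree_map_poly) auto

lemma cf_map_poly [simp]: "cf (map_poly \<sigma> p) i = \<sigma> (cf p i)"
  by (simp add: coeff_map_poly)

lemma map_poly_eq_0_iff' [simp]: "map_poly \<sigma> p = 0 \<longleftrightarrow> p = 0"
  by (auto simp: poly_eq_iff)

lemma map_poly_add [simp]: "map_poly \<sigma> (p + q) = map_poly \<sigma> p + map_poly \<sigma> q"
  by (auto simp: poly_eq_iff)

lemma map_poly_mult [simp]: "map_poly \<sigma> (p * q) = map_poly \<sigma> p * map_poly \<sigma> q"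
  by (auto simp: poly_eq_iff coeff_mult hom_sum)

lemma map_poly_pCons' [simp]: "map_poly \<sigma> (pCons c p) = pCons (\<sigma> c) (map_poly \<sigma> p)"
  by (auto simp: poly_eq_iff coeff_pCons split: nat.splits)

lemma poly_map_poly [simp]: "poly (map_poly \<sigma> p) (\<sigma> x) = \<sigma> (poly p x)"
  by (induction p) auto

lemma map_poly_pderiv: "map_poly \<sigma> (pderiv p) = pderiv (map_poly \<sigma> p)"
proof -
  have "\<sigma> (of_nat n) = of_nat n" for n by (induction n) auto
  then show ?thesis by (auto simp: poly_eq_iff coeff_pderiv simp del: of_nat_Suc)
qed

end

text \<open>The factorization takes place in the algebraically closed domain and is carried over
  factor by factor.\<close>

lemma proots_map_poly:
  fixes \<sigma> :: "'a::alg_closed_field \<Rightarrow> 'b::field"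
  assumes "field_emb \<sigma>"
  shows "proots (map_poly \<sigma> f) = image_mset \<sigma> (proots f)"
proof (cases "f = 0")
  case False
  interpret field_emb \<sigma> by fact
  have mp: "map_poly \<sigma> (\<Prod>r\<in>#A. [:-r, 1:]) = (\<Prod>r\<in>#image_mset \<sigma> A. [:-r, 1:])" for A
    by (induction A) (simp_all add: one_pCons del: mult_pCons_left)
  have "map_poly \<sigma> f = Polynomial.smult (\<sigma> (lcf f)) (map_poly \<sigma> (\<Prod>r\<in>#proots f. [:-r, 1:]))"
    using poly_splits(1)[OF False] map_poly_mult[of "[:lcf f:]" "\<Prod>r\<in>#proots f. [:-r, 1:]"]
    by simp
  then have "map_poly \<sigma> f = Polynomial.smult (\<sigma> (lcf f)) (\<Prod>r\<in>#image_mset \<sigma> (proots f). [:-r, 1:])"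
    by (simp only: mp)
  then show ?thesis
    using False proots_smult[of "\<sigma> (lcf f)"] proots_prod_linear[of "image_mset \<sigma> (proots f)"]
    by (metis hom_eq_0_iff leading_coeff_0_iff)
qed simp

definition pair_polys :: "('b::field \<times> 'c::field) set \<Rightarrow> ('b poly \<times> 'c poly) set" where
  "pair_polys G = {(p, p'). \<forall>i. (cf p i, cf p' i) \<in> G}"

text \<open>Partial embeddings are handled as graphs: subrings of the product ring.\<close>

locale pair_ring =
  fixes G :: "('b::field \<times> 'c::field) set"
  assumes pair_zero [simp]: "(0, 0) \<in> G" and pair_one [simp]: "(1, 1) \<in> G"
    and pair_add [simp]: "(x, x') \<in> G \<Longrightarrow> (y, y') \<in> G \<Longrightarrow> (x + y, x' + y') \<in> G"
    and pair_mult [simp]: "(x, x') \<in> G \<Longrightarrow> (y, y') \<in> G \<Longrightarrow> (x * y, x' * y') \<in> G"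
    and pair_uminus [simp]: "(x, x') \<in> G \<Longrightarrow> (- x, - x') \<in> G"
begin

lemma pair_diff [simp]: "(x, x') \<in> G \<Longrightarrow> (y, y') \<in> G \<Longrightarrow> (x - y, x' - y') \<in> G"
  using pair_add[of x x' "- y" "- y'"] by simp

lemma pair_sum: "(\<And>i. i \<in> A \<Longrightarrow> (f i, g i) \<in> G) \<Longrightarrow> (sum f A, sum g A) \<in> G"
  by (induction A rule: infinite_finite_induct) auto

lemma pp_0 [simp]: "(0, 0) \<in> pair_polys G"
  by (auto simp: pair_polys_def)

lemma pp_pCons: "(c, c') \<in> G \<Longrightarrow> (p, p') \<in> pair_polys G \<Longrightarrow> (pCons c p, pCons c' p') \<in> pair_polys G"
  by (auto simp: pair_polys_def coeff_pCons split: nat.splits)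

lemma pp_const: "(c, c') \<in> G \<Longrightarrow> ([:c:], [:c':]) \<in> pair_polys G"
  by (intro pp_pCons) auto

lemma pp_1 [simp]: "(1, 1) \<in> pair_polys G"
  using pp_const[of 1 1] by (simp add: one_pCons)

lemma pp_add: "(p, p') \<in> pair_polys G \<Longrightarrow> (q, q') \<in> pair_polys G \<Longrightarrow> (p + q, p' + q') \<in> pair_polys G"
  by (auto simp: pair_polys_def)

lemma pp_uminus: "(p, p') \<in> pair_polys G \<Longrightarrow> (- p, - p') \<in> pair_polys G"
  by (auto simp: pair_polys_def)

lemma pp_diff: "(p, p') \<in> pair_polys G \<Longrightarrow> (q, q') \<in> pair_polys G \<Longrightarrow> (p - q, p' - q') \<in> pair_polys G"
  by (auto simp: pair_polys_def)

lemma pp_mult: "(p, p') \<in> pair_polys G \<Longrightarrow> (q, q') \<in> pair_polys G \<Longrightarrow> (p * q, p' * q') \<in> pair_polys G"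
  by (auto simp: pair_polys_def coeff_mult intro!: pair_sum)

lemma pp_power: "(p, p') \<in> pair_polys G \<Longrightarrow> (p ^ n, p' ^ n) \<in> pair_polys G"
  by (induction n) (auto simp: pp_mult)

lemma pp_cf: "(p, p') \<in> pair_polys G \<Longrightarrow> (cf p i, cf p' i) \<in> G"
  by (auto simp: pair_polys_def)

end

text \<open>For a \<open>pair_ring\<close> \<open>G\<close>, the subring of the product ring
  generated by \<open>G\<close> and the pair \<open>(y, y')\<close>. In general it is only a
  relation; it is a graph when \<open>root_pair_iff\<close> applies.\<close>

definition adjoin_pair :: "('b::field \<times> 'c::field) set \<Rightarrow> 'b \<Rightarrow> 'c \<Rightarrow> ('b \<times> 'c) set" where
  "adjoin_pair G y y' = {(poly p y, poly p' y') |p p'. (p, p') \<in> pair_polys G}"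

context pair_ring
begin

lemma adjoin_pairI: "(p, p') \<in> pair_polys G \<Longrightarrow> (poly p y, poly p' y') \<in> adjoin_pair G y y'"
  by (auto simp: adjoin_pair_def)

lemma pair_ring_adjoin: "pair_ring (adjoin_pair G y y')"
proof
  fix a a' b b' assume "(a, a') \<in> adjoin_pair G y y'" "(b, b') \<in> adjoin_pair G y y'"
  then obtain p p' q q' where *: "(p, p') \<in> pair_polys G" "a = poly p y" "a' = poly p' y'"
    "(q, q') \<in> pair_polys G" "b = poly q y" "b' = poly q' y'"
    by (auto simp: adjoin_pair_def)
  show "(a + b, a' + b') \<in> adjoin_pair G y y'"
    using adjoin_pairI[OF pp_add[OF *(1,4)], of y y'] * by simp
  show "(a * b, a' * b') \<in> adjoin_pair G y y'"
    using adjoin_pairI[OF pp_mult[OF *(1,4)], of y y'] * by simp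
  show "(- a, - a') \<in> adjoin_pair G y y'"
    using adjoin_pairI[OF pp_uminus[OF *(1)], of y y'] * by simp
qed (use adjoin_pairI[OF pp_0, of y y'] adjoin_pairI[OF pp_1, of y y'] in auto)

lemma adjoin_pair_mono: "G \<subseteq> adjoin_pair G y y'"
proof clarify
  fix a b assume "(a, b) \<in> G"
  from adjoin_pairI[OF pp_const[OF this], of y y'] show "(a, b) \<in> adjoin_pair G y y'" by simp
qed

lemma adjoin_pair_gen: "(y, y') \<in> adjoin_pair G y y'"
  using adjoin_pairI[of "[:0, 1:]" "[:0, 1:]" y y'] by (simp add: pp_pCons)

end

text \<open>The graph of an isomorphism between two subfields: by additivity the zero condition
  makes it single-valued in both directions.\<close>

locale pair_iso = pair_ring +
  assumes pair_inverse [simp]: "(x, x') \<in> G \<Longrightarrow> (inverse x, inverse x') \<in> G"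
    and pair_eq_0: "(x, x') \<in> G \<Longrightarrow> x = 0 \<longleftrightarrow> x' = 0"
begin

lemma pair_unique: "(x, a) \<in> G \<Longrightarrow> (x, b) \<in> G \<Longrightarrow> a = b"
  using pair_diff[of x a x b] pair_eq_0[of 0 "a - b"] by auto

lemma subfield_set_dom: "subfield_set (fst ` G)"
proof
  fix x y assume "x \<in> fst ` G" "y \<in> fst ` G"
  then obtain x' y' where *: "(x, x') \<in> G" "(y, y') \<in> G" by force
  show "x + y \<in> fst ` G" "x * y \<in> fst ` G" "- x \<in> fst ` G" "inverse x \<in> fst ` G"
    using pair_add[OF *] pair_mult[OF *] pair_uminus[OF *(1)] pair_inverse[OF *(1)]
    by (metis fst_conv image_eqI)+
qed (metis fst_conv image_eqI pair_zero pair_one)+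

lemma pp_exists:
  assumes "p \<in> polys (fst ` G)"
  obtains p' where "(p, p') \<in> pair_polys G"
proof -
  define h where "h = (\<lambda>x. SOME x'. (x, x') \<in> G)"
  have h: "(x, h x) \<in> G" if "x \<in> fst ` G" for x
    using that unfolding h_def by (auto intro: someI)
  have "h 0 = 0" using pair_unique[OF h pair_zero] by (metis fst_conv image_eqI pair_zero)
  then have "(p, map_poly h p) \<in> pair_polys G"
    using assms by (auto simp: pair_polys_def coeff_map_poly polys_def h)
  then show thesis using that by blast
qed

lemma pp_unique: "(p, a) \<in> pair_polys G \<Longrightarrow> (p, b) \<in> pair_polys G \<Longrightarrow> a = b"
  unfolding pair_polys_def poly_eq_iff using pair_unique by blast

lemma pp_polys: "(p, p') \<in> pair_polys G \<Longrightarrow> p \<in> polys (fst ` G)"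
  by (force simp: pair_polys_def polys_def)

lemma pp_deg: assumes "(p, p') \<in> pair_polys G" shows "deg p' = deg p"
proof -
  have "cf p i = 0 \<longleftrightarrow> cf p' i = 0" for i
    using pair_eq_0 assms by (auto simp: pair_polys_def)
  then show ?thesis by (metis le_antisym le_degree leading_coeff_0_iff degree_0 linear le_zero_eq)
qed

lemma pp_eq_0: "(p, p') \<in> pair_polys G \<Longrightarrow> p = 0 \<longleftrightarrow> p' = 0"
  unfolding pair_polys_def poly_eq_iff using pair_eq_0 by auto

lemma pp_monic: "(p, p') \<in> pair_polys G \<Longrightarrow> lcf p = 1 \<Longrightarrow> lcf p' = 1"
  using pp_cf[of p p' "deg p"] pair_unique pair_one pp_deg by metis

text \<open>A polynomial vanishing at \<open>y\<close> is a multiple of the minimal polynomial, and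
  the factorization transfers to the second components. For the converse this is applied to
  \<open>p * q - 1\<close>, where \<open>q\<close> inverts \<open>p\<close> at
  \<open>y\<close>.\<close>

lemma root_pair_iff:
  assumes alg: "algebraic_over (fst ` G) y" and f: "(minpoly (fst ` G) y, f') \<in> pair_polys G"
    and y': "poly f' y' = 0" and p: "(p, p') \<in> pair_polys G"
  shows "poly p y = 0 \<longleftrightarrow> poly p' y' = 0"
proof -
  interpret D: subfield_set "fst ` G" by (rule subfield_set_dom)
  have imp: "poly p' y' = 0" if asm: "(p, p') \<in> pair_polys G" "poly p y = 0" for p p'
  proof -
    have "minpoly (fst ` G) y dvd p" using D.minpoly_dvd[OF alg pp_polys[OF asm(1)] asm(2)] .
    then obtain q where q: "q \<in> polys (fst ` G)" "p = minpoly (fst ` G) y * q"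
      using D.polys_dvd_factor[OF D.minpoly(1)[OF alg] D.minpoly_nonzero[OF alg] pp_polys[OF asm(1)]]
      by blast
    obtain q' where q': "(q, q') \<in> pair_polys G" using pp_exists[OF q(1)] .
    have "p' = f' * q'" using pp_unique[OF asm(1)] pp_mult[OF f q'] q(2) by simp
    then show ?thesis using y' by simp
  qed
  moreover have False if asm: "poly p y \<noteq> 0" "poly p' y' = 0"
  proof -
    obtain q where q: "q \<in> polys (fst ` G)" "poly p y * poly q y = 1"
      using D.poly_inverse_mod[OF alg pp_polys[OF p] asm(1)] by blast
    obtain q' where q': "(q, q') \<in> pair_polys G" using pp_exists[OF q(1)] .
    have "poly (p' * q' - 1) y' = 0"
      by (rule imp[of "p * q - 1"]) (use q p q' in \<open>auto intro: pp_mult pp_diff\<close>)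
    then show False using asm by simp
  qed
  ultimately show ?thesis using p by blast
qed

end

definition pair_invariant :: "('b \<Rightarrow> 'd) \<Rightarrow> ('b \<times> 'b) set \<Rightarrow> bool" where
  "pair_invariant u G \<longleftrightarrow> (\<forall>(x, y)\<in>G. u x = u y)"

text \<open>What \<open>u\<close> must satisfy for an invariant graph to remain invariant after
  passing to fractions. It is used for the test \<open>x = 0\<close> and for valuations.\<close>

definition field_invariant :: "('b::field \<Rightarrow> 'd) \<Rightarrow> bool" where
  "field_invariant u \<longleftrightarrow> (\<forall>x y. u x = u y \<longrightarrow> (x = 0 \<longleftrightarrow> y = 0)) \<and>
     (\<forall>a b c d. u a = u b \<longrightarrow> u c = u d \<longrightarrow> u (a / c) = u (b / d))"

lemma pair_invariant_localization:
  fixes G :: "('b::field \<times> 'b) set"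
  assumes "pair_ring G" "pair_invariant u G" "field_invariant u"
  defines "G' \<equiv> {(a / c, b / d) |a b c d. (a, b) \<in> G \<and> (c, d) \<in> G \<and> c \<noteq> 0}"
  shows "pair_ring G'" "pair_invariant u G'" "G \<subseteq> G'" "(x, x') \<in> G \<Longrightarrow> (inverse x, inverse x') \<in> G'"
proof -
  interpret pair_ring G by fact
  have nz: "d \<noteq> 0" if "(c, d) \<in> G" "c \<noteq> 0" for c d
    using assms(2,3) that unfolding pair_invariant_def field_invariant_def by blast
  show sub: "G \<subseteq> G'"
  proof clarify
    fix a b assume "(a, b) \<in> G"
    then have "(a, b) = (a / 1, b / 1) \<and> (a, b) \<in> G \<and> (1, 1) \<in> G \<and> (1::'b) \<noteq> 0" by simp
    then show "(a, b) \<in> G'" unfolding G'_def mem_Collect_eq by blast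
  qed
  show "pair_invariant u G'"
    using assms(2,3) unfolding G'_def pair_invariant_def field_invariant_def by blast
  show "(inverse x, inverse x') \<in> G'" if x: "(x, x') \<in> G"
  proof (cases "x = 0")
    case True
    then have "x' = 0" using x assms(2,3) unfolding pair_invariant_def field_invariant_def by blast
    then show ?thesis using True sub pair_zero by auto
  next
    case False
    moreover have "inverse x = 1 / x" "inverse x' = 1 / x'" by (simp_all add: divide_inverse)
    ultimately show ?thesis unfolding G'_def using x pair_one by blast
  qed
  show "pair_ring G'"
  proof
    show "(0, 0) \<in> G'" "(1, 1) \<in> G'" using sub pair_zero pair_one by auto
    fix x x' y y' assume "(x, x') \<in> G'" "(y, y') \<in> G'"
    then obtain a b c d e f g h where *: "(a, b) \<in> G" "(c, d) \<in> G" "c \<noteq> 0"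
      "x = a / c" "x' = b / d" "(e, f) \<in> G" "(g, h) \<in> G" "g \<noteq> 0" "y = e / g" "y' = f / h"
      unfolding G'_def by blast
    have "d \<noteq> 0" "h \<noteq> 0" using nz * by auto
    have "x + y = (a * g + e * c) / (c * g)" "x' + y' = (b * h + f * d) / (d * h)"
      using * \<open>d \<noteq> 0\<close> \<open>h \<noteq> 0\<close> by (simp_all add: field_simps)
    moreover have "(a * g + e * c, b * h + f * d) \<in> G" "(c * g, d * h) \<in> G" "c * g \<noteq> 0"
      using * by auto
    ultimately show "(x + y, x' + y') \<in> G'" unfolding G'_def by blast
    have "x * y = (a * e) / (c * g)" "x' * y' = (b * f) / (d * h)" using * by simp_all
    moreover have "(a * e, b * f) \<in> G" "(c * g, d * h) \<in> G" "c * g \<noteq> 0" using * by auto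
    ultimately show "(x * y, x' * y') \<in> G'" unfolding G'_def by blast
    have "- x = (- a) / c" "- x' = (- b) / d" using * by auto
    moreover have "(- a, - b) \<in> G" using * by auto
    ultimately show "(- x, - x') \<in> G'" unfolding G'_def using * by blast
  qed
qed

lemma pair_ring_Union_chain:
  assumes "C \<noteq> {}" "\<And>G G'. G \<in> C \<Longrightarrow> G' \<in> C \<Longrightarrow> G \<subseteq> G' \<or> G' \<subseteq> G" "\<And>G. G \<in> C \<Longrightarrow> pair_ring G"
  shows "pair_ring (\<Union>C)"
proof
  show "(0, 0) \<in> \<Union>C" "(1, 1) \<in> \<Union>C"
    using assms(1,3) pair_ring.pair_zero pair_ring.pair_one by blast+
  fix x x' y y' assume "(x, x') \<in> \<Union>C" "(y, y') \<in> \<Union>C"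
  then obtain G where G: "G \<in> C" "(x, x') \<in> G" "(y, y') \<in> G" using assms(2) by blast
  interpret pair_ring G using assms(3) G(1) .
  show "(x + y, x' + y') \<in> \<Union>C" "(x * y, x' * y') \<in> \<Union>C" "(- x, - x') \<in> \<Union>C"
    using G by (meson UnionI pair_add pair_mult pair_uminus)+
qed

text \<open>A graph maximal by Zorn's Lemma contains its own fractions, hence is a
  \<open>pair_iso\<close>, and \<open>step\<close> leaves no element outside its domain.
  Surjectivity is not claimed.\<close>

theorem extend_embedding:
  fixes G0 :: "('b::field \<times> 'b) set"
  assumes G0: "pair_ring G0" "pair_invariant u G0" and u: "field_invariant u"
    and step: "\<And>G y. G0 \<subseteq> G \<Longrightarrow> pair_iso G \<Longrightarrow> pair_invariant u G \<Longrightarrow> \<exists>y'. pair_invariant u (adjoin_pair G y y')"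
  shows "\<exists>\<sigma>. field_emb \<sigma> \<and> (\<forall>(x, y)\<in>G0. \<sigma> x = y) \<and> (\<forall>x. u (\<sigma> x) = u x)"
proof -
  define A where "A = {G. G0 \<subseteq> G \<and> pair_ring G \<and> pair_invariant u G}"
  have ex_max: "\<exists>M\<in>A. \<forall>N\<in>A. M \<subseteq> N \<longrightarrow> N = M"
  proof (rule subset_Zorn_nonempty)
    show "A \<noteq> {}" using G0 by (auto simp: A_def)
    fix C assume C: "C \<noteq> {}" "subset.chain A C"
    then have "pair_ring (\<Union>C)"
      by (intro pair_ring_Union_chain) (auto simp: A_def subset_chain_def)
    moreover have "pair_invariant u (\<Union>C)" using C by (auto simp: A_def subset_chain_def pair_invariant_def)
    moreover have "G0 \<subseteq> \<Union>C" using C by (force simp: A_def subset_chain_def)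
    ultimately show "\<Union>C \<in> A" by (simp add: A_def)
  qed
  from ex_max obtain M where "M \<in> A" and "\<forall>N\<in>A. M \<subseteq> N \<longrightarrow> N = M" by (elim bexE)
  then have max': "N = M" if "N \<in> A" "M \<subseteq> N" for N using that by simp
  have M: "G0 \<subseteq> M" "pair_ring M" "pair_invariant u M" using \<open>M \<in> A\<close> by (simp_all add: A_def)
  have max: "N = M" if "M \<subseteq> N" "pair_ring N" "pair_invariant u N" for N
    using max'[of N] that M(1) by (simp add: A_def)
  interpret pair_ring M by fact
  interpret pair_iso M
  proof
    fix x x' assume x: "(x, x') \<in> M"
    note loc = pair_invariant_localization[OF M(2,3) u]
    show "(inverse x, inverse x') \<in> M"
      using loc(4)[OF x] unfolding max[OF loc(3) loc(1,2)] .
    show "x = 0 \<longleftrightarrow> x' = 0" using x M(3) u unfolding pair_invariant_def field_invariant_def by blast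
  qed
  have total: "\<exists>y'. (y, y') \<in> M" for y
  proof -
    obtain y' where y': "pair_invariant u (adjoin_pair M y y')"
      using step[OF M(1) pair_iso_axioms M(3), of y] by blast
    have "adjoin_pair M y y' = M"
      using max[OF adjoin_pair_mono pair_ring_adjoin y'] .
    then show ?thesis using adjoin_pair_gen[of y y'] by auto
  qed
  define \<sigma> where "\<sigma> = (\<lambda>x. SOME x'. (x, x') \<in> M)"
  have \<sigma>: "(x, \<sigma> x) \<in> M" for x unfolding \<sigma>_def using total[of x] by (rule someI_ex)
  have \<sigma>_eq: "\<sigma> x = x'" if "(x, x') \<in> M" for x x' using pair_unique[OF \<sigma> that] .
  have "field_emb \<sigma>"
    by unfold_locales (use \<sigma> in \<open>auto intro!: \<sigma>_eq\<close>)
  moreover have "u (\<sigma> x) = u x" for x using \<sigma>[of x] M(3) by (auto simp: pair_invariant_def)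
  ultimately show ?thesis using M(1) \<sigma>_eq by blast
qed

text \<open>With the zero test as invariant, \<open>y\<close> may be sent to any root of its
  transported minimal polynomial.\<close>

lemma extend_embedding_algebraic:
  fixes G0 :: "('b::alg_closed_field \<times> 'b) set"
  assumes G0: "pair_ring G0" and zero: "\<And>x y. (x, y) \<in> G0 \<Longrightarrow> x = 0 \<longleftrightarrow> y = 0"
    and alg: "\<And>y. algebraic_over (fst ` G0) y"
  shows "\<exists>\<sigma>. field_emb \<sigma> \<and> (\<forall>(x, y)\<in>G0. \<sigma> x = y)"
proof -
  have "\<exists>\<sigma>. field_emb \<sigma> \<and> (\<forall>(x, y)\<in>G0. \<sigma> x = y) \<and> (\<forall>x. (\<lambda>x. x = 0) (\<sigma> x) = (\<lambda>x. x = 0) x)"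
  proof (rule extend_embedding[OF G0])
    show "pair_invariant (\<lambda>x. x = 0) G0" using zero by (auto simp: pair_invariant_def)
    show "field_invariant (\<lambda>x::'b. x = 0)" by (auto simp: field_invariant_def)
    fix G and y :: 'b assume G: "G0 \<subseteq> G" "pair_iso G"
    interpret pair_iso G by fact
    interpret D: subfield_set "fst ` G" by (rule subfield_set_dom)
    have a: "algebraic_over (fst ` G) y"
      using algebraic_over_mono[OF _ alg] G(1) by (simp add: image_mono)
    obtain f' where f': "(minpoly (fst ` G) y, f') \<in> pair_polys G"
      using pp_exists[OF D.minpoly(1)[OF a]] .
    have "deg f' > 0" using pp_deg[OF f'] D.minpoly_deg_pos[OF a] by simp
    then obtain y' where y': "poly f' y' = 0" using alg_closed_imp_poly_has_root by blast
    show "\<exists>y'. pair_invariant (\<lambda>x. x = 0) (adjoin_pair G y y')"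
      by (rule exI[of _ y']) (auto simp: pair_invariant_def adjoin_pair_def root_pair_iff[OF a f' y'])
  qed
  then show ?thesis by blast
qed

lemma pair_iso_Id_on: "subfield_set F \<Longrightarrow> pair_iso (Id_on F)"
  unfolding subfield_set_def pair_iso_def pair_ring_def pair_iso_axioms_def by auto

lemma pair_polys_Id_on [simp]: "(p, p') \<in> pair_polys (Id_on F) \<longleftrightarrow> p = p' \<and> p \<in> polys F"
  by (auto simp: pair_polys_def polys_def poly_eq_iff Id_on_iff)

lemma fst_Id_on [simp]: "fst ` Id_on F = F"
  by force

text \<open>\<open>y\<close> and \<open>y'\<close> are annihilated by the same polynomials over
  \<open>F\<close>, so the identity of \<open>F\<close> together with \<open>(y, y')\<close>
  generates a graph that respects zero and extends.\<close>

lemma conjugate_embedding: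
  fixes F :: "'b::alg_closed_field set"
  assumes F: "subfield_set F" and alg: "\<And>x. algebraic_over F x" and y': "poly (minpoly F y) y' = 0"
  shows "\<exists>\<sigma>. field_emb \<sigma> \<and> (\<forall>x\<in>F. \<sigma> x = x) \<and> \<sigma> y = y'"
proof -
  interpret subfield_set F by fact
  interpret pair_iso "Id_on F" by (rule pair_iso_Id_on[OF F])
  have sub: "F \<subseteq> fst ` adjoin_pair (Id_on F) y y'" using adjoin_pair_mono[of y y'] by force
  have "\<exists>\<sigma>. field_emb \<sigma> \<and> (\<forall>(a, b)\<in>adjoin_pair (Id_on F) y y'. \<sigma> a = b)"
  proof (rule extend_embedding_algebraic)
    show "pair_ring (adjoin_pair (Id_on F) y y')" by (rule pair_ring_adjoin)
    show "algebraic_over (fst ` adjoin_pair (Id_on F) y y') x" for x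
      using algebraic_over_mono[OF sub alg] .
    fix a b assume "(a, b) \<in> adjoin_pair (Id_on F) y y'"
    then obtain p where "p \<in> polys F" "a = poly p y" "b = poly p y'"
      by (auto simp: adjoin_pair_def)
    then show "a = 0 \<longleftrightarrow> b = 0"
      using root_pair_iff[of y "minpoly F y" y' p p] alg y' minpoly(1)[OF alg] by simp
  qed
  then obtain \<sigma> where "field_emb \<sigma>" "\<forall>(a, b)\<in>adjoin_pair (Id_on F) y y'. \<sigma> a = b" by blast
  then show ?thesis
    using adjoin_pair_mono[of y y'] adjoin_pair_gen[of y y'] by (intro exI[of _ \<sigma>]) fastforce
qed

section \<open>Valuations\<close>

text \<open>Multiples by natural numbers in any commutative monoid, so that one notation covers
  \<open>'g\<close> and \<open>'g extended\<close>.\<close>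

primrec nmul :: "nat \<Rightarrow> 'c::comm_monoid_add \<Rightarrow> 'c" where
  "nmul 0 x = 0"
| "nmul (Suc n) x = x + nmul n x"

lemma sum_lessThan_const: "(\<Sum>i<n. x) = nmul n x"
  by (induction n) (auto simp: add.commute)

lemma nmul_zero [simp]: "nmul n 0 = 0"
  by (induction n) auto

lemma nmul_add_left: "nmul (m + n) x = nmul m x + nmul n x"
  by (induction m) (auto simp: algebra_simps)

lemma nmul_uminus: "nmul n (- x :: 'g::ab_group_add) = - nmul n x"
  by (induction n) auto

lemma nmul_Fin [simp]: "nmul n (Fin x) = Fin (nmul n x)"
  by (induction n) (auto simp: zero_extended_def)

lemma nmul_mono: "x \<le> y \<Longrightarrow> nmul n x \<le> nmul n (y :: 'g::ordered_ab_semigroup_monoid_add_imp_le)"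
  by (induction n) (auto intro: add_mono)

lemma nmul_strict_mono: "n > 0 \<Longrightarrow> x < y \<Longrightarrow> nmul n x < nmul n (y :: 'g::linordered_ab_group_add)"
proof (induction n)
  case (Suc n)
  then show ?case by (simp add: add_less_le_mono nmul_mono)
qed simp

lemma nmul_less_iff: "n > 0 \<Longrightarrow> nmul n x < nmul n y \<longleftrightarrow> x < (y :: 'g::linordered_ab_group_add)"
  by (meson nmul_mono nmul_strict_mono not_le)

lemma nmul_le_iff: "n > 0 \<Longrightarrow> nmul n x \<le> nmul n y \<longleftrightarrow> x \<le> (y :: 'g::linordered_ab_group_add)"
  by (meson nmul_less_iff not_le)

lemma nmul_eq_iff: "n > 0 \<Longrightarrow> nmul n x = nmul n y \<longleftrightarrow> x = (y :: 'g::linordered_ab_group_add)"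
  by (metis antisym nmul_le_iff order_refl)

lemma nmul_divisible:
  assumes "n > 0" obtains h where "nmul n h = (g :: 'g::divisible_ordered_ab_group)"
  using divisible[OF assms, of g] by (auto simp: sum_lessThan_const)

lemma Fin_add_le_cancel [simp]:
  "Fin a + x \<le> Fin a + y \<longleftrightarrow> x \<le> (y :: 'g::linordered_ab_group_add extended)"
  by (cases x; cases y) auto

lemma Fin_add_less_cancel [simp]:
  "Fin a + x < Fin a + y \<longleftrightarrow> x < (y :: 'g::linordered_ab_group_add extended)"
  by (cases x; cases y) auto

lemma extended_add_mono:
  "a \<le> b \<Longrightarrow> c \<le> d \<Longrightarrow> a + c \<le> b + (d :: 'g::linordered_ab_group_add extended)"
  by (meson add_left_mono add_right_mono order_trans)

lemma less_Pinf_iff: "x < \<infinity> \<longleftrightarrow> x \<noteq> (\<infinity> :: 'g::linorder extended)"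
  by (cases x) auto

locale valued_field = subfield_set F for F :: "'b::field set" +
  fixes v :: "'b \<Rightarrow> 'g::linordered_ab_group_add extended"
  assumes valuation: "valuation_on F v"
begin

lemma v_zero [simp]: "v 0 = \<infinity>"
  using valuation by (simp add: valuation_on_def)

lemma v_mult: "x \<in> F \<Longrightarrow> y \<in> F \<Longrightarrow> v (x * y) = v x + v y"
  using valuation by (simp add: valuation_on_def)

lemma v_add: "x \<in> F \<Longrightarrow> y \<in> F \<Longrightarrow> min (v x) (v y) \<le> v (x + y)"
  using valuation by (simp add: valuation_on_def)

lemma v_Fin:
  assumes "x \<in> F" "x \<noteq> 0" obtains g where "v x = Fin g"
  using valuation assms by (auto simp: valuation_on_def)

lemma v_eq_Pinf [simp]: "x \<in> F \<Longrightarrow> v x = \<infinity> \<longleftrightarrow> x = 0"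
  by (metis extended.distinct(1) v_Fin v_zero)

lemma v_neq_Minf [simp]: "x \<in> F \<Longrightarrow> v x \<noteq> -\<infinity>"
  by (metis extended.distinct(3,5) v_Fin v_zero)

lemma v_one [simp]: "v 1 = 0"
proof -
  obtain g where g: "v 1 = Fin g" by (rule v_Fin[of 1]) auto
  then show ?thesis using v_mult[of 1 1] by (simp add: zero_extended_def)
qed

lemma v_uminus_one: "v (- 1) = 0"
proof -
  obtain g where g: "v (- 1) = Fin g" by (rule v_Fin[of "- 1"]) auto
  then have "g + g = 0" using v_mult[of "- 1" "- 1"] by (simp add: zero_extended_def)
  then have "g = 0" by simp
  then show ?thesis using g by (simp add: zero_extended_def)
qed

lemma v_uminus [simp]: "x \<in> F \<Longrightarrow> v (- x) = v x"
  using v_mult[of "- 1" x] v_uminus_one by simp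

lemma v_diff_commute: "x \<in> F \<Longrightarrow> y \<in> F \<Longrightarrow> v (x - y) = v (y - x)"
  using v_uminus[of "x - y"] by simp

lemma v_diff: "x \<in> F \<Longrightarrow> y \<in> F \<Longrightarrow> min (v x) (v y) \<le> v (x - y)"
  using v_add[of x "- y"] by simp

lemma v_add_ge: "x \<in> F \<Longrightarrow> y \<in> F \<Longrightarrow> c \<le> v x \<Longrightarrow> c \<le> v y \<Longrightarrow> c \<le> v (x + y)"
  using v_add[of x y] by (meson min.bounded_iff order_trans)

lemma v_add_gt: "x \<in> F \<Longrightarrow> y \<in> F \<Longrightarrow> c < v x \<Longrightarrow> c < v y \<Longrightarrow> c < v (x + y)"
  using v_add[of x y] by (meson min_less_iff_conj order_less_le_trans)

lemma v_add_less:
  assumes "x \<in> F" "y \<in> F" "v x < v y" shows "v (x + y) = v x"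
proof (rule antisym)
  show "v x \<le> v (x + y)" using v_add_ge[of x y "v x"] assms by simp
  have "min (v (x + y)) (v y) \<le> v x" using v_diff[of "x + y" y] assms by simp
  then show "v (x + y) \<le> v x" using assms(3) by (auto simp: min_le_iff_disj)
qed

lemma v_diff_less:
  assumes "x \<in> F" "y \<in> F" "v x < v y" shows "v (x - y) = v x" "v (y - x) = v x"
  using v_add_less[of x "- y"] assms v_diff_commute[of x y] by auto

lemma v_add_neq:
  assumes "x \<in> F" "y \<in> F" "v x \<noteq> v y" shows "v (x + y) = min (v x) (v y)"
  using v_add_less[of x y] v_add_less[of y x] assms by (auto simp: min_def add.commute not_le)

lemma v_inverse: "x \<in> F \<Longrightarrow> v x = Fin g \<Longrightarrow> v (inverse x) = Fin (- g)"
proof -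
  assume *: "x \<in> F" "v x = Fin g"
  then have "x \<noteq> 0" by auto
  then obtain h where h: "v (inverse x) = Fin h" using v_Fin[of "inverse x"] * by auto
  have "v (x * inverse x) = Fin g + Fin h" using v_mult[of x "inverse x"] * h by simp
  then have "g + h = 0" using \<open>x \<noteq> 0\<close> by (simp add: zero_extended_def)
  then show ?thesis using h by (simp add: eq_neg_iff_add_eq_0 add.commute)
qed

lemma v_divide: "x \<in> F \<Longrightarrow> y \<in> F \<Longrightarrow> v y = Fin g \<Longrightarrow> v (x / y) = v x + Fin (- g)"
  using v_inverse[of y g] by (simp add: divide_inverse v_mult)

lemma v_power: "x \<in> F \<Longrightarrow> v (x ^ n) = nmul n (v x)"
  by (induction n) (auto simp: v_mult)

lemma v_sum_ge: "(\<And>i. i \<in> A \<Longrightarrow> f i \<in> F \<and> c \<le> v (f i)) \<Longrightarrow> c \<le> v (sum f A)"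
  by (induction A rule: infinite_finite_induct) (auto intro!: v_add_ge sum_mem)

lemma v_sum_gt: "c < \<infinity> \<Longrightarrow> (\<And>i. i \<in> A \<Longrightarrow> f i \<in> F \<and> c < v (f i)) \<Longrightarrow> c < v (sum f A)"
  by (induction A rule: infinite_finite_induct) (auto intro!: v_add_gt sum_mem)

lemma v_sum_unique_min:
  assumes "finite A" "i \<in> A" "v (f i) \<noteq> \<infinity>" "\<And>j. j \<in> A \<Longrightarrow> f j \<in> F"
    "\<And>j. j \<in> A \<Longrightarrow> j \<noteq> i \<Longrightarrow> v (f i) < v (f j)"
  shows "v (sum f A) = v (f i)"
proof -
  have "sum f A = f i + sum f (A - {i})" using assms by (simp add: sum.remove)
  moreover have "v (f i) < v (sum f (A - {i}))"
    by (rule v_sum_gt) (use assms in \<open>auto simp: less_Pinf_iff\<close>)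
  moreover have "sum f (A - {i}) \<in> F" using assms by (intro sum_mem) auto
  ultimately show ?thesis using v_add_less assms by auto
qed

lemma v_prod_mset: "(\<And>x. x \<in># A \<Longrightarrow> f x \<in> F) \<Longrightarrow> v (\<Prod>x\<in>#A. f x) = (\<Sum>x\<in>#A. v (f x))"
proof (induction A)
  case (add x A)
  have "(\<forall>x\<in>#A. f x \<in> F) \<longrightarrow> (\<Prod>x\<in>#A. f x) \<in> F" by (induction A) auto
  then show ?case using add by (simp add: v_mult)
qed simp

text \<open>In an algebraic equation at least two terms attain the minimal value.\<close>

lemma algebraic_value:
  assumes N: "subfield_set N" "N \<subseteq> F" and x: "x \<in> F" "x \<noteq> 0" "algebraic_over N x"
  shows "\<exists>n>0. \<exists>c\<in>N. c \<noteq> 0 \<and> nmul n (v x) = v c"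
proof -
  interpret N: subfield_set N by fact
  obtain f where f: "f \<in> polys N" "f \<noteq> 0" "poly f x = 0"
    using x(3) unfolding algebraic_over_def by blast
  define t where "t = (\<lambda>i. cf f i * x ^ i)"
  have cfF: "cf f i \<in> F" for i using f(1) N(2) by (auto simp: polys_def)
  then have tF: "t i \<in> F" for i using x by (auto simp: t_def)
  define S where "S = {i. i \<le> deg f \<and> cf f i \<noteq> 0}"
  have S: "finite S" "S \<noteq> {}" using f(2) by (auto simp: S_def intro: exI[of _ "deg f"])
  obtain i where i: "i \<in> S" "\<And>j. j \<in> S \<Longrightarrow> v (t i) \<le> v (t j)"
    using arg_min_if_finite(1)[OF S, of "\<lambda>i. v (t i)"] arg_min_least[OF S, of _ "\<lambda>i. v (t i)"]
    by metis
  have t0: "t j \<noteq> 0 \<longleftrightarrow> cf f j \<noteq> 0" for j using x by (auto simp: t_def)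
  have "\<exists>j\<in>S. j \<noteq> i \<and> v (t j) = v (t i)"
  proof (rule ccontr)
    assume *: "\<not> ?thesis"
    have "v (sum t {..deg f}) = v (t i)"
    proof (rule v_sum_unique_min)
      show "v (t i) \<noteq> \<infinity>" using i(1) tF t0 by (auto simp: S_def)
      fix j assume j: "j \<in> {..deg f}" "j \<noteq> i"
      show "v (t i) < v (t j)"
      proof (cases "j \<in> S")
        case True
        then show ?thesis using * i(2)[of j] j by force
      next
        case False
        then have "t j = 0" using j t0 by (auto simp: S_def)
        then show ?thesis using i(1) tF[of i] t0[of i] by (simp add: S_def less_Pinf_iff)
      qed
    qed (use i tF in \<open>auto simp: S_def\<close>)
    moreover have "sum t {..deg f} = 0" using f(3) by (simp add: t_def poly_altdef)
    ultimately have "v (t i) = \<infinity>" by simp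
    then show False using i(1) tF t0 by (auto simp: S_def)
  qed
  then obtain j where j: "j \<in> S" "j \<noteq> i" "v (t j) = v (t i)" by blast
  obtain g where g: "v x = Fin g" using v_Fin x by blast
  have main: "\<exists>n>0. \<exists>c\<in>N. c \<noteq> 0 \<and> nmul n (v x) = v c"
    if ij: "i < j" "cf f i \<noteq> 0" "cf f j \<noteq> 0" "v (t j) = v (t i)" for i j
  proof -
    obtain a where a: "v (cf f i) = Fin a" using v_Fin[OF cfF ij(2)] .
    obtain b where b: "v (cf f j) = Fin b" using v_Fin[OF cfF ij(3)] .
    have "b + nmul j g = a + nmul i g"
      using ij(4) x a b g cfF by (simp add: t_def v_mult v_power)
    moreover have "nmul j g = nmul (j - i) g + nmul i g"
      using nmul_add_left[of "j - i" i g] ij(1) by simp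
    ultimately have "nmul (j - i) g = a - b" by (simp add: algebra_simps)
    moreover have "v (cf f i / cf f j) = Fin (a - b)"
      using v_divide[OF cfF cfF b] a by simp
    ultimately show ?thesis using ij g N.coeff_mem[OF f(1)]
      by (intro exI[of _ "j - i"] conjI bexI[of _ "cf f i / cf f j"]) auto
  qed
  show ?thesis
  proof (cases "i < j")
    case True
    then show ?thesis using main[of i j] i j by (auto simp: S_def)
  next
    case False
    then show ?thesis using main[of j i] i j by (auto simp: S_def)
  qed
qed

lemma valued_field_subset: "subfield_set F' \<Longrightarrow> F' \<subseteq> F \<Longrightarrow> valued_field F' v"
  unfolding valued_field_def valued_field_axioms_def
  using valuation unfolding valuation_on_def by blast

end

lemma valued_field_UNIV: "valuation_on UNIV v \<Longrightarrow> valued_field UNIV v"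
  by (simp add: valued_field_def valued_field_axioms_def)

lemma field_invariant_valuation:
  assumes "valued_field UNIV v" shows "field_invariant v"
proof -
  interpret valued_field UNIV v by fact
  have z: "v x = v y \<Longrightarrow> x = 0 \<longleftrightarrow> y = 0" for x y by (metis UNIV_I v_eq_Pinf)
  moreover have "v (a / c) = v (b / d)" if "v a = v b" "v c = v d" for a b c d
  proof (cases "c = 0")
    case True
    then show ?thesis using z[OF that(2)] by simp
  next
    case False
    then obtain g where "v c = Fin g" using v_Fin by blast
    then show ?thesis using v_divide that by simp
  qed
  ultimately show ?thesis unfolding field_invariant_def by blast
qed

locale valued_UNIV = valued_field UNIV v for v :: "'b::field \<Rightarrow> 'g::linordered_ab_group_add extended"
begin

lemma cf_prod_roots_nonneg:
  assumes "\<And>r. r \<in># A \<Longrightarrow> 0 \<le> v r"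
  shows "0 \<le> v (cf (\<Prod>r\<in>#A. [:-r, 1:]) k)"
  using assms
proof (induction A arbitrary: k)
  case empty
  then show ?case by (auto simp: coeff_1)
next
  case (add r A)
  define P where "P = (\<Prod>r\<in>#A. [:-r, 1:])"
  have IH: "0 \<le> v (cf P k)" for k unfolding P_def using add by auto
  have nn: "0 \<le> v (r * cf P k)" for k
    using add.prems[of r] IH[of k] extended_add_mono[of 0 "v r" 0 "v (cf P k)"] by (simp add: v_mult)
  have "cf ([:-r, 1:] * P) k = (case k of 0 \<Rightarrow> 0 | Suc k \<Rightarrow> cf P k) - r * cf P k"
    by (auto simp: coeff_pCons split: nat.splits)
  then have "0 \<le> v (cf ([:-r, 1:] * P) k)"
    using IH nn v_diff[of "cf P (k - 1)" "r * cf P k"]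
    by (cases k) (auto intro: order_trans[rotated])
  then show ?case by (simp add: P_def)
qed

text \<open>Multiplying by \<open>[:-r, 1:]\<close> adds the negative \<open>v r\<close> to the
  value of the constant coefficient, and neither summand of any other coefficient sinks that
  low.\<close>

lemma cf_prod_roots_neg:
  assumes "\<And>r. r \<in># A \<Longrightarrow> v r < 0" "k > 0"
  shows "v (cf (\<Prod>r\<in>#A. [:-r, 1:]) 0) < v (cf (\<Prod>r\<in>#A. [:-r, 1:]) k)"
  using assms
proof (induction A arbitrary: k)
  case empty
  then show ?case by (auto simp: coeff_1 zero_extended_def)
next
  case (add r A)
  define P where "P = (\<Prod>r\<in>#A. [:-r, 1:])"
  have IH: "v (cf P 0) < v (cf P k)" if "k > 0" for k unfolding P_def using add that by auto
  have "r \<noteq> 0" using add.prems(1)[of r] by auto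
  then obtain g where g: "v r = Fin g" using v_Fin by blast
  have g0: "g < 0" using add.prems(1)[of r] g by (simp add: zero_extended_def)
  obtain h where h: "v (cf P 0) = Fin h" using IH[of 1] by (cases "v (cf P 0)") auto
  have c0: "cf ([:-r, 1:] * P) 0 = - (r * cf P 0)" by simp
  have v0: "v (r * cf P 0) = Fin (g + h)" using g h by (simp add: v_mult)
  have small: "Fin (g + h) < Fin h" using g0 by simp
  have a: "Fin (g + h) < v (r * cf P k)" if "k > 0" for k
    using IH[OF that] g h Fin_add_less_cancel[of g "Fin h" "v (cf P k)"] by (simp add: v_mult)
  have b: "Fin (g + h) < v (cf P k)" for k
    using IH[of k] h small less_trans[of "Fin (g + h)" "Fin h" "v (cf P k)"] by (cases "k = 0") auto
  obtain k' where k': "k = Suc k'" using add.prems(2) gr0_implies_Suc by blast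
  have "cf ([:-r, 1:] * P) k = cf P k' - r * cf P k" by (simp add: k')
  then have "Fin (g + h) < v (cf ([:-r, 1:] * P) k)"
    using v_diff[of "cf P k'" "r * cf P k"] a[OF add.prems(2)] b[of k']
    by (metis UNIV_I min_less_iff_conj order_less_le_trans)
  then show ?case using c0 v0 by (simp add: P_def[symmetric])
qed

lemma poly_nonneg:
  assumes "\<And>i. 0 \<le> v (cf f i)" "0 \<le> v x" shows "0 \<le> v (poly f x)"
  unfolding poly_altdef
proof (rule v_sum_ge)
  fix i
  have "0 + 0 \<le> v (cf f i) + v (x ^ i)"
  proof (rule extended_add_mono)
    show "0 \<le> v (x ^ i)"
      by (induction i) (use assms(2) extended_add_mono[of 0 "v x" 0] in \<open>auto simp: v_mult\<close>)
  qed (use assms in auto)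
  then show "cf f i * x ^ i \<in> UNIV \<and> 0 \<le> v (cf f i * x ^ i)" by (simp add: v_mult)
qed

end

lemma (in valued_UNIV) pos_mult: "0 < v x \<Longrightarrow> 0 \<le> v y \<Longrightarrow> 0 < v (x * y)"
  using extended_add_mono[of "v x" "v x" 0 "v y"] by (auto simp: v_mult)

section \<open>Conjugacy of extensions of a valuation\<close>

lemma (in field_emb) map_poly_pair:
  assumes "(p, p') \<in> pair_polys G" "\<And>x x'. (x, x') \<in> G \<Longrightarrow> \<sigma> x = x'"
  shows "map_poly \<sigma> p = p'"
  using assms by (auto simp: poly_eq_iff pair_polys_def)

text \<open>A nonzero element of an ordered group has infinite order, so there is at most one such
  \<open>m\<close>. Hence finitely many coincidences of values can be avoided by the choice of an
  exponent.\<close>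

lemma finite_nmul_eq:
  assumes "g \<noteq> (0 :: 'g::linordered_ab_group_add)"
  shows "finite {m. nmul m g = h}"
proof (rule finite_subset)
  define m0 where "m0 = (SOME m. nmul m g = h)"
  show "{m. nmul m g = h} \<subseteq> {m0}"
  proof
    fix m assume "m \<in> {m. nmul m g = h}"
    then have m: "nmul m g = h" by simp
    then have m0: "nmul m0 g = h" unfolding m0_def by (rule someI)
    have "a = b" if "nmul a g = nmul b g" "a \<le> b" for a b
    proof (rule ccontr)
      assume "a \<noteq> b"
      then have "nmul (b - a) g = 0" using nmul_add_left[of "b - a" a g] that by simp
      then show False using nmul_eq_iff[of "b - a" g 0] assms that \<open>a \<noteq> b\<close> by simp
    qed
    then show "m \<in> {m0}" using m m0 by (metis linear singletonI)
  qed
qed simp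

text \<open>If no root of the minimal polynomial of \<open>y\<close> works, some element of the field generated by \<open>y\<close> is
  integral for \<open>U\<close> while all its conjugates have negative value.  Then the constant coefficient of its
  minimal polynomial has strictly smaller value than all others, which is incompatible with the equation.\<close>

theorem valuation_conjugate:
  fixes G :: "('b::alg_closed_field \<times> 'b) set" and u U :: "'b \<Rightarrow> 'g::linordered_ab_group_add extended"
  assumes G: "pair_iso G" and alg: "\<And>x. algebraic_over (fst ` G) x"
    and u: "valued_UNIV u"
    and U: "valued_field {poly p y |p. p \<in> polys (fst ` G)} U"
    and Uu: "\<And>x x'. (x, x') \<in> G \<Longrightarrow> U x = u x'"
  shows "\<exists>y'. \<forall>(p, p')\<in>pair_polys G. U (poly p y) = u (poly p' y')"
proof (rule ccontr)
  assume contr: "\<not> ?thesis"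
  define N where "N = fst ` G"
  define L where "L = {poly p y |p. p \<in> polys N}"
  interpret pair_iso G by fact
  interpret N: subfield_set N unfolding N_def by (rule subfield_set_dom)
  interpret u: valued_UNIV u by fact
  interpret U: valued_field L U using U by (simp add: L_def N_def)
  have alg: "algebraic_over N x" for x using alg by (simp add: N_def)
  have L: "poly p y \<in> L" if "(p, p') \<in> pair_polys G" for p p'
    using pp_polys[OF that] by (auto simp: L_def N_def)
  have NL: "N \<subseteq> L" unfolding L_def by (rule N.simple_extension_superset)
  have pair: "\<exists>x'. (x, x') \<in> G" if "x \<in> N" for x using that by (auto simp: N_def)
  obtain f' where f': "(minpoly N y, f') \<in> pair_polys G"
    using pp_exists N.minpoly(1)[OF alg] N_def by metis
  have f'0: "f' \<noteq> 0" using pp_eq_0[OF f'] N.minpoly_nonzero[OF alg] by simp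
  define R where "R = {y'. poly f' y' = 0}"
  have finR: "finite R" unfolding R_def using poly_roots_finite[OF f'0] by simp
  have root_iff: "poly p y = 0 \<longleftrightarrow> poly p' y' = 0" if "y' \<in> R" "(p, p') \<in> pair_polys G" for p p' y'
    using root_pair_iff[of y f' y' p p'] alg f' that by (simp add: R_def N_def)
  \<comment> \<open>A root \<open>y'\<close> that fails has a polynomial \<open>p\<close> with
    different values at \<open>y\<close> and \<open>y'\<close>. Some positive multiple of the value
    at \<open>y\<close> is the value of a constant \<open>c\<close>; so \<open>p ^ n / c\<close>, or
    its inverse, has value 0 at \<open>y\<close> and negative value at \<open>y'\<close>.\<close>
  have step1: "\<exists>h h'. (h, h') \<in> pair_polys G \<and> 0 \<le> U (poly h y) \<and> u (poly h' y') < 0"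
    if y': "y' \<in> R" for y'
  proof -
    obtain p p' where p: "(p, p') \<in> pair_polys G" "U (poly p y) \<noteq> u (poly p' y')"
      using contr by blast
    have nz: "poly p y \<noteq> 0" "poly p' y' \<noteq> 0" using root_iff[OF y' p(1)] p(2) by auto
    obtain a where a: "U (poly p y) = Fin a" using U.v_Fin[OF L[OF p(1)] nz(1)] .
    obtain b where b: "u (poly p' y') = Fin b" using u.v_Fin[OF UNIV_I nz(2)] .
    obtain n c where c: "n > 0" "c \<in> N" "c \<noteq> 0" "nmul n (U (poly p y)) = U c"
      using U.algebraic_value[OF N.subfield_set_axioms NL L[OF p(1)] nz(1) alg] by blast
    obtain c' where c': "(c, c') \<in> G" using pair[OF c(2)] by blast
    have Uc: "U c = Fin (nmul n a)" "u c' = Fin (nmul n a)" using c(4) a Uu[OF c'] by simp_all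
    have cL: "c \<in> L" using c(2) NL by auto
    consider "b < a" | "a < b" using p(2) a b by fastforce
    then show ?thesis
    proof cases
      case 1
      define h h' where "h = p ^ n * [:inverse c:]" and "h' = p' ^ n * [:inverse c':]"
      have "(h, h') \<in> pair_polys G" unfolding h_def h'_def
        using p c' by (intro pp_mult pp_power pp_const) auto
      moreover have "U (poly h y) = 0"
        using L[OF p(1)] cL a U.v_inverse[OF cL Uc(1)]
        by (simp add: h_def U.v_mult U.v_power zero_extended_def)
      moreover have "u (poly h' y') < 0"
        using b u.v_inverse[OF UNIV_I Uc(2)] 1 c(1) nmul_strict_mono[of n b a]
        by (simp add: h'_def u.v_mult u.v_power zero_extended_def)
      ultimately show ?thesis by force
    next
      case 2
      obtain q where q: "q \<in> polys N" "poly p y * poly q y = 1"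
        using N.poly_inverse_mod[OF alg _ nz(1)] pp_polys[OF p(1)] by (auto simp: N_def)
      obtain q' where q': "(q, q') \<in> pair_polys G" using pp_exists q(1) N_def by metis
      have "poly (p' * q' - 1) y' = 0"
        using root_iff[OF y', of "p * q - 1" "p' * q' - 1"] q(2) pp_diff[OF pp_mult[OF p(1) q'] pp_1]
        by simp
      then have q'y: "poly q' y' = inverse (poly p' y')" by (simp add: inverse_unique)
      have qy: "poly q y = inverse (poly p y)" using q(2) by (simp add: inverse_unique)
      define h h' where "h = q ^ n * [:c:]" and "h' = q' ^ n * [:c':]"
      have "(h, h') \<in> pair_polys G" unfolding h_def h'_def
        using q' c' by (intro pp_mult pp_power pp_const) auto
      moreover have "U (poly h y) = 0"
        using L[OF p(1)] cL U.v_inverse[OF L[OF p(1)] a] Uc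
        by (simp add: h_def qy U.v_mult U.v_power nmul_uminus zero_extended_def del: power_inverse)
      moreover have "u (poly h' y') < 0"
        using u.v_inverse[OF UNIV_I b] Uc 2 c(1) nmul_strict_mono[of n a b]
        by (simp add: h'_def q'y u.v_mult u.v_power nmul_uminus zero_extended_def del: power_inverse)
      ultimately show ?thesis by force
    qed
  qed
  \<comment> \<open>The elements for single roots are merged one by one as \<open>h ^ m + k\<close>;
    \<open>Bad\<close> collects the exponents for which the two summands could cancel.\<close>
  have "finite S \<Longrightarrow> S \<subseteq> R \<Longrightarrow>
      \<exists>h h'. (h, h') \<in> pair_polys G \<and> 0 \<le> U (poly h y) \<and> (\<forall>y'\<in>S. u (poly h' y') < 0)" for S
  proof (induction S rule: finite_induct)
    case empty
    show ?case by (rule exI[of _ 0], rule exI[of _ 0]) simp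
  next
    case (insert y1 S)
    obtain h h' where h: "(h, h') \<in> pair_polys G" "0 \<le> U (poly h y)" "\<forall>y'\<in>S. u (poly h' y') < 0"
      using insert by auto
    obtain k k' where k: "(k, k') \<in> pair_polys G" "0 \<le> U (poly k y)" "u (poly k' y1) < 0"
      using step1[of y1] insert by auto
    define Bad where "Bad = (\<Union>y'\<in>{y' \<in> insert y1 S. u (poly h' y') < 0}.
      {m. nmul m (u (poly h' y')) = u (poly k' y')})"
    have "finite Bad" unfolding Bad_def
    proof (rule finite_UN_I)
      show "finite {y' \<in> insert y1 S. u (poly h' y') < 0}" using insert by simp
      fix y' assume "y' \<in> {y' \<in> insert y1 S. u (poly h' y') < 0}"
      then have neg: "u (poly h' y') < 0" by simp
      then have "poly h' y' \<noteq> 0" by auto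
      then obtain g where g: "u (poly h' y') = Fin g" using u.v_Fin[OF UNIV_I] by blast
      then have "g \<noteq> 0" using neg by (auto simp: zero_extended_def)
      then show "finite {m. nmul m (u (poly h' y')) = u (poly k' y')}"
        using finite_nmul_eq[of g] g by (cases "u (poly k' y')") auto
    qed
    \<comment> \<open>\<open>m = 0\<close> is excluded too, since \<open>h ^ 0\<close> has no
      negative value.\<close>
    then obtain m where m: "m \<notin> insert 0 Bad" using ex_new_if_finite[OF infinite_UNIV_nat] by blast
    define H H' where "H = h ^ m + k" and "H' = h' ^ m + k'"
    have "(H, H') \<in> pair_polys G" unfolding H_def H'_def using h k by (intro pp_add pp_power) auto
    moreover have "0 \<le> U (poly H y)"
    proof -
      have "0 \<le> U (poly h y ^ m)"
      proof (induction m)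
        case (Suc m)
        then show ?case
          using L[OF h(1)] extended_add_mono[OF h(2) Suc.IH] by (simp add: U.v_mult)
      qed simp
      then show ?thesis unfolding H_def using L[OF h(1)] L[OF k(1)] k(2)
        by (auto intro!: U.v_add_ge)
    qed
    moreover have "u (poly H' y') < 0" if y': "y' \<in> insert y1 S" for y'
    proof -
      have *: "min (u (poly h' y' ^ m)) (u (poly k' y')) < 0 \<and> u (poly h' y' ^ m) \<noteq> u (poly k' y')"
      proof (cases "u (poly h' y') < 0")
        case True
        then have "poly h' y' \<noteq> 0" by auto
        then obtain g where g: "u (poly h' y') = Fin g" using u.v_Fin[OF UNIV_I] by blast
        then have "u (poly h' y' ^ m) < 0"
          using True m nmul_strict_mono[of m g 0] by (simp add: u.v_power zero_extended_def)
        moreover have "u (poly h' y' ^ m) \<noteq> u (poly k' y')"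
          using m True y' by (auto simp: Bad_def u.v_power)
        ultimately show ?thesis by (auto simp: min_less_iff_disj)
      next
        case False
        then have [simp]: "y' = y1" using y' h(3) by auto
        have "0 \<le> u (poly h' y' ^ m)"
        proof (induction m)
          case (Suc m)
          then show ?case
            using False extended_add_mono[of 0 "u (poly h' y')" 0] by (simp add: u.v_mult not_less)
        qed simp
        then show ?thesis using k(3) by (auto simp: min_less_iff_disj)
      qed
      then show ?thesis unfolding H'_def using u.v_add_neq by simp
    qed
    ultimately show ?case by blast
  qed
  from this[OF finR] obtain h h' where h: "(h, h') \<in> pair_polys G" "0 \<le> U (poly h y)"
      "\<And>y'. y' \<in> R \<Longrightarrow> u (poly h' y') < 0" by auto
  define t where "t = poly h y"
  obtain m' where m': "(minpoly N t, m') \<in> pair_polys G"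
    using pp_exists N.minpoly(1)[OF alg] N_def by metis
  have m'0: "m' \<noteq> 0" using pp_eq_0[OF m'] N.minpoly_nonzero[OF alg] by simp
  \<comment> \<open>\<open>r\<close> is the image of \<open>t = h(y)\<close> under an embedding that
    extends \<open>G\<close>; the embedding moves \<open>y\<close> to some root in \<open>R\<close>,
    so \<open>r\<close> is the value of \<open>h'\<close> there.\<close>
  have roots: "u r < 0" if r: "poly m' r = 0" for r
  proof -
    have "\<exists>\<sigma>. field_emb \<sigma> \<and> (\<forall>(a, b)\<in>adjoin_pair G t r. \<sigma> a = b)"
    proof (rule extend_embedding_algebraic)
      show "pair_ring (adjoin_pair G t r)" by (rule pair_ring_adjoin)
      show "algebraic_over (fst ` adjoin_pair G t r) x" for x
        using algebraic_over_mono[OF image_mono[OF adjoin_pair_mono] alg[unfolded N_def]] .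
      show "a = 0 \<longleftrightarrow> b = 0" if "(a, b) \<in> adjoin_pair G t r" for a b
        using that root_pair_iff[of t m' r] alg m' r by (auto simp: adjoin_pair_def N_def)
    qed
    then obtain \<sigma> where \<sigma>: "field_emb \<sigma>" "\<forall>(a, b)\<in>adjoin_pair G t r. \<sigma> a = b" by blast
    interpret field_emb \<sigma> by fact
    have G\<sigma>: "\<sigma> x = x'" if "(x, x') \<in> G" for x x' using bspec[OF \<sigma>(2), of "(x, x')"] that adjoin_pair_mono[of t r] by auto
    have "\<sigma> t = r" using bspec[OF \<sigma>(2) adjoin_pair_gen] by simp
    moreover have "\<sigma> t = poly h' (\<sigma> y)"
      using poly_map_poly[of h y] map_poly_pair[OF h(1) G\<sigma>] by (simp add: t_def)
    moreover have "\<sigma> y \<in> R"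
      using poly_map_poly[of "minpoly N y" y] map_poly_pair[OF f' G\<sigma>] N.minpoly(3)[OF alg, of y]
      by (simp add: R_def)
    ultimately show ?thesis using h(3) by metis
  qed
  have m'_prod: "m' = (\<Prod>r\<in>#proots m'. [:-r, 1:])"
    using poly_splits(1)[OF m'0] pp_monic[OF m' N.minpoly(2)[OF alg]] by simp
  have less: "U (cf (minpoly N t) 0) < U (cf (minpoly N t) k)" if "k > 0" for k
  proof -
    have "u (cf m' 0) < u (cf m' k)"
      by (subst (1 2) m'_prod, rule u.cf_prod_roots_neg) (use that roots m'0 in auto)
    then show ?thesis using Uu[OF pp_cf[OF m']] by simp
  qed
  have tL: "t \<in> L" unfolding t_def by (rule L[OF h(1)])
  have cL: "cf (minpoly N t) i \<in> L" for i using N.coeff_mem[OF N.minpoly(1)[OF alg]] NL by blast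
  define s where "s = (\<lambda>i. cf (minpoly N t) i * t ^ i)"
  have s0: "s 0 = cf (minpoly N t) 0" by (simp add: s_def)
  have "U (sum s {..deg (minpoly N t)}) = U (s 0)"
  proof (rule U.v_sum_unique_min)
    show "U (s 0) \<noteq> \<infinity>" using less[of 1] by (auto simp: s0)
    show "s j \<in> L" for j using cL tL by (auto simp: s_def)
    fix j :: nat assume "j \<noteq> 0"
    have "0 \<le> U (t ^ j)"
    proof (induction j)
      case (Suc j)
      then show ?case using tL extended_add_mono[OF h(2) Suc.IH] by (simp add: U.v_mult t_def)
    qed simp
    then have "U (cf (minpoly N t) j) + 0 \<le> U (s j)"
      using cL tL add_left_mono[of 0 "U (t ^ j)" "U (cf (minpoly N t) j)"] by (simp add: s_def U.v_mult)
    then show "U (s 0) < U (s j)" using less[of j] \<open>j \<noteq> 0\<close> by (simp add: s0)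
  qed auto
  moreover have "sum s {..deg (minpoly N t)} = 0"
    using N.minpoly(3)[OF alg, of t] by (simp add: s_def poly_altdef)
  ultimately have "U (cf (minpoly N t) 0) = \<infinity>" by (simp add: s0)
  then show False using less[of 1] by simp
qed

text \<open>A new \<open>y\<close> is adjoined by applying \<open>valuation_conjugate\<close> to
  \<open>u\<close> itself: its restriction to the field generated by \<open>y\<close> over the
  domain is compared with \<open>u\<close> over the range.\<close>

theorem extend_valued_embedding:
  fixes G0 :: "('b::alg_closed_field \<times> 'b) set" and u :: "'b \<Rightarrow> 'g::linordered_ab_group_add extended"
  assumes G0: "pair_ring G0" "pair_invariant u G0" and u: "valued_UNIV u"
    and alg: "\<And>x. algebraic_over (fst ` G0) x"
  shows "\<exists>\<sigma>. field_emb \<sigma> \<and> (\<forall>(x, y)\<in>G0. \<sigma> x = y) \<and> (\<forall>x. u (\<sigma> x) = u x)"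
proof (rule extend_embedding[OF G0])
  interpret u: valued_UNIV u by fact
  show "field_invariant u" by (rule field_invariant_valuation) unfold_locales
  fix G y assume G: "G0 \<subseteq> G" "pair_iso G" "pair_invariant u G"
  interpret pair_iso G by fact
  interpret D: subfield_set "fst ` G" by (rule subfield_set_dom)
  have alg': "algebraic_over (fst ` G) x" for x
    using algebraic_over_mono[OF image_mono[OF G(1)] alg] .
  have "\<exists>y'. \<forall>(p, p')\<in>pair_polys G. u (poly p y) = u (poly p' y')"
  proof (rule valuation_conjugate[OF G(2) alg' u])
    show "valued_field {poly p y |p. p \<in> polys (fst ` G)} u"
      by (rule u.valued_field_subset[OF D.subfield_set_simple_extension[OF alg']]) simp
    show "u x = u x'" if "(x, x') \<in> G" for x x' using G(3) that by (auto simp: pair_invariant_def)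
  qed
  then show "\<exists>y'. pair_invariant u (adjoin_pair G y y')"
    by (fastforce simp: pair_invariant_def adjoin_pair_def)
qed

corollary valuation_conjugate_over:
  fixes F :: "'b::alg_closed_field set" and u U :: "'b \<Rightarrow> 'g::linordered_ab_group_add extended"
  assumes F: "subfield_set F" and alg: "\<And>x. algebraic_over F x" and u: "valued_UNIV u"
    and U: "valued_field {poly p y |p. p \<in> polys F} U" and Uu: "\<And>x. x \<in> F \<Longrightarrow> U x = u x"
  shows "\<exists>y'. \<forall>p\<in>polys F. U (poly p y) = u (poly p y')"
proof -
  have "\<exists>y'. \<forall>(p, p')\<in>pair_polys (Id_on F). U (poly p y) = u (poly p' y')"
    by (rule valuation_conjugate[OF pair_iso_Id_on[OF F]]) (use alg u U Uu in auto)
  then show ?thesis by fastforce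
qed

section \<open>Henselian fields\<close>

text \<open>Take a positive power whose minimal polynomial \<open>f\<close> has least degree. If
  \<open>f\<close> had derivative 0, it would be a polynomial in \<open>X ^ p\<close>, and the
  \<open>p\<close>-th power of that element would have smaller degree.\<close>

lemma (in subfield_set) separable_power:
  fixes x :: 'b
  assumes "algebraic_over F x" and alg: "\<And>y. algebraic_over F y"
  shows "\<exists>q>0. pderiv (minpoly F (x ^ q)) \<noteq> 0"
proof -
  define P where "P = (\<lambda>n. \<exists>q>0. deg (minpoly F (x ^ q)) = n)"
  have "P (deg (minpoly F (x ^ 1)))" unfolding P_def by (intro exI[of _ 1]) auto
  then have "P (LEAST n. P n)" by (rule LeastI)
  then obtain q where q: "q > 0" "deg (minpoly F (x ^ q)) = (LEAST n. P n)" unfolding P_def by blast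
  have min: "deg (minpoly F (x ^ q)) \<le> deg (minpoly F (x ^ q'))" if "q' > 0" for q'
    unfolding q(2) by (rule Least_le) (use that in \<open>auto simp: P_def\<close>)
  define f where "f = minpoly F (x ^ q)"
  note f = minpoly(1-3)[OF alg, of "x ^ q", folded f_def]
  have fpos: "deg f > 0" unfolding f_def by (rule minpoly_deg_pos[OF alg])
  have "pderiv f \<noteq> 0"
  proof
    assume *: "pderiv f = 0"
    define p where "p = CHAR('b)"
    have dvd: "p dvd k" if "cf f k \<noteq> 0" for k
    proof (cases k)
      case (Suc m)
      have "of_nat (Suc m) * cf f (Suc m) = 0" using * by (metis coeff_0 coeff_pderiv)
      then have "of_nat (Suc m) = (0 :: 'b)" using that Suc by simp
      then show ?thesis using of_nat_eq_0_iff_char_dvd Suc p_def by metis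
    qed simp
    have "p dvd deg f" using dvd[of "deg f"] fpos by fastforce
    \<comment> \<open>Characteristic 0 is excluded here, as \<open>0 dvd deg f\<close> would make
      the degree 0.\<close>
    then have p0: "p > 0" using fpos by (metis dvd_0_left_iff gr0I neq0_conv)
    have "p \<noteq> 1" unfolding p_def by simp
    with p0 have p2: "p > 1" by simp
    define d where "d = deg f div p"
    have d: "deg f = p * d" using \<open>p dvd deg f\<close> by (simp add: d_def)
    define g where "g = (\<Sum>i\<le>d. Polynomial.monom (cf f (p * i)) i)"
    have gF: "g \<in> polys F" unfolding g_def
      using coeff_mem[OF f(1)] by (auto simp: polys_def coeff_sum coeff_monom intro!: sum_mem)
    have cg: "cf g d = cf f (deg f)" by (simp add: g_def coeff_sum d)
    have g0: "g \<noteq> 0" using cg fpos by fastforce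
    have "deg g \<le> d" unfolding g_def by (intro degree_sum_le) (auto intro: order_trans[OF degree_monom_le])
    moreover have "poly g (x ^ (q * p)) = poly f (x ^ q)"
    proof -
      have "poly f (x ^ q) = (\<Sum>k\<in>{..deg f}. cf f k * (x ^ q) ^ k)" by (simp add: poly_altdef)
      also have "\<dots> = (\<Sum>k\<in>(\<lambda>i. p * i) ` {..d}. cf f k * (x ^ q) ^ k)"
      proof (rule sum.mono_neutral_right)
        show "\<forall>i\<in>{..deg f} - (\<lambda>i. p * i) ` {..d}. cf f i * (x ^ q) ^ i = 0"
        proof
          fix i assume i: "i \<in> {..deg f} - (\<lambda>i. p * i) ` {..d}"
          have "\<not> p dvd i"
          proof
            assume "p dvd i"
            then obtain j where j: "i = p * j" by blast
            then have "j \<le> d" using i p0 d by auto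
            then show False using i j by auto
          qed
          then show "cf f i * (x ^ q) ^ i = 0" using dvd by auto
        qed
      qed (auto simp: d)
      also have "\<dots> = (\<Sum>i\<le>d. cf f (p * i) * (x ^ q) ^ (p * i))"
        using p0 by (subst sum.reindex) (auto simp: inj_on_def)
      also have "\<dots> = poly g (x ^ (q * p))"
        by (simp add: g_def poly_sum poly_monom mult.assoc flip: power_mult)
      finally show ?thesis by simp
    qed
    ultimately have "deg (minpoly F (x ^ (q * p))) \<le> d"
      using minpoly_min[OF alg gF g0, of "x ^ (q * p)"] f(3) by simp
    then have "deg f \<le> d" using min[of "q * p"] q(1) p0 by (simp add: f_def)
    then show False using d mult_le_mono1[of 2 p d] p2 fpos by linarith
  qed
  then show ?thesis using q(1) unfolding f_def by blast
qed

text \<open>A multiple root would be annihilated by the derivative, a nonzero polynomial of smaller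
  degree, although every root has the same minimal polynomial.\<close>

lemma (in subfield_set) minpoly_simple_root:
  assumes alg: "algebraic_over F x" and "pderiv (minpoly F x) \<noteq> 0" and r: "poly (minpoly F x) r = 0"
  shows "poly (pderiv (minpoly F x)) r \<noteq> 0"
proof
  assume *: "poly (pderiv (minpoly F x)) r = 0"
  note c = minpoly_conjugate[OF alg r]
  have "deg (minpoly F r) \<le> deg (pderiv (minpoly F x))"
    by (rule minpoly_min[OF c(1)]) (use * assms minpoly in auto)
  moreover have "deg (pderiv (minpoly F x)) \<le> deg (minpoly F x) - 1"
    by (rule degree_le) (auto simp: coeff_pderiv coeff_eq_0)
  ultimately show False using minpoly_deg_pos[OF alg] c(2) by simp
qed

lemma count_proots_simple:
  fixes f :: "'b::field poly"
  assumes "f \<noteq> 0" "poly f r = 0" "poly (pderiv f) r \<noteq> 0"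
  shows "count (proots f) r = 1"
proof -
  have "order r f \<noteq> 0" using assms by (simp add: order_root)
  moreover have "order r f < 2"
  proof (rule ccontr)
    assume "\<not> order r f < 2"
    then have "[:-r, 1:] ^ 2 dvd f" using assms(1) by (simp add: order_divides)
    then obtain g where "f = [:-r, 1:] ^ 2 * g" by (rule dvdE)
    then have f: "f = [:-r, 1:] * ([:-r, 1:] * g)" by (simp only: power2_eq_square mult.assoc)
    have "poly (pderiv f) r = 0" unfolding f by (subst pderiv_mult) simp
    then show False using assms by simp
  qed
  ultimately show ?thesis using assms by simp
qed

context valued_UNIV
begin

lemma nonneg_mult: "0 \<le> v x \<Longrightarrow> 0 \<le> v y \<Longrightarrow> 0 \<le> v (x * y)"
  using extended_add_mono[of 0 "v x" 0 "v y"] by (simp add: v_mult)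

lemma nonneg_power: "0 \<le> v x \<Longrightarrow> 0 \<le> v (x ^ n)"
  by (induction n) (auto intro: nonneg_mult)

lemma poly_diff_ge:
  assumes "\<And>i. 0 \<le> v (cf f i)" "0 \<le> v a" "0 \<le> v b"
  shows "v (a - b) \<le> v (poly f a - poly f b)"
  using assms(1)
proof (induction f)
  case (pCons c f)
  have nn: "0 \<le> v (cf f i)" for i using pCons.prems[of "Suc i"] by simp
  have "v (a - b) \<le> v (a * (poly f a - poly f b))"
    using extended_add_mono[OF assms(2) pCons.IH[OF nn]] by (simp add: v_mult)
  moreover have "v (a - b) \<le> v ((a - b) * poly f b)"
    using add_left_mono[OF poly_nonneg[OF nn assms(3)], of "v (a - b)"] by (simp add: v_mult)
  moreover have "poly (pCons c f) a - poly (pCons c f) b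
      = a * (poly f a - poly f b) + (a - b) * poly f b" by (simp add: algebra_simps)
  ultimately show ?case using v_add_ge by simp
qed simp

lemma of_nat_nonneg: "0 \<le> v (of_nat n)"
  by (induction n) (auto intro: v_add_ge)

lemma pderiv_nonneg: "(\<And>i. 0 \<le> v (cf f i)) \<Longrightarrow> 0 \<le> v (cf (pderiv f) i)"
  unfolding coeff_pderiv by (intro nonneg_mult of_nat_nonneg)

lemma pderiv_near_root:
  assumes "\<And>i. 0 \<le> v (cf f i)" "0 \<le> v a" "v (poly (pderiv f) a) = 0" "0 < v (b - a)"
  shows "0 \<le> v b" "poly (pderiv f) b \<noteq> 0"
proof -
  show b: "0 \<le> v b" using v_add_ge[of "b - a" a 0] assms by simp
  have "v (a - b) \<le> v (poly (pderiv f) a - poly (pderiv f) b)"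
    by (rule poly_diff_ge) (use assms b in \<open>auto intro: pderiv_nonneg\<close>)
  then show "poly (pderiv f) b \<noteq> 0"
    using assms(3,4) v_diff_commute[of a b] by auto
qed

end

text \<open>With two such roots, \<open>f = (X - b) (X - c) h\<close> with \<open>h\<close>
  integral, and each term of \<open>f'(a)\<close> would contain \<open>a - b\<close> or
  \<open>a - c\<close>, against \<open>v (f'(a)) = 0\<close>.\<close>

lemma (in valued_UNIV) hensel_root_unique:
  assumes f: "lcf f = 1" "\<And>i. 0 \<le> v (cf f i)" and a: "0 \<le> v a" "v (poly (pderiv f) a) = 0"
    and b: "poly f b = 0" "0 < v (b - a)" and c: "poly f c = 0" "0 < v (c - a)"
  shows "b = c"
proof (rule ccontr)
  assume "b \<noteq> c"
  obtain g where g: "f = [:-b, 1:] * g" using b(1) poly_eq_0_iff_dvd by blast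
  have "poly g c = 0" using c(1) \<open>b \<noteq> c\<close> by (simp add: g)
  then obtain h where h: "g = [:-c, 1:] * h" using poly_eq_0_iff_dvd by blast
  have b0: "0 \<le> v b" and c0: "0 \<le> v c" using pderiv_near_root[OF f(2) a] b c by auto
  \<comment> \<open>Synthetic division: the coefficients of the quotient are computed from the top
    down, without leaving the valuation ring.\<close>
  have synth: "0 \<le> v (cf q k)" if "\<And>i. 0 \<le> v (cf p i)" "p = [:-r, 1:] * q" "0 \<le> v r"
    for p q r k
  proof (induction "deg q + 1 - k" arbitrary: k)
    case 0
    then show ?case by (simp add: coeff_eq_0)
  next
    case (Suc m)
    have "cf p (Suc k) = cf q k - r * cf q (Suc k)" by (simp add: that(2))
    then have "cf q k = cf p (Suc k) + r * cf q (Suc k)" by simp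
    moreover have "0 \<le> v (cf q (Suc k))" by (rule Suc.hyps(1)) (use Suc.hyps(2) in simp)
    ultimately show ?case using that(1)[of "Suc k"] nonneg_mult[OF that(3)] v_add_ge by auto
  qed
  have gn: "0 \<le> v (cf g i)" for i using synth[OF f(2) g b0] .
  have hn: "0 \<le> v (cf h i)" for i using synth[OF gn h c0] .
  have "poly (pderiv f) a = (a - b) * poly (pderiv g) a + (a - c) * poly h a"
    unfolding g by (subst pderiv_mult) (simp add: h pderiv_pCons algebra_simps)
  moreover have "0 < v ((a - b) * poly (pderiv g) a)"
    by (intro pos_mult poly_nonneg pderiv_nonneg gn a) (use b v_diff_commute[of a b] in simp)
  moreover have "0 < v ((a - c) * poly h a)"
    by (intro pos_mult poly_nonneg hn a) (use c v_diff_commute[of a c] in simp)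
  ultimately have "0 < v (poly (pderiv f) a)" using v_add_gt by simp
  then show False using a by simp
qed

text \<open>For monic \<open>f\<close> the value of \<open>f(a)\<close> is the sum of the values of
  \<open>a - r\<close> over the roots \<open>r\<close>, so one of them is positive. This provides a
  member of the family intersected in \<open>henselization\<close>.\<close>

lemma henselian_UNIV:
  assumes "valued_UNIV (v :: 'b::alg_closed_field \<Rightarrow> 'g::linordered_ab_group_add extended)"
  shows "henselian UNIV v"
  unfolding henselian_def
proof (intro ballI impI)
  interpret valued_UNIV v by fact
  fix f :: "'b poly" and a
  assume *: "lcf f = 1 \<and> (\<forall>i. 0 \<le> v (cf f i)) \<and> 0 < v (poly f a) \<and> v (poly (pderiv f) a) = 0"
  then have f0: "f \<noteq> 0" by auto
  have "\<exists>r\<in>#proots f. 0 < v (a - r)"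
  proof (rule ccontr)
    assume neg: "\<not> ?thesis"
    have "(\<Sum>r\<in>#A. v (a - r)) \<le> 0" if "A \<subseteq># proots f" for A
      using that
    proof (induction A)
      case (add r A)
      then have "v (a - r) \<le> 0" using neg by (meson insert_subset_eq_iff not_le)
      moreover have "(\<Sum>r\<in>#A. v (a - r)) \<le> 0"
        using add by (metis subset_mset.order_trans mset_subset_eq_add_right union_single_eq_diff
            add_mset_add_single mset_subset_eq_add_left)
      ultimately show ?case using extended_add_mono[of "v (a - r)" 0 _ 0] by simp
    qed simp
    then have "v (poly f a) \<le> 0" using poly_eq_prod_roots[OF f0, of a] * by (simp add: v_prod_mset)
    then show False using * by auto
  qed
  then obtain r where "poly f r = 0" "0 < v (a - r)" using f0 by auto
  then show "\<exists>b\<in>UNIV. poly f b = 0 \<and> 0 < v (b - a)"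
    using v_diff_commute[of a r] by (intro bexI[of _ r]) auto
qed

context
  fixes v :: "'b::alg_closed_field \<Rightarrow> 'g::linordered_ab_group_add extended"
  assumes v: "valued_UNIV v"
begin

lemma subset_henselization: "F \<subseteq> henselization F v"
  by (auto simp: henselization_def)

lemma henselization_minimal: "subfield_set N \<Longrightarrow> F \<subseteq> N \<Longrightarrow> henselian N v \<Longrightarrow> henselization F v \<subseteq> N"
  by (auto simp: henselization_def subfield_iff_subfield_set)

lemma subfield_set_henselization: "subfield_set (henselization F v)"
  unfolding henselization_def subfield_iff_subfield_set by (rule subfield_set_Inter) simp

text \<open>All henselian fields containing \<open>F\<close> supply the same root by uniqueness, so
  it lies in their intersection.\<close>

lemma henselian_henselization: "henselian (henselization F v) v"
  unfolding henselian_def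
proof (intro ballI impI)
  interpret valued_UNIV v by (rule v)
  fix f a
  assume f: "f \<in> polys (henselization F v)" and a: "a \<in> valuation_ring (henselization F v) v"
    and *: "lcf f = 1 \<and> (\<forall>i. 0 \<le> v (cf f i)) \<and> 0 < v (poly f a) \<and> v (poly (pderiv f) a) = 0"
  have ex: "\<exists>b\<in>N. poly f b = 0 \<and> 0 < v (b - a)" if N: "is_subfield N" "F \<subseteq> N" "henselian N v" for N
  proof -
    have sub: "henselization F v \<subseteq> N"
      using henselization_minimal N by (simp add: subfield_iff_subfield_set)
    then have "f \<in> polys N" "a \<in> valuation_ring N v"
      using f a polys_mono by (auto simp: valuation_ring_def)
    then show ?thesis using N(3) * unfolding henselian_def by blast
  qed
  obtain b where b: "poly f b = 0" "0 < v (b - a)"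
    using ex[of UNIV] henselian_UNIV[OF v] by (auto simp: subfield_iff_subfield_set)
  have "b \<in> N" if "is_subfield N" "F \<subseteq> N" "henselian N v" for N
    using ex[OF that] b hensel_root_unique[of f a] * a by (auto simp: valuation_ring_def)
  then show "\<exists>b\<in>henselization F v. poly f b = 0 \<and> 0 < v (b - a)"
    using b by (intro bexI[of _ b]) (auto simp: henselization_def)
qed

end

section \<open>Embeddings over a henselian field preserve the valuation\<close>

lemma cf_prod_roots_scaled:
  fixes c :: "'b::field"
  assumes "c \<noteq> 0"
  shows "c ^ k * cf (\<Prod>r\<in>#A. [:-r, 1:]) k = c ^ size A * cf (\<Prod>r\<in>#image_mset (\<lambda>r. r / c) A. [:-r, 1:]) k"
proof (induction A arbitrary: k)
  case empty
  then show ?case by (cases k) (auto simp: coeff_1)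
next
  case (add r A)
  define P P' where "P = (\<Prod>r\<in>#A. [:-r, 1:])"
    and "P' = (\<Prod>r\<in>#image_mset (\<lambda>r. r / c) A. [:-r, 1:])"
  have IH: "c ^ k * cf P k = c ^ size A * cf P' k" for k using add by (simp add: P_def P'_def)
  have "c ^ k * cf ([:-r, 1:] * P) k = c * c ^ size A * cf ([:-(r / c), 1:] * P') k"
  proof (cases k)
    case 0
    then show ?thesis using IH[of 0] assms by (simp add: algebra_simps)
  next
    case (Suc j)
    have "c ^ k * cf ([:-r, 1:] * P) k = c * (c ^ j * cf P j) - r * (c ^ k * cf P k)"
      by (simp add: Suc algebra_simps)
    also have "\<dots> = c * (c ^ size A * cf P' j) - r * (c ^ size A * cf P' k)" by (simp only: IH)
    also have "\<dots> = c * c ^ size A * cf ([:-(r / c), 1:] * P') k"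
      using assms by (simp add: Suc algebra_simps)
    finally show ?thesis .
  qed
  then show ?case by (simp add: P_def P'_def)
qed

lemma map_poly_fixed:
  fixes \<sigma> :: "'b::field \<Rightarrow> 'b"
  assumes "field_emb \<sigma>" "f \<in> polys F" "\<And>x. x \<in> F \<Longrightarrow> \<sigma> x = x" shows "map_poly \<sigma> f = f"
proof -
  interpret field_emb \<sigma> by fact
  show ?thesis using assms by (auto simp: poly_eq_iff polys_def)
qed

lemma sum_mset_less:
  fixes g :: "'b \<Rightarrow> 'g::linordered_ab_group_add"
  assumes "A \<noteq> {#}" "\<And>r. r \<in># A \<Longrightarrow> g r < M"
  shows "(\<Sum>r\<in>#A. g r) < nmul (size A) M"
  using assms
proof (induction A)
  case (add r A)
  then show ?case by (cases "A = {#}") (auto intro: add_strict_mono)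
qed simp

text \<open>\<open>B\<close> collects the elements of non-maximal value. A different part of equal
  size trades some of them for elements of value \<open>M\<close>.\<close>

lemma sum_mset_least:
  fixes g :: "'b \<Rightarrow> 'g::linordered_ab_group_add"
  assumes le: "\<And>r. r \<in># A \<Longrightarrow> g r \<le> M" and B: "B = filter_mset (\<lambda>r. g r < M) A"
    and T: "T \<subseteq># A" "size T = size B" "T \<noteq> B"
  shows "(\<Sum>r\<in>#B. g r) < (\<Sum>r\<in>#T. g r)"
proof -
  define T1 T2 where "T1 = filter_mset (\<lambda>r. g r < M) T" and "T2 = filter_mset (\<lambda>r. \<not> g r < M) T"
  have TT: "T = T1 + T2" unfolding T1_def T2_def by (rule multiset_partition)
  have T1: "T1 \<subseteq># B" unfolding T1_def B by (rule multiset_filter_mono[OF T(1)])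
  have gM: "g r = M" if "r \<in># T2" for r
    using that T(1) le[of r] by (auto simp: T2_def not_less intro: antisym dest: mset_subset_eqD)
  have sT2: "(\<Sum>r\<in>#T2. g r) = nmul (size T2) M"
    using gM by (induction T2) auto
  obtain D where D: "B = T1 + D" using T1 by (metis subset_mset.add_diff_inverse)
  have "size D = size T2" using D TT T(2) by simp
  moreover have "D \<noteq> {#}" using D TT T(2,3) by auto
  ultimately have "(\<Sum>r\<in>#D. g r) < nmul (size T2) M"
    using sum_mset_less[of D g M] D B by (metis (mono_tags, lifting) filter_mset_eq_conv
        mset_subset_eqD mset_subset_eq_add_right count_greater_zero_iff mem_Collect_eq set_mset_filter)
  then show ?thesis using D TT sT2 by simp
qed

lemma (in valued_UNIV) one_unit_power: "0 < v (x - 1) \<Longrightarrow> 0 < v (x ^ n - 1)"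
proof (induction n)
  case (Suc n)
  have "0 \<le> v x" using v_add_ge[of "x - 1" 1 0] Suc.prems by simp
  then have "0 < v (x * (x ^ n - 1))"
    using pos_mult[of "x ^ n - 1" x] Suc by (simp add: mult.commute)
  moreover have "x ^ Suc n - 1 = x * (x ^ n - 1) + (x - 1)" by (simp add: algebra_simps)
  ultimately show ?case using Suc.prems v_add_gt by (metis UNIV_I)
qed (simp add: zero_extended_def)

lemma (in valued_UNIV) pos_power: "0 < v y \<Longrightarrow> n > 0 \<Longrightarrow> 0 < v (y ^ n)"
proof (induction n)
  case (Suc n)
  then show ?case using pos_mult[of y "y ^ n"] nonneg_power[of y n] by simp
qed simp

text \<open>Modulo the maximal ideal \<open>f\<close> is \<open>X - 1\<close> times a power of
  \<open>X\<close>, so 1 is a simple residual root; the lift in \<open>H\<close> is close to 1 and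
  can only be \<open>t\<close>.\<close>

lemma henselian_one_unit:
  fixes v :: "'b::alg_closed_field \<Rightarrow> 'g::linordered_ab_group_add extended"
  assumes v: "valued_UNIV v" and H: "subfield_set H" "henselian H v"
    and f: "f \<in> polys H" "lcf f = 1" and t: "proots f = add_mset t A" "0 < v (t - 1)"
    and A: "\<And>r. r \<in># A \<Longrightarrow> 0 < v r"
  shows "t \<in> H"
proof -
  interpret valued_UNIV v by fact
  interpret H: subfield_set H by fact
  have f0: "f \<noteq> 0" using f(2) by auto
  define g where "g = (\<Prod>r\<in>#A. [:-r, 1:])"
  have fg: "f = [:-t, 1:] * g"
    using poly_splits(1)[OF f0] f(2) t(1) by (simp add: g_def del: mult_pCons_left)
  have vt: "0 \<le> v t" using v_add_ge[of "t - 1" 1 0] t(2) by simp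
  have gn: "0 \<le> v (cf g k)" for k unfolding g_def
    by (rule cf_prod_roots_nonneg) (rule less_imp_le[OF A])
  have fn: "0 \<le> v (cf f k)" for k
  proof -
    have "f = (\<Prod>r\<in>#add_mset t A. [:-r, 1:])" by (simp add: fg g_def)
    moreover have "0 \<le> v r" if "r \<in># add_mset t A" for r using vt less_imp_le[OF A] that by auto
    ultimately show ?thesis using cf_prod_roots_nonneg[of "add_mset t A" k] by metis
  qed
  have one: "v (1 - r) = 0" if "r \<in># A" for r
    using v_diff_less[of 1 r] A[OF that] by simp
  have "(\<Sum>r\<in>#A. v (1 - r)) = (\<Sum>r\<in>#A. 0)" by (rule arg_cong, rule image_mset_cong) (rule one)
  then have "(\<Sum>r\<in>#A. v (1 - r)) = 0" by simp
  then have g1: "v (poly g 1) = 0"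
    by (simp add: g_def poly_prod_mset image_mset.compositionality o_def v_prod_mset)
  have t1: "0 < v (1 - t)" using t(2) v_diff_commute[of t 1] by simp
  have "0 < v (poly f 1)" using pos_mult[OF t1, of "poly g 1"] g1 by (simp add: fg algebra_simps)
  moreover have "v (poly (pderiv f) 1) = 0"
  proof -
    have e: "poly (pderiv f) 1 = poly g 1 + (1 - t) * poly (pderiv g) 1"
      unfolding fg by (subst pderiv_mult) (simp add: pderiv_pCons algebra_simps)
    have "0 < v ((1 - t) * poly (pderiv g) 1)"
      by (intro pos_mult poly_nonneg pderiv_nonneg gn t1) simp
    then show ?thesis using v_add_less[of "poly g 1" "(1 - t) * poly (pderiv g) 1"] g1 e by simp
  qed
  moreover have "1 \<in> valuation_ring H v" by (simp add: valuation_ring_def)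
  ultimately have "\<exists>b\<in>H. poly f b = 0 \<and> 0 < v (b - 1)"
    using H(2) f fn unfolding henselian_def by blast
  then obtain b where b: "b \<in> H" "poly f b = 0" "0 < v (b - 1)" by blast
  have "b \<in># proots f" using b(2) f0 by simp
  then have "b = t \<or> b \<in># A" using t(1) by simp
  moreover have "\<not> b \<in># A"
  proof
    assume "b \<in># A"
    then have "v (1 - b) = 0" using v_diff_less[of 1 b] A by simp
    then show False using b(3) v_diff_commute[of b 1] by simp
  qed
  ultimately show ?thesis using b(1) by auto
qed

text \<open>If the roots of a minimal polynomial over \<open>H\<close> have different values, take the product of those with
  non-maximal value and divide it by the dominant coefficient: this is a 1-unit \<open>\<theta>\<close> whose other conjugates
  are all infinitesimal.  Hensel's Lemma puts a power of \<open>\<theta>\<close> into \<open>H\<close>, so an embedding over \<open>H\<close> cannot move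
  a root of non-maximal value to one of maximal value.\<close>

theorem henselian_embedding_value:
  fixes v :: "'b::alg_closed_field \<Rightarrow> 'g::linordered_ab_group_add extended" and \<sigma> :: "'b \<Rightarrow> 'b"
  assumes v: "valued_UNIV v" and H: "subfield_set H" "henselian H v"
    and alg: "\<And>x. algebraic_over H x" and \<sigma>: "field_emb \<sigma>" "\<And>x. x \<in> H \<Longrightarrow> \<sigma> x = x"
  shows "v (\<sigma> x) = v x"
proof (rule ccontr)
  assume neq: "v (\<sigma> x) \<noteq> v x"
  interpret valued_UNIV v by fact
  interpret H: subfield_set H by fact
  interpret \<sigma>: field_emb \<sigma> by fact
  have x0: "x \<noteq> 0" using neq by auto
  define f where "f = minpoly H x"
  note f = H.minpoly(1-3)[OF alg, of x, folded f_def]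
  have f0: "f \<noteq> 0" unfolding f_def by (rule H.minpoly_nonzero[OF alg])
  define A where "A = proots f"
  have f_prod: "f = (\<Prod>r\<in>#A. [:-r, 1:])" using poly_splits(1)[OF f0] f(2) by (simp add: A_def)
  have emb: "\<exists>\<tau>. field_emb \<tau> \<and> (\<forall>x\<in>H. \<tau> x = x) \<and> \<tau> r = s" if "r \<in># A" "s \<in># A" for r s
  proof -
    have "minpoly H r = f" using H.minpoly_conjugate(2)[OF alg, of x r] that f0 by (simp add: f_def A_def)
    then show ?thesis using conjugate_embedding[OF H(1) alg, of r s] that f0 by (simp add: A_def)
  qed
  have xA: "x \<in># A" using f(3) f0 by (simp add: A_def)
  have sxA: "\<sigma> x \<in># A"
    using \<sigma>.poly_map_poly[of f x] map_poly_fixed[OF \<sigma>(1) f(1) \<sigma>(2)] f(3) f0 by (simp add: A_def)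
  have nz: "r \<noteq> 0" if "r \<in># A" for r
  proof -
    obtain \<tau> where "field_emb \<tau>" "\<tau> x = r" using emb[OF xA \<open>r \<in># A\<close>] by blast
    then show ?thesis using x0 field_emb.hom_eq_0_iff[of \<tau> x] by auto
  qed
  define g where "g = (\<lambda>r. case v r of Fin a \<Rightarrow> a | _ \<Rightarrow> 0)"
  have vg: "v r = Fin (g r)" if "r \<noteq> 0" for r
    by (rule v_Fin[OF UNIV_I that]) (simp add: g_def)
  define M where "M = Max (g ` set_mset A)"
  have gM: "g r \<le> M" if "r \<in># A" for r using that by (simp add: M_def)
  have "M \<in> g ` set_mset A" unfolding M_def using xA by (intro Max_in) auto
  then obtain c where c: "c \<in># A" "g c = M" by auto
  define B C where "B = filter_mset (\<lambda>r. g r < M) A" and "C = filter_mset (\<lambda>r. \<not> g r < M) A"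
  have ABC: "A = B + C" unfolding B_def C_def by (rule multiset_partition)
  have "g x \<noteq> g (\<sigma> x)" using neq vg x0 nz[OF sxA] by simp
  then obtain b where b: "b \<in># A" "g b < M"
    using gM[OF xA] gM[OF sxA] xA sxA by (metis less_le)
  have c0: "c \<noteq> 0" using nz c(1) .
  define k where "k = size C"
  \<comment> \<open>\<open>e\<close> is the elementary symmetric function of degree
    \<open>size B\<close> in the negated roots. The product \<open>\<pi>\<close> over
    \<open>B\<close> is its unique term of least value, so \<open>e\<close> and \<open>\<pi>\<close>
    agree up to larger values.\<close>
  define e where "e = cf f k"
  define \<pi> where "\<pi> = (\<Prod>r\<in>#B. - r)"
  have e: "v (\<pi> - e) > v \<pi>"
  proof -
    \<comment> \<open>Division by \<open>c\<close> moves the maximal root value \<open>M\<close> to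
      0: roots from \<open>B\<close> get negative value, those from \<open>C\<close> become
      integral.\<close>
    let ?s = "\<lambda>A. \<Prod>r\<in>#image_mset (\<lambda>r. r / c) A. [:-r, 1:]"
    have v_div: "v (r / c) = Fin (g r - M)" if "r \<in># A" for r
      using v_divide[of r c M] vg[OF nz[OF that]] vg[OF c0] c(2) by simp
    have neg: "v r < 0" if "r \<in># image_mset (\<lambda>r. r / c) B" for r
      using that v_div by (auto simp: B_def zero_extended_def)
    have nonneg: "0 \<le> v r" if "r \<in># image_mset (\<lambda>r. r / c) C" for r
      using that v_div gM by (auto simp: C_def zero_extended_def not_less)
    have sizes: "size A = size B + k" by (simp add: ABC k_def)
    have "c ^ k * e = c ^ size A * cf (?s A) k"
      unfolding e_def f_prod by (rule cf_prod_roots_scaled[OF c0])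
    then have e_eq: "e = c ^ size B * cf (?s A) k"
      using c0 by (simp add: sizes power_add)
    have "c ^ 0 * cf (\<Prod>r\<in>#B. [:-r, 1:]) 0 = c ^ size B * cf (?s B) 0"
      by (rule cf_prod_roots_scaled[OF c0])
    moreover have "cf (\<Prod>r\<in>#B. [:-r, 1:]) 0 = \<pi>"
      unfolding \<pi>_def by (induction B) (auto simp: poly_0_coeff_0[symmetric] poly_prod_mset)
    ultimately have pi_eq: "\<pi> = c ^ size B * cf (?s B) 0" by simp
    have deg_C: "deg (?s C) = k \<and> lcf (?s C) = 1"
    proof -
      have "deg (?s C) = k"
        unfolding k_def
      proof (induction C)
        case (add r C)
        have "?s C \<noteq> 0" by (auto simp: prod_mset_zero_iff)
        then show ?case using add by (simp add: degree_mult_eq del: mult_pCons_left)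
      qed simp
      moreover have "lcf (?s C) = 1"
        by (induction C) (auto simp: lead_coeff_mult simp del: mult_pCons_left)
      ultimately show ?thesis by simp
    qed
    have "cf (?s A) k = (\<Sum>i\<le>k. cf (?s B) i * cf (?s C) (k - i))"
      by (simp add: ABC coeff_mult)
    also have "\<dots> = cf (?s B) 0 * cf (?s C) k + (\<Sum>i\<in>{..k} - {0}. cf (?s B) i * cf (?s C) (k - i))"
      by (subst sum.remove[of _ 0]) auto
    finally have diff: "cf (?s B) 0 - cf (?s A) k
        = - (\<Sum>i\<in>{..k} - {0}. cf (?s B) i * cf (?s C) (k - i))"
      using deg_C by auto
    have lt: "v (cf (?s B) 0) < v (cf (?s B) i)" if "i > 0" for i
      by (rule cf_prod_roots_neg) (use neg that in auto)
    have "v (cf (?s B) 0) < v (\<Sum>i\<in>{..k} - {0}. cf (?s B) i * cf (?s C) (k - i))"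
    proof (rule v_sum_gt)
      show "v (cf (?s B) 0) < \<infinity>" using lt[of 1] by (auto simp: less_Pinf_iff)
      fix i assume "i \<in> {..k} - {0}"
      then have "v (cf (?s B) 0) < v (cf (?s B) i) + 0" using lt[of i] by simp
      also have "\<dots> \<le> v (cf (?s B) i) + v (cf (?s C) (k - i))"
        by (rule add_left_mono) (rule cf_prod_roots_nonneg, use nonneg in auto)
      finally show "cf (?s B) i * cf (?s C) (k - i) \<in> UNIV \<and>
          v (cf (?s B) 0) < v (cf (?s B) i * cf (?s C) (k - i))" by (simp add: v_mult)
    qed
    then have *: "v (cf (?s B) 0) < v (cf (?s B) 0 - cf (?s A) k)" unfolding diff by simp
    have "v (c ^ size B) = Fin (nmul (size B) M)" using vg[OF c0] c(2) by (simp add: v_power)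
    then have "v (c ^ size B * cf (?s B) 0) < v (c ^ size B * (cf (?s B) 0 - cf (?s A) k))"
      using * by (simp add: v_mult)
    then show ?thesis by (simp add: pi_eq e_eq algebra_simps)
  qed
  have ve: "v e = v \<pi>" using v_diff_less(2)[of \<pi> "\<pi> - e"] e by simp
  have v\<pi>: "v (\<Prod>r\<in>#T. - r) = Fin (\<Sum>r\<in>#T. g r)" if "T \<subseteq># A" for T
    using that
  proof (induction T)
    case (add r T)
    then have "r \<in># A" "T \<subseteq># A" by (auto dest: mset_subset_eq_insertD subset_mset.less_imp_le)
    then show ?case using add.IH vg[OF nz[of r]] by (simp add: v_mult)
  qed (simp add: zero_extended_def)
  have BA: "B \<subseteq># A" by (simp add: ABC)
  have e0: "e \<noteq> 0" using ve v\<pi>[OF BA] by (auto simp: \<pi>_def)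
  have eH: "e \<in> H" unfolding e_def by (rule H.coeff_mem[OF f(1)])
  define \<theta> where "\<theta> = \<pi> / e"
  have \<theta>1: "0 < v (\<theta> - 1)"
  proof -
    have "\<theta> - 1 = (\<pi> - e) / e" using e0 by (simp add: \<theta>_def diff_divide_distrib)
    then have "v (\<theta> - 1) = v (\<pi> - e) + Fin (- (\<Sum>r\<in>#B. g r))"
      using v_divide[of "\<pi> - e" e] ve v\<pi>[OF BA] by (simp add: \<pi>_def)
    moreover have "Fin (- (\<Sum>r\<in>#B. g r)) + v \<pi> < Fin (- (\<Sum>r\<in>#B. g r)) + v (\<pi> - e)"
      using e by simp
    ultimately show ?thesis
      using v\<pi>[OF BA] by (simp add: \<pi>_def add.commute zero_extended_def)
  qed
  \<comment> \<open>An embedding over \<open>H\<close> permutes \<open>A\<close> and sends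
    \<open>B\<close> to a part of the same size; unless that part is \<open>B\<close>, its product
    has larger value and \<open>\<tau> \<theta>\<close> becomes infinitesimal.\<close>
  have dich: "image_mset \<tau> B = B \<and> \<tau> \<theta> = \<theta> \<or> 0 < v (\<tau> \<theta>)"
    if \<tau>: "field_emb \<tau>" "\<forall>x\<in>H. \<tau> x = x" for \<tau>
  proof -
    interpret \<tau>: field_emb \<tau> by fact
    have "map_poly \<tau> f = f" using map_poly_fixed[OF \<tau>(1) f(1)] \<tau>(2) by blast
    then have "image_mset \<tau> A = A" using proots_map_poly[OF \<tau>(1), of f] by (simp add: A_def)
    then have TA: "image_mset \<tau> B \<subseteq># A" by (metis ABC image_mset_subseteq_mono mset_subset_eq_add_left)
    have \<tau>\<theta>: "\<tau> \<theta> = (\<Prod>r\<in>#image_mset \<tau> B. - r) / e"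
      using \<tau>(2) eH by (simp add: \<theta>_def \<pi>_def \<tau>.hom_prod_mset image_mset.compositionality o_def)
    show ?thesis
    proof (cases "image_mset \<tau> B = B")
      case True
      then show ?thesis using \<tau>\<theta> by (simp add: \<theta>_def \<pi>_def)
    next
      case False
      have "(\<Sum>r\<in>#B. g r) < (\<Sum>r\<in>#image_mset \<tau> B. g r)"
        by (rule sum_mset_least[OF gM B_def TA]) (use False in auto)
      moreover have "v (\<tau> \<theta>) = Fin (\<Sum>r\<in>#image_mset \<tau> B. g r) + Fin (- (\<Sum>r\<in>#B. g r))"
        unfolding \<tau>\<theta> v\<pi>[OF TA, symmetric] by (rule v_divide) (use ve v\<pi>[OF BA] in \<open>auto simp: \<pi>_def\<close>)
      ultimately show ?thesis by (simp add: zero_extended_def)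
    qed
  qed
  \<comment> \<open>Hensel's Lemma needs a simple root, and \<open>\<theta>\<close> may be
    inseparable over \<open>H\<close>.\<close>
  obtain q where q: "q > 0" "pderiv (minpoly H (\<theta> ^ q)) \<noteq> 0"
    using H.separable_power[OF alg alg] by blast
  define h where "h = minpoly H (\<theta> ^ q)"
  note h = H.minpoly(1-3)[OF alg, of "\<theta> ^ q", folded h_def]
  have h0: "h \<noteq> 0" unfolding h_def by (rule H.minpoly_nonzero[OF alg])
  have roots_h: "r = \<theta> ^ q \<or> 0 < v r" if r: "poly h r = 0" for r
  proof -
    obtain \<tau> where \<tau>: "field_emb \<tau>" "\<forall>x\<in>H. \<tau> x = x" "\<tau> (\<theta> ^ q) = r"
      using conjugate_embedding[OF H(1) alg, of "\<theta> ^ q" r] r by (auto simp: h_def)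
    interpret \<tau>: field_emb \<tau> by fact
    have *: "r = \<tau> \<theta> ^ q" using \<tau>(3) by simp
    show ?thesis using dich[OF \<tau>(1,2)] * pos_power[OF _ q(1)] by auto
  qed
  have "count (proots h) (\<theta> ^ q) = 1"
    by (rule count_proots_simple[OF h0 h(3)])
       (use H.minpoly_simple_root[OF alg q(2)] h(3) in \<open>simp add: h_def\<close>)
  define D where "D = proots h - {#\<theta> ^ q#}"
  have D: "proots h = add_mset (\<theta> ^ q) D" using h(3) h0 by (simp add: D_def)
  have D': "\<theta> ^ q \<notin># D"
    using \<open>count (proots h) (\<theta> ^ q) = 1\<close> unfolding D by (simp add: not_in_iff)
  have "\<theta> ^ q \<in> H"
  proof (rule henselian_one_unit[OF v H h(1,2) D one_unit_power[OF \<theta>1]])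
    fix r assume r: "r \<in># D"
    then have "r \<in># proots h" unfolding D by simp
    then have "poly h r = 0" using h0 by simp
    then show "0 < v r" using roots_h D' r by auto
  qed
  obtain \<tau> where \<tau>: "field_emb \<tau>" "\<forall>x\<in>H. \<tau> x = x" "\<tau> b = c" using emb[OF b(1) c(1)] by blast
  interpret \<tau>: field_emb \<tau> by fact
  \<comment> \<open>The fixed power has value 0, so \<open>\<tau> \<theta>\<close> is not
    infinitesimal and \<open>\<tau>\<close> maps \<open>B\<close> onto itself, although it sends
    \<open>b\<close>, an element of \<open>B\<close>, to \<open>c\<close>, which is not in
    \<open>B\<close>.\<close>
  have "\<tau> \<theta> ^ q = \<theta> ^ q" using \<tau>(2) \<open>\<theta> ^ q \<in> H\<close> by (metis \<tau>.hom_power)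
  moreover have "v (\<theta> ^ q) = 0"
    using v_add_less[of 1 "\<theta> ^ q - 1"] one_unit_power[OF \<theta>1, of q] by simp
  ultimately have "\<not> 0 < v (\<tau> \<theta>)"
    using pos_power[of "\<tau> \<theta>" q] q(1) by auto
  then have "image_mset \<tau> B = B" using dich[OF \<tau>(1,2)] by auto
  moreover have "b \<in># B" using b by (simp add: B_def)
  ultimately have "c \<in># B" using \<tau>(3) by (metis image_eqI set_image_mset)
  then show False using c(2) by (simp add: B_def)
qed

section \<open>Henselization and purely inseparable elements\<close>

lemma subfield_set_Union_chain:
  assumes "C \<noteq> {}" "\<And>N N'. N \<in> C \<Longrightarrow> N' \<in> C \<Longrightarrow> N \<subseteq> N' \<or> N' \<subseteq> N" "\<And>N. N \<in> C \<Longrightarrow> subfield_set N"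
  shows "subfield_set (\<Union>C)"
proof
  show "0 \<in> \<Union>C" "1 \<in> \<Union>C"
    using assms(1,3) subfield_set.zero_mem subfield_set.one_mem by blast+
  fix x y assume "x \<in> \<Union>C" "y \<in> \<Union>C"
  then obtain N where N: "N \<in> C" "x \<in> N" "y \<in> N" using assms(2) by blast
  interpret subfield_set N using assms(3) N(1) .
  show "x + y \<in> \<Union>C" "x * y \<in> \<Union>C" "- x \<in> \<Union>C" "inverse x \<in> \<Union>C"
    using N by (meson UnionI add_mem mult_mem uminus_mem inverse_mem)+
qed

text \<open>A subfield \<open>N\<close> that is maximal among those omitting \<open>y\<close> is already henselian: a Hensel root \<open>b\<close>
  outside \<open>N\<close> is separable and \<open>y = g(b)\<close> for a polynomial \<open>g\<close> of small degree, but \<open>g\<close> takes the value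
  \<open>y\<close> at all conjugates of \<open>b\<close>, so it is constant.\<close>

theorem henselization_omits_purely_inseparable:
  fixes v :: "'b::alg_closed_field \<Rightarrow> 'g::linordered_ab_group_add extended"
  assumes v: "valued_UNIV v" and F: "subfield_set F"
    and y: "y \<notin> F" and P: "P \<in> polys F" "P \<noteq> 0" "poly P y = 0" "\<And>r. poly P r = 0 \<Longrightarrow> r = y"
  shows "y \<notin> henselization F v"
proof -
  interpret valued_UNIV v by fact
  define A where "A = {N. F \<subseteq> N \<and> subfield_set N \<and> y \<notin> N}"
  have "\<exists>M\<in>A. \<forall>N\<in>A. M \<subseteq> N \<longrightarrow> N = M"
  proof (rule subset_Zorn_nonempty)
    show "A \<noteq> {}" using F y by (auto simp: A_def)
    fix C assume C: "C \<noteq> {}" "subset.chain A C"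
    then have "subfield_set (\<Union>C)"
      by (intro subfield_set_Union_chain) (auto simp: A_def subset_chain_def)
    moreover have "y \<notin> \<Union>C" using C by (auto simp: A_def subset_chain_def)
    moreover have "F \<subseteq> \<Union>C" using C by (force simp: A_def subset_chain_def)
    ultimately show "\<Union>C \<in> A" by (simp add: A_def)
  qed
  then obtain N where "N \<in> A" and "\<forall>N'\<in>A. N \<subseteq> N' \<longrightarrow> N' = N" by (elim bexE)
  then have N: "F \<subseteq> N" "subfield_set N" "y \<notin> N" by (auto simp: A_def)
  have max: "N' = N" if "N \<subseteq> N'" "subfield_set N'" "y \<notin> N'" for N'
    using \<open>\<forall>N'\<in>A. N \<subseteq> N' \<longrightarrow> N' = N\<close> that N(1) by (auto simp: A_def)
  interpret N: subfield_set N by fact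
  have PN: "P \<in> polys N" using P(1) polys_mono[OF N(1)] by blast
  have "henselian N v" unfolding henselian_def
  proof (intro ballI impI)
    fix f a
    assume f: "f \<in> polys N" and a: "a \<in> valuation_ring N v"
      and *: "lcf f = 1 \<and> (\<forall>i. 0 \<le> v (cf f i)) \<and> 0 < v (poly f a) \<and> v (poly (pderiv f) a) = 0"
    obtain b where b: "poly f b = 0" "0 < v (b - a)"
      using henselian_UNIV[OF v] a * unfolding henselian_def valuation_ring_def polys_def
      by (auto dest!: spec[of _ f] spec[of _ a])
    have alg: "algebraic_over N b" unfolding algebraic_over_def
      using f b(1) * by (intro bexI[of _ f]) auto
    have "b \<in> N"
    proof (rule ccontr)
      assume "b \<notin> N"
      define L where "L = {poly p b |p. p \<in> polys N}"
      have "N \<subseteq> L" "b \<in> L" unfolding L_def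
        by (rule N.simple_extension_superset N.simple_extension_generator)+
      then have "y \<in> L"
        using max[of L] N.subfield_set_simple_extension[OF alg] \<open>b \<notin> N\<close> by (auto simp: L_def)
      then obtain g0 where g0: "g0 \<in> polys N" "y = poly g0 b" by (auto simp: L_def)
      define h where "h = minpoly N b"
      note h = N.minpoly(1-3)[OF alg, folded h_def]
      have h0: "h \<noteq> 0" unfolding h_def by (rule N.minpoly_nonzero[OF alg])
      obtain q g where qg: "q \<in> polys N" "g \<in> polys N" "g0 = q * h + g" "g = 0 \<or> deg g < deg h"
        using N.polys_division[OF h(1) h0 g0(1)] by blast
      have gb: "poly g b = y" using g0(2) qg(3) h(3) by simp
      \<comment> \<open>\<open>b\<close> is a simple root of \<open>f\<close>, hence of its factor
        \<open>h\<close>; this makes the roots of \<open>h\<close> distinct.\<close>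
      have fb: "poly (pderiv f) b \<noteq> 0" using pderiv_near_root(2)[of f a b] * a b
        by (auto simp: valuation_ring_def)
      obtain k where k: "f = h * k" using N.minpoly_dvd[OF alg f b(1)] unfolding h_def by blast
      have "pderiv h \<noteq> 0"
      proof
        assume "pderiv h = 0"
        then have "poly (pderiv f) b = 0" using h(3) by (simp add: k pderiv_mult)
        then show False using fb by simp
      qed
      then have simple: "count (proots h) r = 1" if "poly h r = 0" for r
        using that h0 N.minpoly_simple_root[OF alg, of r]
        by (intro count_proots_simple) (auto simp: h_def)
      have "card {r. poly h r = 0} = size (proots h)"
        using simple h0 by (simp add: size_multiset_overloaded_eq)
      then have card_h: "card {r. poly h r = 0} = deg h" using poly_splits(2)[OF h0] by simp
      \<comment> \<open>\<open>P(g(X))\<close> vanishes at \<open>b\<close>, hence at all its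
        conjugates, and \<open>y\<close> is the only root of \<open>P\<close>.\<close>
      have conj: "poly g r = y" if r: "poly h r = 0" for r
      proof -
        have "h dvd pcompose P g" unfolding h_def
          by (rule N.minpoly_dvd[OF alg N.polys_pcompose[OF PN qg(2)]]) (simp add: poly_pcompose gb P(3))
        then have "poly (pcompose P g) r = 0" using r by (auto elim!: dvdE)
        then show ?thesis using P(4) by (simp add: poly_pcompose)
      qed
      have "g - [:y:] = 0"
      proof (rule ccontr)
        assume ne: "g - [:y:] \<noteq> 0"
        have "{r. poly h r = 0} \<subseteq> {r. poly (g - [:y:]) r = 0}" using conj by auto
        then have "deg h \<le> card {r. poly (g - [:y:]) r = 0}"
          unfolding card_h[symmetric] using poly_roots_finite[OF ne] by (intro card_mono) auto
        also have "\<dots> \<le> deg (g - [:y:])" by (rule card_poly_roots_bound[OF ne])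
        also have "\<dots> \<le> deg g" by (metis degree_diff_le degree_pCons_0 le_refl zero_le)
        finally show False using qg(4) N.minpoly_deg_pos[OF alg] by (auto simp: h_def)
      qed
      then have "[:y:] \<in> polys N" using qg(2) by simp
      then show False using N(3) by simp
    qed
    then show "\<exists>b\<in>N. poly f b = 0 \<and> 0 < v (b - a)" using b by blast
  qed
  then show ?thesis using henselization_minimal[OF v N(2,1)] N(3) by blast
qed

section \<open>Rational rank\<close>

text \<open>If the \<open>n\<close>-th power of \<open>a\<close> is neutral, then \<open>q\<close>
  tensor \<open>a\<close> equals \<open>q / n\<close> tensor that power, which is zero.\<close>

lemma rat_tensor_null_torsion:
  assumes A: "group A" and tors: "\<And>a. a \<in> carrier A \<Longrightarrow> \<exists>n::nat>0. a [^]\<^bsub>A\<^esub> n = \<one>\<^bsub>A\<^esub>"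
    and t: "t \<in> carrier (rat_tensor_free A)"
  shows "t \<in> rat_tensor_null A"
proof -
  interpret A: group A by fact
  define N where "N = rat_tensor_null A"
  have N0: "0 \<in> N" unfolding N_def rat_tensor_null_def rat_tensor_free_def
    using generate.one[of "free_Abelian_group (UNIV \<times> carrier A)"] by simp
  have Nadd: "x + y \<in> N" if "x \<in> N" "y \<in> N" for x y
    using generate.eng[OF that[unfolded N_def rat_tensor_null_def]]
    by (simp add: N_def rat_tensor_null_def rat_tensor_free_def)
  define gens where "gens = {frag_of (q + r :: rat, a) - frag_of (q, a) - frag_of (r, a) | q r a. a \<in> carrier A} \<union>
     {frag_of (q, a \<otimes>\<^bsub>A\<^esub> b) - frag_of (q, a) - frag_of (q, b) | q a b.
        a \<in> carrier A \<and> b \<in> carrier A}"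
  have gens_sub: "gens \<subseteq> carrier (rat_tensor_free A)"
    unfolding gens_def rat_tensor_free_def
    by (auto dest!: subsetD[OF keys_diff] split: if_splits)
  have N_gens: "N = generate (rat_tensor_free A) gens"
    by (simp add: N_def rat_tensor_null_def gens_def)
  interpret Fr: group "rat_tensor_free A" unfolding rat_tensor_free_def by simp
  have Nneg: "- x \<in> N" if "x \<in> N" for x
  proof -
    have x: "x \<in> carrier (rat_tensor_free A)"
      using Fr.generate_in_carrier[OF gens_sub] that N_gens by simp
    have "inv\<^bsub>rat_tensor_free A\<^esub> x \<in> N"
      using Fr.generate_m_inv_closed[OF gens_sub] that N_gens by simp
    then show ?thesis using x by (simp add: rat_tensor_free_def)
  qed
  have Ndiff: "x - y \<in> N" if "x \<in> N" "y \<in> N" for x y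
    using Nadd[OF that(1) Nneg[OF that(2)]] by simp
  have Ngen: "x \<in> N" if "x \<in> gens" for x using that by (simp add: N_gens generate.incl)
  have gen1: "frag_of (q + r, a) - frag_of (q, a) - frag_of (r, a) \<in> N" if "a \<in> carrier A" for q r a
    by (rule Ngen) (use that in \<open>auto simp: gens_def\<close>)
  have gen2: "frag_of (q, a \<otimes>\<^bsub>A\<^esub> b) - frag_of (q, a) - frag_of (q, b) \<in> N"
    if "a \<in> carrier A" "b \<in> carrier A" for q a b
    by (rule Ngen) (use that in \<open>auto simp: gens_def\<close>)
  \<comment> \<open>A positive integer factor moves from the rational to the group component by
    repeated use of both bilinearity relations.\<close>
  have move: "frag_of (of_nat (Suc k) * q, a) - frag_of (q, a [^]\<^bsub>A\<^esub> Suc k) \<in> N"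
    if a: "a \<in> carrier A" for k q a
  proof (induction k)
    case 0
    then show ?case using N0 a by simp
  next
    case (Suc k)
    have "frag_of (of_nat (Suc (Suc k)) * q, a) - frag_of (q, a [^]\<^bsub>A\<^esub> Suc (Suc k))
      = (frag_of (of_nat (Suc k) * q + q, a) - frag_of (of_nat (Suc k) * q, a) - frag_of (q, a))
        + (frag_of (of_nat (Suc k) * q, a) - frag_of (q, a [^]\<^bsub>A\<^esub> Suc k))
        - (frag_of (q, a [^]\<^bsub>A\<^esub> Suc k \<otimes>\<^bsub>A\<^esub> a) - frag_of (q, a [^]\<^bsub>A\<^esub> Suc k) - frag_of (q, a))"
      by (simp add: algebra_simps)
    also have "\<dots> \<in> N"
      by (intro Ndiff Nadd gen1[OF a] Suc gen2 a A.nat_pow_closed)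
    finally show ?case .
  qed
  have elem: "frag_of (q, a) \<in> N" if a: "a \<in> carrier A" for q a
  proof -
    obtain n :: nat where n: "n > 0" "a [^]\<^bsub>A\<^esub> n = \<one>\<^bsub>A\<^esub>" using tors[OF a] by blast
    obtain k where k: "n = Suc k" using n(1) gr0_implies_Suc by blast
    define r where "r = q / of_nat n"
    have "of_nat (Suc k) * r = q" using n(1) k by (simp add: r_def)
    then have *: "frag_of (q, a) - frag_of (r, \<one>\<^bsub>A\<^esub>) \<in> N" using move[OF a, of k r] n(2) k by simp
    \<comment> \<open>As the product of \<open>\<one>\<close> with itself is \<open>\<one>\<close>,
      this relation is just minus the generator.\<close>
    have "frag_of (r, \<one>\<^bsub>A\<^esub> \<otimes>\<^bsub>A\<^esub> \<one>\<^bsub>A\<^esub>) - frag_of (r, \<one>\<^bsub>A\<^esub>) - frag_of (r, \<one>\<^bsub>A\<^esub>) \<in> N"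
      by (intro gen2) auto
    then have "- frag_of (r, \<one>\<^bsub>A\<^esub>) \<in> N" by simp
    from Ndiff[OF * this] show ?thesis by simp
  qed
  have "t \<in> N"
    by (rule free_Abelian_group_induct[of t "UNIV \<times> carrier A"])
       (use t elem N0 Ndiff in \<open>auto simp: rat_tensor_free_def\<close>)
  then show ?thesis by (simp add: N_def)
qed

text \<open>For torsion \<open>A\<close> every element is null, so each coefficient function
  represents 0; on a one-element \<open>B\<close> the functions 0 and 1 violate uniqueness.\<close>

lemma rat_tensor_dim_1_not_torsion:
  assumes A: "group A" and dim: "rat_tensor_dim A 1"
  shows "\<exists>a\<in>carrier A. \<forall>n::nat. n > 0 \<longrightarrow> a [^]\<^bsub>A\<^esub> n \<noteq> \<one>\<^bsub>A\<^esub>"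
proof (rule ccontr)
  assume "\<not> ?thesis"
  then have tors: "\<exists>n::nat>0. a [^]\<^bsub>A\<^esub> n = \<one>\<^bsub>A\<^esub>" if "a \<in> carrier A" for a using that by blast
  note null = rat_tensor_null_torsion[OF A tors]
  from dim obtain B where B: "B \<subseteq> carrier (rat_tensor_free A)" "card B = 1"
    and uniq: "\<forall>t\<in>carrier (rat_tensor_free A).
      \<exists>!c. c \<in> B \<rightarrow>\<^sub>E UNIV \<and> t - (\<Sum>b\<in>B. rat_tensor_scale (c b) b) \<in> rat_tensor_null A"
    unfolding rat_tensor_dim_def by (elim exE conjE)
  obtain b where b: "B = {b}" using B(2) by (auto simp: card_1_singleton_iff)
  have scale: "rat_tensor_scale q b \<in> carrier (rat_tensor_free A)" for q
  proof -
    have "Poly_Mapping.keys (rat_tensor_scale q b)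
        \<subseteq> (\<Union>x\<in>Poly_Mapping.keys b. Poly_Mapping.keys (case x of (r, a) \<Rightarrow> frag_of (q * r, a)))"
      unfolding rat_tensor_scale_def by (rule keys_frag_extend)
    then show ?thesis using B(1) b by (fastforce simp: rat_tensor_free_def)
  qed
  have "0 - (\<Sum>b\<in>B. rat_tensor_scale (c b) b) \<in> rat_tensor_null A" for c
    by (rule null) (use scale b in \<open>auto simp: rat_tensor_free_def\<close>)
  moreover have "0 \<in> carrier (rat_tensor_free A)" by (simp add: rat_tensor_free_def)
  from bspec[OF uniq this] obtain c0 where "\<And>c. c \<in> B \<rightarrow>\<^sub>E UNIV \<Longrightarrow>
      0 - (\<Sum>b\<in>B. rat_tensor_scale (c b) b) \<in> rat_tensor_null A \<Longrightarrow> c = c0"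
    by (elim ex1E) blast
  ultimately have eq: "c = c0" if "c \<in> B \<rightarrow>\<^sub>E UNIV" for c using that by blast
  have "(\<lambda>x\<in>B. 0) = (\<lambda>x\<in>B. 1 :: rat)" by (rule trans[OF eq eq[symmetric]]) auto
  then show False using b by (auto simp: fun_eq_iff split: if_splits)
qed

text \<open>Powers in the factor group are cosets of multiples, which translates the multiplicative
  notation into \<open>nmul\<close>.\<close>

lemma quotient_not_torsion:
  fixes G H :: "'g::ab_group_add set"
  assumes G: "0 \<in> G" "\<And>x y. x \<in> G \<Longrightarrow> y \<in> G \<Longrightarrow> x + y \<in> G" "\<And>x. x \<in> G \<Longrightarrow> - x \<in> G"
    and H: "0 \<in> H" "\<And>x y. x \<in> H \<Longrightarrow> y \<in> H \<Longrightarrow> x + y \<in> H" "\<And>x. x \<in> H \<Longrightarrow> - x \<in> H" "H \<subseteq> G"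
    and dim: "rat_tensor_dim (additive_group G Mod H) 1"
  shows "\<exists>\<gamma>\<in>G. \<forall>n>0. nmul n \<gamma> \<notin> H"
proof -
  let ?A = "additive_group G"
  have G': "comm_group ?A"
    by (rule comm_groupI) (use G in \<open>auto simp: additive_group_def algebra_simps\<close>,
      metis G(3) add.right_inverse add.commute)
  interpret A: comm_group ?A by (rule G')
  have inv: "inv\<^bsub>?A\<^esub> x = - x" if "x \<in> G" for x
    by (rule A.inv_equality) (use that G in \<open>auto simp: additive_group_def\<close>)
  have "subgroup H ?A"
    by (rule A.subgroupI) (use H inv in \<open>auto simp: additive_group_def\<close>)
  then interpret H: normal H ?A by (rule A.subgroup_imp_normal)
  obtain a where a: "a \<in> carrier (?A Mod H)" "\<And>n::nat. n > 0 \<Longrightarrow> a [^]\<^bsub>?A Mod H\<^esub> n \<noteq> \<one>\<^bsub>?A Mod H\<^esub>"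
    using rat_tensor_dim_1_not_torsion[OF H.factorgroup_is_group dim] by blast
  obtain \<gamma> where \<gamma>: "\<gamma> \<in> G" "a = H #>\<^bsub>?A\<^esub> \<gamma>" using a(1) by (auto simp: carrier_FactGroup additive_group_def)
  have nG: "nmul n \<gamma> \<in> G" for n by (induction n) (use G \<gamma> in auto)
  have pow: "a [^]\<^bsub>?A Mod H\<^esub> n = H #>\<^bsub>?A\<^esub> nmul n \<gamma>" for n :: nat
  proof (induction n)
    case 0
    show ?case using H.subset A.coset_mult_one[of H] by (simp add: additive_group_def)
  next
    case (Suc n)
    have "a [^]\<^bsub>?A Mod H\<^esub> Suc n = (H #>\<^bsub>?A\<^esub> nmul n \<gamma>) <#>\<^bsub>?A\<^esub> (H #>\<^bsub>?A\<^esub> \<gamma>)"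
      using Suc \<gamma>(2) by simp
    also have "\<dots> = H #>\<^bsub>?A\<^esub> (nmul n \<gamma> \<otimes>\<^bsub>?A\<^esub> \<gamma>)"
      by (rule H.rcos_sum) (use nG \<gamma> in \<open>auto simp: additive_group_def\<close>)
    also have "\<dots> = H #>\<^bsub>?A\<^esub> nmul (Suc n) \<gamma>" by (simp add: additive_group_def add.commute)
    finally show ?case .
  qed
  have "nmul n \<gamma> \<notin> H" if "n > 0" for n
  proof
    assume "nmul n \<gamma> \<in> H"
    then have "H #>\<^bsub>?A\<^esub> nmul n \<gamma> = H" by (intro A.coset_join2) (use nG H.subgroup_axioms in \<open>auto simp: additive_group_def\<close>)
    then show False using a(2)[OF that] pow[of n] by simp
  qed
  then show ?thesis using \<gamma>(1) by blast
qed

section \<open>Pseudo convergent sequences\<close>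

lemma index_succ: "\<nu> < index_succ (\<nu> :: 'i::{wellorder, no_top})"
  unfolding index_succ_def using gt_ex[of \<nu>] by (rule LeastI_ex)

lemma index_succ_le: "\<nu> < \<mu> \<Longrightarrow> index_succ \<nu> \<le> (\<mu> :: 'i::{wellorder, no_top})"
  unfolding index_succ_def by (rule Least_le)

locale pcs = valued_UNIV v for v :: "'b::field \<Rightarrow> 'g::linordered_ab_group_add extended" +
  fixes z :: "'i::{wellorder, no_top} \<Rightarrow> 'b"
  assumes pc: "pseudo_convergent v z"
begin

abbreviation "\<delta> \<equiv> pcs_delta v z"

lemma pcD: "\<nu>1 < \<nu>2 \<Longrightarrow> \<nu>2 < \<nu>3 \<Longrightarrow> v (z \<nu>1 - z \<nu>2) < v (z \<nu>2 - z \<nu>3)"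
  using pc by (auto simp: pseudo_convergent_def)

lemma delta_eq: "\<nu> < \<mu> \<Longrightarrow> v (z \<nu> - z \<mu>) = \<delta> \<nu>"
proof -
  assume "\<nu> < \<mu>"
  then consider "\<mu> = index_succ \<nu>" | "index_succ \<nu> < \<mu>" using index_succ_le by fastforce
  then show ?thesis
  proof cases
    case 2
    have "v ((z \<nu> - z (index_succ \<nu>)) + (z (index_succ \<nu>) - z \<mu>)) = v (z \<nu> - z (index_succ \<nu>))"
      by (rule v_add_less) (use pcD[OF index_succ 2] in auto)
    then show ?thesis by (simp add: pcs_delta_def)
  qed (simp add: pcs_delta_def)
qed

lemma delta_less: "\<nu> < \<mu> \<Longrightarrow> \<delta> \<nu> < \<delta> \<mu>"
  using pcD[of \<nu> \<mu> "index_succ \<mu>"] index_succ[of \<mu>] delta_eq[of \<nu> \<mu>] by (simp add: pcs_delta_def)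

lemma delta_Fin: obtains g where "\<delta> \<nu> = Fin g"
proof -
  have "\<delta> \<nu> \<noteq> \<infinity>" using delta_less[OF index_succ[of \<nu>]] by auto
  moreover have "\<delta> \<nu> \<noteq> -\<infinity>" by (simp add: pcs_delta_def)
  ultimately show thesis using that by (cases "\<delta> \<nu>") auto
qed

text \<open>At an earlier index \<open>\<nu>\<close> the difference to a late \<open>z \<mu>\<close>
  has value \<open>\<delta> \<nu>\<close>, and the correction \<open>y - z \<mu>\<close> has larger
  value; so "eventually" improves to "always".\<close>

lemma limit_iff: "pcs_limit v z y \<longleftrightarrow> (\<forall>\<nu>. v (y - z \<nu>) = \<delta> \<nu>)"
proof
  assume "pcs_limit v z y"
  then obtain N where N: "\<And>\<nu>. \<nu> \<ge> N \<Longrightarrow> v (y - z \<nu>) = \<delta> \<nu>"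
    unfolding pcs_limit_def eventually_at_top_linorder by blast
  show "\<forall>\<nu>. v (y - z \<nu>) = \<delta> \<nu>"
  proof
    fix \<nu>
    obtain \<mu> where \<mu>: "max \<nu> N < \<mu>" using gt_ex by blast
    have "v ((z \<mu> - z \<nu>) + (y - z \<mu>)) = v (z \<mu> - z \<nu>)"
      by (rule v_add_less)
        (use N[of \<mu>] \<mu> delta_eq[of \<nu> \<mu>] delta_less[of \<nu> \<mu>] v_diff_commute[of "z \<mu>" "z \<nu>"] in auto)
    then show "v (y - z \<nu>) = \<delta> \<nu>"
      using \<mu> delta_eq[of \<nu> \<mu>] v_diff_commute[of "z \<mu>" "z \<nu>"] by simp
  qed
qed (simp add: pcs_limit_def)

text \<open>If the value exceeds \<open>\<delta> \<nu>\<close>, it drops to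
  \<open>\<delta> \<nu>\<close> at the next index, where \<open>\<delta>\<close> is larger.\<close>

lemma nonlimitE:
  assumes "\<not> pcs_limit v z y"
  obtains \<nu> where "v (y - z \<nu>) < \<delta> \<nu>"
proof -
  obtain \<nu> where \<nu>: "v (y - z \<nu>) \<noteq> \<delta> \<nu>" using assms limit_iff by blast
  show thesis
  proof (cases "v (y - z \<nu>) < \<delta> \<nu>")
    case False
    let ?\<mu> = "index_succ \<nu>"
    have "v ((z \<nu> - z ?\<mu>) + (y - z \<nu>)) = v (z \<nu> - z ?\<mu>)"
      by (rule v_add_less) (use False \<nu> in \<open>auto simp: pcs_delta_def\<close>)
    then have "v (y - z ?\<mu>) = \<delta> \<nu>" by (simp add: pcs_delta_def)
    then show thesis using that[of ?\<mu>] delta_less[OF index_succ[of \<nu>]] by simp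
  qed (use that in blast)
qed

lemma below_delta_constant:
  assumes "v (y - z \<nu>) < \<delta> \<nu>" "\<nu> \<le> \<mu>" shows "v (y - z \<mu>) = v (y - z \<nu>)"
proof (cases "\<nu> = \<mu>")
  case False
  then have "v ((y - z \<nu>) + (z \<nu> - z \<mu>)) = v (y - z \<nu>)"
    by (intro v_add_less) (use assms delta_eq[of \<nu> \<mu>] in auto)
  then show ?thesis by simp
qed simp

lemma limit_diff:
  assumes "pcs_limit v z y" shows "pcs_limit v z y' \<longleftrightarrow> (\<forall>\<nu>. \<delta> \<nu> < v (y - y'))"
proof
  assume y': "pcs_limit v z y'"
  show "\<forall>\<nu>. \<delta> \<nu> < v (y - y')"
  proof
    fix \<nu>
    have "\<delta> (index_succ \<nu>) \<le> v (y - y')"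
      using v_diff[of "y - z (index_succ \<nu>)" "y' - z (index_succ \<nu>)"] assms y' by (simp add: limit_iff)
    then show "\<delta> \<nu> < v (y - y')" using delta_less[OF index_succ[of \<nu>]] by simp
  qed
next
  assume *: "\<forall>\<nu>. \<delta> \<nu> < v (y - y')"
  show "pcs_limit v z y'"
    unfolding limit_iff
  proof
    fix \<nu>
    have "v ((y - z \<nu>) - (y - y')) = v (y - z \<nu>)"
      by (rule v_diff_less) (use * assms in \<open>auto simp: limit_iff\<close>)
    then show "v (y' - z \<nu>) = \<delta> \<nu>" using assms by (simp add: limit_iff)
  qed
qed

end

section \<open>Rational functions\<close>

lemma ratC_simps [simp]:
  "ratC (a + b) = ratC a + ratC b" "ratC (a - b) = ratC a - ratC b" "ratC (- a) = - ratC a"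
  "ratC (a * b) = ratC a * ratC b" "ratC (1::'a::field) = 1" "ratC (0::'a) = 0"
proof -
  show "ratC (a + b) = ratC a + ratC b" by (subst to_fract_add[symmetric]) simp
  show "ratC (a - b) = ratC a - ratC b" by (subst to_fract_diff[symmetric]) simp
  show "ratC (- a) = - ratC a" by (subst to_fract_uminus[symmetric]) simp
  show "ratC (a * b) = ratC a * ratC b" by (subst to_fract_mult[symmetric]) simp
  show "ratC (1::'a) = 1" by (simp add: one_pCons[symmetric])
  show "ratC (0::'a) = 0" by simp
qed

lemma field_emb_ratC: "field_emb (ratC :: 'a::field \<Rightarrow> _)"
  by unfold_locales (simp_all del: to_fract_add to_fract_mult)

lemma to_fract_linear: "to_fract [:- a, 1:] = ratX - ratC (a :: 'a::field)"
  by (subst to_fract_diff[symmetric]) simp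

lemma ratX_neq_ratC: "ratX \<noteq> ratC (a :: 'a::field)"
  by simp

lemma to_fract_power: "to_fract (p ^ n) = to_fract p ^ n"
  by (induction n) auto

lemma to_fract_prod_mset: "to_fract (prod_mset A) = (\<Prod>x\<in>#A. to_fract x)"
  by (induction A) auto

lemma to_fract_splits:
  fixes p :: "'a::alg_closed_field poly"
  assumes "p \<noteq> 0"
  shows "to_fract p = ratC (lcf p) * (\<Prod>r\<in>#proots p. ratX - ratC r)"
proof -
  have "to_fract p = to_fract ([:lcf p:] * (\<Prod>x\<in>#proots p. [:-x, 1:]))"
    using poly_splits(1)[OF assms] by simp
  also have "\<dots> = ratC (lcf p) * (\<Prod>r\<in>#proots p. ratX - ratC r)"
    by (simp only: to_fract_mult to_fract_prod_mset image_mset.compositionality o_def to_fract_linear)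
  finally show ?thesis .
qed

lemma subfield_set_ratfuns:
  assumes "subfield_set K" shows "subfield_set (ratfuns K)"
proof -
  interpret subfield_set K by fact
  have I: "Fract f g \<in> ratfuns K" if "f \<in> polys K" "g \<in> polys K" "g \<noteq> 0" for f g
    using that by (auto simp: ratfuns_def)
  show ?thesis
  proof
    show "0 \<in> ratfuns K" "1 \<in> ratfuns K"
      using I[of 0 1] I[of 1 1] by (auto simp: Zero_fract_def One_fract_def)
    fix x y assume "x \<in> ratfuns K" "y \<in> ratfuns K"
    then obtain f g h k where *: "x = Fract f g" "f \<in> polys K" "g \<in> polys K" "g \<noteq> 0"
      "y = Fract h k" "h \<in> polys K" "k \<in> polys K" "k \<noteq> 0" by (auto simp: ratfuns_def)
    show "x + y \<in> ratfuns K" "x * y \<in> ratfuns K" "- x \<in> ratfuns K"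
      using * by (auto intro!: I)
    show "inverse x \<in> ratfuns K"
      using * I[of g f] \<open>0 \<in> ratfuns K\<close>
      by (cases "f = 0") (auto simp: Zero_fract_def[symmetric] fract_collapse)
  qed
qed

lemma to_fract_mem_ratfuns: "subfield_set K \<Longrightarrow> f \<in> polys K \<Longrightarrow> to_fract f \<in> ratfuns K"
proof -
  assume *: "subfield_set K" "f \<in> polys K"
  then have "1 \<in> polys K" "to_fract f = Fract f 1"
    by (simp_all add: subfield_set.polys_1 Fract_conv_to_fract)
  then show ?thesis
    using * unfolding ratfuns_def by (intro CollectI exI[of _ f] exI[of _ 1]) simp
qed

lemma ratC_mem_ratfuns: "subfield_set K \<Longrightarrow> c \<in> K \<Longrightarrow> ratC c \<in> ratfuns K"
  by (rule to_fract_mem_ratfuns) (auto simp: subfield_set.polys_const)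

lemma ratX_mem_ratfuns: "subfield_set K \<Longrightarrow> ratX \<in> ratfuns K"
  by (rule to_fract_mem_ratfuns)
     (auto simp: subfield_set.polys_pCons subfield_set.zero_mem subfield_set.one_mem subfield_set.polys_0)

lemma ratfunsE:
  assumes "\<phi> \<in> ratfuns K"
  obtains f g where "f \<in> polys K" "g \<in> polys K" "g \<noteq> 0" "\<phi> = to_fract f / to_fract g"
  using assms by (auto simp: ratfuns_def Fract_conv_to_fract)

section \<open>Monomial valuations\<close>

lemma fract_valuation:
  fixes P :: "'r::idom \<Rightarrow> 'g::linordered_ab_group_add extended"
  assumes P0: "P 0 = \<infinity>" and PFin: "\<And>x. x \<noteq> 0 \<Longrightarrow> P x \<in> range Fin"
    and Pmult: "\<And>x y. P (x * y) = P x + P y" and Padd: "\<And>x y. min (P x) (P y) \<le> P (x + y)"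
  shows "\<exists>u. valuation_on UNIV u \<and> (\<forall>x y. y \<noteq> 0 \<longrightarrow> u (Fract x y) = P x - P y)"
proof -
  define u where "u = (\<lambda>\<phi>. SOME \<gamma>. \<exists>x y. y \<noteq> 0 \<and> \<phi> = Fract x y \<and> \<gamma> = P x - P y)"
  have wd: "P a - P b = P c - P d" if nz: "b \<noteq> 0" "d \<noteq> 0" "Fract a b = Fract c d" for a b c d
  proof -
    obtain \<beta> \<gamma> where *: "P b = Fin \<beta>" "P d = Fin \<gamma>" using PFin[OF nz(1)] PFin[OF nz(2)] by blast
    have "a * d = c * b" using nz by (simp add: eq_fract)
    then have "P a + P d = P c + P b" by (metis Pmult)
    then show ?thesis using * by (cases "P a"; cases "P c") (auto simp: algebra_simps)
  qed
  have u: "u (Fract a b) = P a - P b" if "b \<noteq> 0" for a b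
    unfolding u_def
  proof (rule someI2_ex)
    show "\<exists>\<gamma> x y. y \<noteq> 0 \<and> Fract a b = Fract x y \<and> \<gamma> = P x - P y" using that by blast
    fix \<gamma> assume "\<exists>x y. y \<noteq> 0 \<and> Fract a b = Fract x y \<and> \<gamma> = P x - P y"
    then obtain x y where "y \<noteq> 0" "Fract a b = Fract x y" "\<gamma> = P x - P y" by blast
    then show "\<gamma> = P a - P b" using wd[OF _ \<open>b \<noteq> 0\<close>, of y x a] by simp
  qed
  have one: "P 1 = 0"
  proof -
    obtain g where g: "P 1 = Fin g" using PFin[of 1] by auto
    then have "g + g = g" using Pmult[of 1 1] by simp
    then show ?thesis using g by (simp add: zero_extended_def)
  qed
  have "valuation_on UNIV u"
    unfolding valuation_on_def
  proof (intro conjI ballI impI)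
    show "u 0 = \<infinity>" using u[of 1 0] P0 one by (simp add: Zero_fract_def zero_extended_def)
    fix x :: "'r fract"
    show "u x \<in> range Fin" if "x \<noteq> 0"
    proof (cases x)
      case (Fract a b)
      then have "a \<noteq> 0" using that by (auto simp: Zero_fract_def eq_fract)
      then obtain \<alpha> \<beta> where "P a = Fin \<alpha>" "P b = Fin \<beta>" using PFin Fract by blast
      then show ?thesis using u Fract by simp
    qed
    fix y :: "'r fract"
    obtain a b where ab: "x = Fract a b" "b \<noteq> 0" by (cases x)
    obtain c d where cd: "y = Fract c d" "d \<noteq> 0" by (cases y)
    obtain \<beta> \<gamma> where *: "P b = Fin \<beta>" "P d = Fin \<gamma>" using PFin ab cd by blast
    have xy: "u (x * y) = P (a * c) - P (b * d)" "u (x + y) = P (a * d + c * b) - P (b * d)"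
      using ab cd by (simp_all add: u)
    have ux: "u x = P a - Fin \<beta>" "u y = P c - Fin \<gamma>" using ab cd * u by simp_all
    show "u (x * y) = u x + u y"
      unfolding xy ux Pmult * by (cases "P a"; cases "P c") (auto simp: algebra_simps)
    have "P (a * d + c * b) \<ge> min (P a + Fin \<gamma>) (P c + Fin \<beta>)"
      using Padd[of "a * d" "c * b"] * by (simp add: Pmult)
    then have "Fin (- (\<beta> + \<gamma>)) + min (P a + Fin \<gamma>) (P c + Fin \<beta>) \<le> Fin (- (\<beta> + \<gamma>)) + P (a * d + c * b)"
      by (simp only: Fin_add_le_cancel)
    moreover have "Fin (- (\<beta> + \<gamma>)) + min (P a + Fin \<gamma>) (P c + Fin \<beta>) = min (u x) (u y)"
      unfolding ux by (cases "P a"; cases "P c") (auto simp: algebra_simps min_def)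
    moreover have "Fin (- (\<beta> + \<gamma>)) + P (a * d + c * b) = u (x + y)"
      unfolding xy Pmult * by (cases "P (a * d + c * b)") (auto simp: algebra_simps)
    ultimately show "min (u x) (u y) \<le> u (x + y)" by metis
  qed
  then show ?thesis using u by blast
qed

locale valued_closed = valued_UNIV v
  for v :: "'a::alg_closed_field \<Rightarrow> 'g::divisible_ordered_ab_group extended"
begin

abbreviation "\<Gamma> \<equiv> value_group UNIV v"

lemma mem_value_group: "v x = Fin g \<Longrightarrow> g \<in> \<Gamma>"
  by (auto simp: value_group_def)

lemma value_group_zero [simp]: "0 \<in> \<Gamma>"
  using v_one mem_value_group by (metis zero_extended_def)

lemma value_group_nonzeroE:
  assumes "g \<in> \<Gamma>" obtains x where "v x = Fin g" "x \<noteq> 0"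
proof -
  obtain x where "v x = Fin g" using assms by (auto simp: value_group_def)
  then show thesis using that[of x] by force
qed

lemma value_group_add [simp]: "g \<in> \<Gamma> \<Longrightarrow> h \<in> \<Gamma> \<Longrightarrow> g + h \<in> \<Gamma>"
proof -
  assume "g \<in> \<Gamma>" "h \<in> \<Gamma>"
  then obtain x y where "v x = Fin g" "v y = Fin h" by (auto simp: value_group_def)
  then have "v (x * y) = Fin (g + h)" by (simp add: v_mult)
  then show ?thesis by (rule mem_value_group)
qed

lemma value_group_uminus [simp]: "g \<in> \<Gamma> \<Longrightarrow> - g \<in> \<Gamma>"
  using v_inverse[OF UNIV_I] mem_value_group by (auto simp: value_group_def)

lemma value_group_diff [simp]: "g \<in> \<Gamma> \<Longrightarrow> h \<in> \<Gamma> \<Longrightarrow> g - h \<in> \<Gamma>"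
  using value_group_add[of g "- h"] by simp

lemma value_group_nmul [simp]: "g \<in> \<Gamma> \<Longrightarrow> nmul n g \<in> \<Gamma>"
  by (induction n) auto

lemma value_group_sum_mset: "(\<And>x. x \<in># A \<Longrightarrow> f x \<in> \<Gamma>) \<Longrightarrow> (\<Sum>x\<in>#A. f x) \<in> \<Gamma>"
  by (induction A) auto

text \<open>Roots \<open>y ^ n = x\<close> exist in the algebraically closed field, and division by
  \<open>n\<close> is unique in an ordered group.\<close>

lemma value_group_pure: "n > 0 \<Longrightarrow> nmul n g \<in> \<Gamma> \<Longrightarrow> g \<in> \<Gamma>"
proof -
  assume n: "n > 0" and "nmul n g \<in> \<Gamma>"
  then obtain x where x: "v x = Fin (nmul n g)" "x \<noteq> 0" by (elim value_group_nonzeroE)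
  obtain y where y: "y ^ n = x" using nth_root_exists[OF n] by blast
  then have "y \<noteq> 0" using x n by auto
  then obtain h where h: "v y = Fin h" using v_Fin by blast
  then have "nmul n h = nmul n g" using x y v_power[of y n] by simp
  then show "g \<in> \<Gamma>" using nmul_eq_iff[OF n] h mem_value_group by metis
qed

text \<open>Composition with \<open>X + a\<close> gives the Taylor coefficients at \<open>a\<close>,
  that is, the coefficients with respect to powers of \<open>X - a\<close>.\<close>

definition monval :: "'a \<Rightarrow> 'g \<Rightarrow> 'a poly \<Rightarrow> 'g extended" where
  "monval a \<alpha> p = (MIN i\<in>{..deg p}. v (cf (pcompose p [:a, 1:]) i) + Fin (nmul i \<alpha>))"

context
  fixes a :: 'a and \<alpha> :: 'g
  assumes \<alpha>: "\<alpha> \<notin> \<Gamma>"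
begin

private definition term_val where
  "term_val p i = v (cf (pcompose p [:a, 1:]) i) + Fin (nmul i \<alpha>)"

private lemma deg_shift: "deg (pcompose p [:a, 1:]) = deg p"
  by (simp add: degree_pcompose)

private lemma shift_eq_0: "pcompose p [:a, 1:] = 0 \<longleftrightarrow> p = 0"
  by (rule pcompose_eq_0_iff) simp

private lemma monval_le: "monval a \<alpha> p \<le> term_val p i"
proof (cases "i \<le> deg p")
  case True
  then show ?thesis unfolding monval_def term_val_def by (intro Min_le) auto
next
  case False
  then have "cf (pcompose p [:a, 1:]) i = 0" by (intro coeff_eq_0) (simp add: deg_shift)
  then show ?thesis by (simp add: term_val_def)
qed

private lemma monval_ge: "(\<And>i. c \<le> term_val p i) \<Longrightarrow> c \<le> monval a \<alpha> p"
  unfolding monval_def term_val_def by (subst Min_ge_iff) auto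

text \<open>Equal finite terms with \<open>i < j\<close> would put a positive multiple of
  \<open>\<alpha>\<close> into \<open>\<Gamma>\<close>.\<close>

private lemma term_val_distinct:
  assumes "term_val p i = term_val q j" "term_val p i \<noteq> \<infinity>" shows "i = j"
proof -
  have main: "\<not> i < j" if eq: "term_val p i = term_val q j" and fin: "term_val p i \<noteq> \<infinity>" for i j p q
  proof
    assume "i < j"
    obtain g h where *: "v (cf (pcompose p [:a, 1:]) i) = Fin g" "v (cf (pcompose q [:a, 1:]) j) = Fin h"
      using eq fin v_neq_Minf[OF UNIV_I] unfolding term_val_def
      by (cases "v (cf (pcompose p [:a, 1:]) i)"; cases "v (cf (pcompose q [:a, 1:]) j)") auto
    then have "g + nmul i \<alpha> = h + nmul j \<alpha>" using eq by (simp add: term_val_def)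
    moreover have "nmul j \<alpha> = nmul (j - i) \<alpha> + nmul i \<alpha>"
      using nmul_add_left[of "j - i" i \<alpha>] \<open>i < j\<close> by simp
    ultimately have "nmul (j - i) \<alpha> = g - h" by (simp add: algebra_simps)
    moreover have "g - h \<in> \<Gamma>" using * mem_value_group by simp
    ultimately show False using value_group_pure[of "j - i" \<alpha>] \<alpha> \<open>i < j\<close> by simp
  qed
  show ?thesis using main[of p i q j] main[of q j p i] assms by (cases i j rule: linorder_cases) auto
qed

private lemma monval_attained:
  assumes "p \<noteq> 0"
  obtains i where "monval a \<alpha> p = term_val p i" "monval a \<alpha> p \<in> range Fin"
    "\<And>j. j \<noteq> i \<Longrightarrow> term_val p i < term_val p j"
proof -
  have "monval a \<alpha> p \<in> (term_val p) ` {..deg p}"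
    unfolding monval_def term_val_def by (rule Min_in) auto
  then obtain i where i: "monval a \<alpha> p = term_val p i" by auto
  have "cf (pcompose p [:a, 1:]) (deg p) \<noteq> 0"
    using shift_eq_0 assms deg_shift by (metis leading_coeff_0_iff)
  then obtain g where "v (cf (pcompose p [:a, 1:]) (deg p)) = Fin g" using v_Fin by blast
  then have "monval a \<alpha> p < \<infinity>"
    using monval_le[of p "deg p"] by (cases "monval a \<alpha> p") (auto simp: term_val_def)
  moreover have "term_val p i \<noteq> -\<infinity>"
    unfolding term_val_def using v_neq_Minf[OF UNIV_I, of "cf (pcompose p [:a, 1:]) i"]
    by (cases "v (cf (pcompose p [:a, 1:]) i)") auto
  ultimately have fin: "monval a \<alpha> p \<in> range Fin" 
    by (cases "monval a \<alpha> p") (simp_all add: i)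
  have "term_val p i < term_val p j" if "j \<noteq> i" for j
    using monval_le[of p j] term_val_distinct[of p i p j] i fin that by (auto simp: less_le)
  then show thesis using that i fin by blast
qed

lemma monval_zero: "monval a \<alpha> 0 = \<infinity>"
  by (simp add: monval_def)

lemma monval_Fin: "p \<noteq> 0 \<Longrightarrow> monval a \<alpha> p \<in> range Fin"
  using monval_attained[of p] by metis

lemma monval_add: "min (monval a \<alpha> p) (monval a \<alpha> q) \<le> monval a \<alpha> (p + q)"
proof (rule monval_ge)
  fix i
  have "min (v (cf (pcompose p [:a, 1:]) i)) (v (cf (pcompose q [:a, 1:]) i))
      \<le> v (cf (pcompose (p + q) [:a, 1:]) i)"
    by (simp add: pcompose_add v_add)
  then have "min (term_val p i) (term_val q i) \<le> term_val (p + q) i"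
    unfolding term_val_def by (auto simp: min_le_iff_disj intro: add_right_mono)
  then show "min (monval a \<alpha> p) (monval a \<alpha> q) \<le> term_val (p + q) i"
    using monval_le[of p i] monval_le[of q i] by (meson min.mono order_trans)
qed

text \<open>Gauss's Lemma with unique minima: if the factors attain theirs at \<open>i\<close> and
  \<open>j\<close>, the coefficient of degree \<open>i + j\<close> in the product has a single
  dominant summand.\<close>

lemma monval_mult: "monval a \<alpha> (p * q) = monval a \<alpha> p + monval a \<alpha> q"
proof (cases "p = 0 \<or> q = 0")
  case True
  then show ?thesis using monval_Fin[of p] monval_Fin[of q]
    by (cases "p = 0"; cases "q = 0") (auto simp: monval_zero)
next
  case False
  let ?p = "pcompose p [:a, 1:]" and ?q = "pcompose q [:a, 1:]"
  obtain i where i: "monval a \<alpha> p = term_val p i" "monval a \<alpha> p \<in> range Fin"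
    "\<And>j. j \<noteq> i \<Longrightarrow> term_val p i < term_val p j" using monval_attained[of p] False by metis
  obtain j where j: "monval a \<alpha> q = term_val q j" "monval a \<alpha> q \<in> range Fin"
    "\<And>i. i \<noteq> j \<Longrightarrow> term_val q j < term_val q i" using monval_attained[of q] False by metis
  obtain g h where gh: "term_val p i = Fin g" "term_val q j = Fin h" using i j by auto
  have summand: "v (cf ?p k * cf ?q (n - k)) + Fin (nmul n \<alpha>) = term_val p k + term_val q (n - k)"
    if "k \<le> n" for k n
  proof -
    have "Fin (nmul n \<alpha>) = Fin (nmul k \<alpha>) + Fin (nmul (n - k) \<alpha>)"
      using that nmul_add_left[of k "n - k" \<alpha>] by simp
    then show ?thesis by (simp only: term_val_def v_mult[OF UNIV_I UNIV_I] ac_simps)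
  qed
  have ge: "Fin (g + h) \<le> term_val p k + term_val q l" for k l
    using extended_add_mono[of "Fin g" "term_val p k" "Fin h" "term_val q l"]
      monval_le[of p k] monval_le[of q l] i j gh by simp
  have gt: "Fin (g + h) < term_val p k + term_val q l" if "k \<noteq> i \<or> l \<noteq> j" for k l
  proof -
    have "Fin g \<le> term_val p k" "Fin h \<le> term_val q l"
      using monval_le[of p k] monval_le[of q l] i j gh by simp_all
    moreover have "Fin g < term_val p k \<or> Fin h < term_val q l" using that i(3) j(3) gh by metis
    ultimately show ?thesis
      by (cases "term_val p k"; cases "term_val q l") (auto intro: add_less_le_mono add_le_less_mono)
  qed
  have shift: "x + Fin c \<le> y + Fin c \<longleftrightarrow> x \<le> y" "x + Fin c < y + Fin c \<longleftrightarrow> x < y"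
    for x y :: "'g extended" and c
    using Fin_add_le_cancel[of c x y] Fin_add_less_cancel[of c x y] by (simp_all add: add.commute)
  show ?thesis
  proof (rule antisym)
    have "v (cf (?p * ?q) (i + j)) = v (cf ?p i * cf ?q (i + j - i))"
      unfolding coeff_mult
    proof (rule v_sum_unique_min)
      have e: "v (cf ?p i * cf ?q (i + j - i)) + Fin (nmul (i + j) \<alpha>) = Fin (g + h)"
        using summand[of i "i + j"] gh by simp
      then show "v (cf ?p i * cf ?q (i + j - i)) \<noteq> \<infinity>" by auto
      fix k assume k: "k \<in> {..i + j}" "k \<noteq> i"
      then have "Fin (g + h) < v (cf ?p k * cf ?q (i + j - k)) + Fin (nmul (i + j) \<alpha>)"
        using summand[of k "i + j"] gt[of k "i + j - k"] by simp
      then show "v (cf ?p i * cf ?q (i + j - i)) < v (cf ?p k * cf ?q (i + j - k))"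
        unfolding e[symmetric] shift .
    qed auto
    then have "term_val (p * q) (i + j) = Fin (g + h)"
      using summand[of i "i + j"] gh by (simp add: term_val_def pcompose_mult)
    then show "monval a \<alpha> (p * q) \<le> monval a \<alpha> p + monval a \<alpha> q"
      using monval_le[of "p * q" "i + j"] i(1) j(1) gh by simp
    show "monval a \<alpha> p + monval a \<alpha> q \<le> monval a \<alpha> (p * q)"
    proof (rule monval_ge)
      fix n
      have "Fin (g + h + - nmul n \<alpha>) \<le> v (cf (?p * ?q) n)"
        unfolding coeff_mult
      proof (rule v_sum_ge)
        fix k assume "k \<in> {..n}"
        then have "Fin (g + h + - nmul n \<alpha>) + Fin (nmul n \<alpha>)
            \<le> v (cf ?p k * cf ?q (n - k)) + Fin (nmul n \<alpha>)"
          using summand[of k n] ge[of k "n - k"] by simp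
        then show "cf ?p k * cf ?q (n - k) \<in> UNIV \<and> Fin (g + h + - nmul n \<alpha>) \<le> v (cf ?p k * cf ?q (n - k))"
          unfolding shift by simp
      qed
      then have "Fin (g + h + - nmul n \<alpha>) + Fin (nmul n \<alpha>) \<le> v (cf (?p * ?q) n) + Fin (nmul n \<alpha>)"
        unfolding shift .
      then show "monval a \<alpha> p + monval a \<alpha> q \<le> term_val (p * q) n"
        using i(1) j(1) gh by (simp add: term_val_def pcompose_mult)
    qed
  qed
qed

lemma monval_const: "monval a \<alpha> [:c:] = v c"
  by (simp add: monval_def zero_extended_def[symmetric])

lemma monval_le_eval: "monval a \<alpha> p \<le> v (poly p a)"
proof -
  have "cf (pcompose p [:a, 1:]) 0 = poly p a"
    by (simp add: poly_0_coeff_0[symmetric] poly_pcompose)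
  then show ?thesis using monval_le[of p 0] by (simp add: term_val_def zero_extended_def[symmetric])
qed

lemma monval_linear: "monval a \<alpha> [:- r, 1:] = min (Fin \<alpha>) (v (a - r))"
proof -
  have "{..deg [:- r, 1:]} = {0, 1}" by auto
  then show ?thesis
    by (simp add: monval_def pcompose_pCons zero_extended_def[symmetric] min.commute)
qed

lemma monval_prod_mset: "monval a \<alpha> (\<Prod>r\<in>#A. f r) = (\<Sum>r\<in>#A. monval a \<alpha> (f r))"
proof (induction A)
  case empty
  then show ?case using monval_const[of 1] by (simp add: one_pCons[symmetric])
qed (simp add: monval_mult)

lemma monval_extension:
  obtains u where "valuation_on UNIV u" "\<And>p. u (to_fract p) = monval a \<alpha> p" "\<And>c. u (ratC c) = v c"
proof -
  obtain u where u: "valuation_on UNIV u"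
    "\<And>x y. y \<noteq> 0 \<Longrightarrow> u (Fract x y) = monval a \<alpha> x - monval a \<alpha> y"
    using fract_valuation[OF monval_zero monval_Fin monval_mult monval_add] by blast
  have *: "u (to_fract p) = monval a \<alpha> p" for p
  proof -
    have "u (to_fract p) = monval a \<alpha> p - monval a \<alpha> [:1:]"
      using u(2)[of 1 p] by (simp add: Fract_conv_to_fract one_pCons)
    then show ?thesis unfolding monval_const by (cases "monval a \<alpha> p") (auto simp: zero_extended_def)
  qed
  then show thesis using that u(1) monval_const by metis
qed

end

end

text \<open>The left side is an increasing piecewise linear function of \<open>\<alpha>\<close>. The
  solution \<open>a\<close> treats \<open>min \<alpha> d\<close> as the constant \<open>d\<close>,
  the solution \<open>b\<close> as \<open>\<alpha>\<close>; \<open>a < d < b\<close> is impossible,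
  so one of them is valid.\<close>

lemma solve_sum_min:
  fixes D :: "'g::divisible_ordered_ab_group multiset"
  assumes "k > 0"
  shows "\<exists>\<alpha>. nmul k \<alpha> + (\<Sum>d\<in>#D. min \<alpha> d) = \<gamma>"
  using assms
proof (induction D arbitrary: k \<gamma>)
  case empty
  then show ?case by (auto elim: nmul_divisible[of k \<gamma>])
next
  case (add d D)
  obtain a where a: "nmul k a + (\<Sum>d\<in>#D. min a d) = \<gamma> - d" using add.IH[OF add.prems] by blast
  obtain b where b: "nmul (Suc k) b + (\<Sum>d\<in>#D. min b d) = \<gamma>" using add.IH[of "Suc k"] by blast
  show ?case
  proof (cases "d \<le> a \<or> b \<le> d")
    case True
    then show ?thesis
    proof
      assume "d \<le> a"
      then show ?thesis using a by (intro exI[of _ a]) (auto simp: min_def algebra_simps)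
    next
      assume "b \<le> d"
      then show ?thesis using b by (intro exI[of _ b]) (auto simp: min_def algebra_simps)
    qed
  next
    case False
    then have "nmul k a + (\<Sum>d\<in>#D. min a d) \<le> nmul k b + (\<Sum>d\<in>#D. min b d)"
      by (intro add_mono nmul_mono sum_mset_mono min.mono) auto
    moreover have "nmul k b + (\<Sum>d\<in>#D. min b d) = \<gamma> - b" using b by (simp add: algebra_simps)
    ultimately have "\<gamma> - d \<le> \<gamma> - b" using a by simp
    then show ?thesis using False by simp
  qed
qed

section \<open>Value transcendental extensions\<close>

locale value_transcendental_setup = valued_closed vb
  for vb :: "'a::alg_closed_field \<Rightarrow> 'g::divisible_ordered_ab_group extended" +
  fixes K :: "'a set" and v :: "'a \<Rightarrow> 'g extended" and w :: "'a poly fract \<Rightarrow> 'g extended"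
  assumes K: "subfield_set K" and alg: "\<And>x. algebraic_over K x"
    and v: "valuation_on K v" and vb_eq: "\<And>c. c \<in> K \<Longrightarrow> vb c = v c"
    and w: "valuation_on (ratfuns K) w" and w_eq: "\<And>c. c \<in> K \<Longrightarrow> w (ratC c) = v c"
    and vt: "value_transcendental K v w"
begin

sublocale K: subfield_set K by (rule K)

sublocale w: valued_field "ratfuns K" w
  using w subfield_set_ratfuns[OF K] by (simp add: valued_field_def valued_field_axioms_def)

abbreviation "W p \<equiv> w (to_fract p)"

lemma polyK [simp]: "p \<in> polys K \<Longrightarrow> to_fract p \<in> ratfuns K"
  by (rule to_fract_mem_ratfuns[OF K])

lemma W_mult: "p \<in> polys K \<Longrightarrow> q \<in> polys K \<Longrightarrow> W (p * q) = W p + W q"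
  by (simp add: w.v_mult)

lemma W_add: "p \<in> polys K \<Longrightarrow> q \<in> polys K \<Longrightarrow> min (W p) (W q) \<le> W (p + q)"
  using w.v_add[of "to_fract p" "to_fract q"] by simp

lemma W_add_neq: "p \<in> polys K \<Longrightarrow> q \<in> polys K \<Longrightarrow> W p \<noteq> W q \<Longrightarrow> W (p + q) = min (W p) (W q)"
  using w.v_add_neq[of "to_fract p" "to_fract q"] by simp

lemma W_Fin: assumes "p \<in> polys K" "p \<noteq> 0" obtains g where "W p = Fin g"
  using w.v_Fin[of "to_fract p"] assms by auto

lemma W_const: "c \<in> K \<Longrightarrow> W [:c:] = vb c"
  by (simp add: w_eq vb_eq)

lemma value_group_torsion:
  assumes "g \<in> \<Gamma>" shows "\<exists>n>0. nmul n g \<in> value_group K v"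
proof -
  obtain x where x: "vb x = Fin g" "x \<noteq> 0" using value_group_nonzeroE[OF assms] .
  obtain n c where "n > 0" "c \<in> K" "c \<noteq> 0" "nmul n (vb x) = vb c"
    using algebraic_value[OF K _ _ x(2) alg] by auto
  then show ?thesis using x vb_eq[of c] by (intro exI[of _ n]) (auto simp: value_group_def)
qed

text \<open>Rational rank one provides a value no positive multiple of which lies in
  \<open>value_group K v\<close>, whereas \<open>\<Gamma>\<close> is torsion modulo that
  group.\<close>

lemma exists_transcendental_value: "\<exists>\<phi>\<in>ratfuns K. \<exists>g. w \<phi> = Fin g \<and> g \<notin> \<Gamma>"
proof -
  have closed: "0 \<in> value_group F u \<and> (\<forall>x y. x \<in> value_group F u \<longrightarrow> y \<in> value_group F u \<longrightarrow> x + y \<in> value_group F u)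
      \<and> (\<forall>x. x \<in> value_group F u \<longrightarrow> - x \<in> value_group F u)"
    if "valued_field F u" for F :: "'b::field set" and u :: "'b \<Rightarrow> 'g extended"
  proof -
    interpret u: valued_field F u by fact
    show ?thesis
    proof (intro conjI allI impI)
      show "0 \<in> value_group F u" using u.v_one u.one_mem unfolding value_group_def zero_extended_def by blast
      fix x assume "x \<in> value_group F u"
      then obtain a where a: "a \<in> F" "u a = Fin x" by (auto simp: value_group_def)
      then show "- x \<in> value_group F u"
        using u.v_inverse[OF a] u.inverse_mem[OF a(1)] unfolding value_group_def by blast
      fix y assume "y \<in> value_group F u"
      then obtain b where b: "b \<in> F" "u b = Fin y" by (auto simp: value_group_def)
      have "u (a * b) = Fin (x + y)" using a b by (simp add: u.v_mult)
      then show "x + y \<in> value_group F u" using u.mult_mem[OF a(1) b(1)] unfolding value_group_def by blast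
    qed
  qed
  have v': "valued_field K v" using v K by (simp add: valued_field_def valued_field_axioms_def)
  have sub: "value_group K v \<subseteq> value_group (ratfuns K) w"
  proof
    fix g assume "g \<in> value_group K v"
    then obtain c where "c \<in> K" "v c = Fin g" by (auto simp: value_group_def)
    then have "ratC c \<in> ratfuns K" "w (ratC c) = Fin g" using w_eq by auto
    then show "g \<in> value_group (ratfuns K) w" unfolding value_group_def by blast
  qed
  note cl = closed[OF w.valued_field_axioms] closed[OF v']
  have "\<exists>g\<in>value_group (ratfuns K) w. \<forall>n>0. nmul n g \<notin> value_group K v"
    by (rule quotient_not_torsion) (use cl sub vt in \<open>simp_all add: value_transcendental_def\<close>)
  then obtain g where g: "g \<in> value_group (ratfuns K) w" "\<forall>n>0. nmul n g \<notin> value_group K v" by blast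
  then have "g \<notin> \<Gamma>" using value_group_torsion by blast
  then show ?thesis using g(1) unfolding value_group_def by blast
qed

lemma exists_transcendental_poly: "\<exists>f\<in>polys K. f \<noteq> 0 \<and> (\<exists>g. W f = Fin g \<and> g \<notin> \<Gamma>)"
proof -
  obtain \<phi> g where \<phi>: "\<phi> \<in> ratfuns K" "w \<phi> = Fin g" "g \<notin> \<Gamma>" using exists_transcendental_value by blast
  obtain p q where pq: "p \<in> polys K" "q \<in> polys K" "q \<noteq> 0" "\<phi> = to_fract p / to_fract q"
    using ratfunsE[OF \<phi>(1)] .
  have "p \<noteq> 0" using \<phi>(2) pq(4) by auto
  obtain a where a: "W p = Fin a" using W_Fin[OF pq(1) \<open>p \<noteq> 0\<close>] .
  obtain b where b: "W q = Fin b" using W_Fin[OF pq(2,3)] .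
  have "g = a - b" using w.v_divide[of "to_fract p" "to_fract q" b] a b \<phi>(2) pq by simp
  then have "a \<notin> \<Gamma> \<or> b \<notin> \<Gamma>" using \<phi>(3) by auto
  then show ?thesis using a b pq \<open>p \<noteq> 0\<close> by blast
qed

text \<open>Start with a polynomial of least degree and value outside \<open>\<Gamma>\<close>. It is
  not constant; dividing off the minimal polynomial of a root leaves a cofactor of smaller degree,
  whose value is in \<open>\<Gamma>\<close>, so the minimal polynomial inherits the
  property.\<close>

lemma exists_key_polynomial:
  obtains a1 \<gamma> where "W (minpoly K a1) = Fin \<gamma>" "\<gamma> \<notin> \<Gamma>"
    "\<And>p g. p \<in> polys K \<Longrightarrow> p \<noteq> 0 \<Longrightarrow> deg p < deg (minpoly K a1) \<Longrightarrow> W p = Fin g \<Longrightarrow> g \<in> \<Gamma>"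
proof -
  define S where "S = (\<lambda>f. f \<in> polys K \<and> f \<noteq> 0 \<and> (\<exists>g. W f = Fin g \<and> g \<notin> \<Gamma>))"
  define P where "P = (\<lambda>n. \<exists>f. S f \<and> deg f = n)"
  have "\<exists>n. P n" using exists_transcendental_poly by (auto simp: P_def S_def)
  then have "P (LEAST n. P n)" by (rule LeastI_ex)
  then obtain f where f: "S f" "deg f = (LEAST n. P n)" by (auto simp: P_def)
  have small: "g \<in> \<Gamma>" if "p \<in> polys K" "p \<noteq> 0" "deg p < deg f" "W p = Fin g" for p g
  proof (rule ccontr)
    assume "g \<notin> \<Gamma>"
    then have "P (deg p)" using that unfolding P_def S_def by blast
    then show False using not_less_Least[of "deg p" P] that f(2) by simp
  qed
  from f(1) obtain \<gamma>0 where f': "f \<in> polys K" "f \<noteq> 0" "W f = Fin \<gamma>0" "\<gamma>0 \<notin> \<Gamma>" by (auto simp: S_def)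
  have "deg f > 0"
  proof (rule ccontr)
    assume "\<not> deg f > 0"
    then obtain c where c: "f = [:c:]" by (auto elim: degree_eq_zeroE)
    then have "c \<in> K" using f'(1) by simp
    then show False using f'(3,4) W_const c mem_value_group by metis
  qed
  then obtain a1 where a1: "poly f a1 = 0" using alg_closed_imp_poly_has_root by blast
  define m where "m = minpoly K a1"
  note m = K.minpoly(1-3)[OF alg, of a1, folded m_def]
  have m0: "m \<noteq> 0" unfolding m_def by (rule K.minpoly_nonzero[OF alg])
  obtain k where k: "k \<in> polys K" "f = m * k"
    using K.polys_dvd_factor[OF m(1) m0 f'(1)] K.minpoly_dvd[OF alg f'(1) a1] m_def by blast
  have k0: "k \<noteq> 0" using k f' by auto
  have df: "deg f = deg m + deg k" unfolding k(2) using m0 k0 by (rule degree_mult_eq)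
  obtain \<kappa> where \<kappa>: "W k = Fin \<kappa>" using W_Fin[OF k(1) k0] .
  obtain \<gamma> where \<gamma>: "W m = Fin \<gamma>" using W_Fin[OF m(1) m0] .
  have dm: "deg m > 0" unfolding m_def by (rule K.minpoly_deg_pos[OF alg])
  then have "\<kappa> \<in> \<Gamma>" using small[OF k(1) k0 _ \<kappa>] df by simp
  moreover have "\<gamma>0 = \<gamma> + \<kappa>" using W_mult[OF m(1) k(1)] k(2) \<gamma> \<kappa> f'(3) by simp
  ultimately have "\<gamma> \<notin> \<Gamma>" using f'(4) by auto
  then show thesis using that[of a1 \<gamma>] \<gamma> small df by (auto simp: m_def)
qed

text \<open>The values of \<open>w\<close> on polynomials of degree below that of the key polynomial define a valuation of its
  residue field, which extends \<open>v\<close>; by conjugacy it is induced by \<open>vb\<close> at some root \<open>a\<close>.\<close>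

lemma exists_key_root:
  obtains a \<gamma> where "W (minpoly K a) = Fin \<gamma>" "\<gamma> \<notin> \<Gamma>"
    "\<And>p. p \<in> polys K \<Longrightarrow> deg p < deg (minpoly K a) \<Longrightarrow> W p = vb (poly p a)"
proof -
  obtain a1 \<gamma> where \<gamma>: "W (minpoly K a1) = Fin \<gamma>" "\<gamma> \<notin> \<Gamma>"
    and small: "\<And>p g. p \<in> polys K \<Longrightarrow> p \<noteq> 0 \<Longrightarrow> deg p < deg (minpoly K a1) \<Longrightarrow> W p = Fin g \<Longrightarrow> g \<in> \<Gamma>"
    using exists_key_polynomial by metis
  define f where "f = minpoly K a1"
  note f = K.minpoly(1-3)[OF alg, of a1, folded f_def]
  have f0: "f \<noteq> 0" unfolding f_def by (rule K.minpoly_nonzero[OF alg])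
  have df: "deg f > 0" unfolding f_def by (rule K.minpoly_deg_pos[OF alg])
  define L where "L = {poly p a1 |p. p \<in> polys K}"
  \<comment> \<open>Elements of \<open>K(a1)\<close> are represented by their unique polynomials of
    degree below \<open>deg f\<close>.\<close>
  define red where "red = (\<lambda>p x. p \<in> polys K \<and> deg p < deg f \<and> poly p a1 = x)"
  have red_unique: "p = q" if "red p x" "red q x" for p q x
  proof (rule ccontr)
    assume "p \<noteq> q"
    then have "deg f \<le> deg (p - q)" unfolding f_def
      by (intro K.minpoly_min[OF alg]) (use that in \<open>auto simp: red_def\<close>)
    moreover have "deg (p - q) < deg f" using that unfolding red_def by (intro degree_diff_less) auto
    ultimately show False by simp
  qed
  have red_ex: "\<exists>p. red p x" if x: "x \<in> L" for x
  proof -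
    obtain p where p: "p \<in> polys K" "x = poly p a1" using x by (auto simp: L_def)
    obtain q r where qr: "q \<in> polys K" "r \<in> polys K" "p = q * f + r" "r = 0 \<or> deg r < deg f"
      using K.polys_division[OF f(1) f0 p(1)] by blast
    then have "red r x" using p f(3) df by (auto simp: red_def)
    then show ?thesis by blast
  qed
  define rem where "rem = (\<lambda>x. SOME p. red p x)"
  have rem: "red (rem x) x" if "x \<in> L" for x unfolding rem_def using red_ex[OF that] by (rule someI_ex)
  have rem_eq: "rem x = p" if "red p x" for p x
    using red_unique[OF rem that] that by (auto simp: red_def L_def)
  define U where "U = (\<lambda>x. W (rem x))"
  have L: "subfield_set L" unfolding L_def by (rule K.subfield_set_simple_extension[OF alg])
  interpret L: subfield_set L by (rule L)
  have rem0: "rem 0 = 0" by (rule rem_eq) (use df in \<open>auto simp: red_def\<close>)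
  have rem_nz: "rem x \<noteq> 0" if "x \<in> L" "x \<noteq> 0" for x using rem[OF that(1)] that(2) by (auto simp: red_def)
  have "valuation_on L U" unfolding valuation_on_def
  proof (intro conjI ballI impI)
    show "U 0 = \<infinity>" by (simp add: U_def rem0)
    fix x assume x: "x \<in> L"
    note rx = rem[OF x, unfolded red_def]
    show "U x \<in> range Fin" if nz: "x \<noteq> 0"
      using W_Fin[of "rem x"] rx rem_nz[OF x nz] unfolding U_def by blast
    fix y assume y: "y \<in> L"
    note ry = rem[OF y, unfolded red_def]
    have "rem (x + y) = rem x + rem y"
      by (rule rem_eq) (use rx ry in \<open>auto simp: red_def intro!: degree_add_less\<close>)
    then show "min (U x) (U y) \<le> U (x + y)" using W_add rx ry by (simp add: U_def)
    show "U (x * y) = U x + U y"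
    proof (cases "x = 0 \<or> y = 0")
      case True
      then have "U x + U y = \<infinity>"
        using W_Fin[of "rem x"] W_Fin[of "rem y"] rx ry rem_nz[OF x] rem_nz[OF y] rem0
        unfolding U_def by (cases "x = 0"; cases "y = 0") force+
      then show ?thesis using True by (auto simp: U_def rem0)
    next
      case False
      note nz = rem_nz[OF x] rem_nz[OF y]
      have xy: "x * y \<in> L" using x y by simp
      note rxy = rem[OF xy, unfolded red_def]
      obtain \<alpha> where \<alpha>: "W (rem x) = Fin \<alpha>" using W_Fin rx nz(1) False by blast
      obtain \<beta> where \<beta>: "W (rem y) = Fin \<beta>" using W_Fin ry nz(2) False by blast
      have "\<alpha> \<in> \<Gamma>" "\<beta> \<in> \<Gamma>" using small \<alpha> \<beta> rx ry nz False by (auto simp: f_def)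
      obtain q r where qr: "q \<in> polys K" "r \<in> polys K" "rem x * rem y = q * f + r" "r = 0 \<or> deg r < deg f"
        using K.polys_division[OF f(1) f0, of "rem x * rem y"] rx ry by auto
      have "poly (rem x * rem y) a1 = poly r a1" using f(3) by (simp add: qr(3))
      then have "poly r a1 = x * y" using rx ry by simp
      then have r: "rem (x * y) = r" using qr(2,4) df by (intro rem_eq) (auto simp: red_def)
      have prod: "W (q * f + r) = Fin (\<alpha> + \<beta>)" using W_mult[of "rem x" "rem y"] rx ry \<alpha> \<beta> qr(3) by simp
      have r0: "r \<noteq> 0" using rem_nz[OF xy] False r by auto
      obtain \<rho> where \<rho>: "W r = Fin \<rho>" using W_Fin[OF qr(2) r0] .
      have "\<rho> \<in> \<Gamma>" using small[OF qr(2) r0 _ \<rho>] qr(4) r0 by (simp add: f_def)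
      \<comment> \<open>The product has value in \<open>\<Gamma>\<close>. Since
        \<open>deg q < deg f\<close>, the value of a nonzero \<open>q * f\<close> is outside
        \<open>\<Gamma>\<close> and that of \<open>r\<close> inside, so the two differ and the
        minimum must be the value of \<open>r\<close>.\<close>
      have "W r = Fin (\<alpha> + \<beta>)"
      proof (cases "q = 0")
        case True
        then show ?thesis using prod by simp
      next
        case q0: False
        have "deg (q * f) = deg q + deg f" using q0 f0 by (rule degree_mult_eq)
        moreover have "deg (q * f) \<le> deg (rem x * rem y)"
        proof -
          have "q * f = rem x * rem y - r" by (simp add: qr(3))
          moreover have "deg r < deg (q * f)" using qr(4) r0 q0 f0 by (simp add: degree_mult_eq)
          ultimately show ?thesis by (metis degree_add_eq_left diff_add_cancel order_refl)
        qed
        moreover have "deg (rem x * rem y) = deg (rem x) + deg (rem y)"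
          using nz False by (intro degree_mult_eq) auto
        ultimately have "deg q < deg f" using rx ry by linarith
        obtain \<kappa> where \<kappa>: "W q = Fin \<kappa>" using W_Fin[OF qr(1) q0] .
        have "\<kappa> \<in> \<Gamma>" using small[OF qr(1) q0 _ \<kappa>] \<open>deg q < deg f\<close> by (simp add: f_def)
        have qf: "W (q * f) = Fin (\<kappa> + \<gamma>)" using W_mult[OF qr(1) f(1)] \<kappa> \<gamma>(1) by (simp add: f_def)
        have notin: "\<kappa> + \<gamma> \<notin> \<Gamma>"
          using value_group_diff[of "\<kappa> + \<gamma>" \<kappa>] \<open>\<kappa> \<in> \<Gamma>\<close> \<gamma>(2) by auto
        then have "W (q * f) \<noteq> W r" using qf \<rho> \<open>\<rho> \<in> \<Gamma>\<close> by auto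
        then have "Fin (\<alpha> + \<beta>) = min (Fin (\<kappa> + \<gamma>)) (W r)"
          using W_add_neq[of "q * f" r] qr f(1) prod qf by simp
        moreover have "\<alpha> + \<beta> \<noteq> \<kappa> + \<gamma>" using notin \<open>\<alpha> \<in> \<Gamma>\<close> \<open>\<beta> \<in> \<Gamma>\<close> by (metis value_group_add)
        ultimately show ?thesis by (auto simp: min_def split: if_splits)
      qed
      then show ?thesis using r \<alpha> \<beta> by (simp add: U_def)
    qed
  qed
  then have UL: "valued_field L U" using L by (simp add: valued_field_def valued_field_axioms_def)
  have UK: "U c = vb c" if "c \<in> K" for c
  proof -
    have "rem c = [:c:]" by (rule rem_eq) (use that df in \<open>auto simp: red_def\<close>)
    then show ?thesis using W_const[OF that] by (simp add: U_def)
  qed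
  obtain a where a: "\<forall>p\<in>polys K. U (poly p a1) = vb (poly p a)"
    using valuation_conjugate_over[OF K alg valued_UNIV_axioms UL[unfolded L_def] UK] by blast
  have "U (poly f a1) = \<infinity>" using f(3) rem0 by (simp add: U_def)
  then have "vb (poly f a) = \<infinity>" using a f(1) by metis
  then have fa: "poly f a = 0" by simp
  then have m: "minpoly K a = f" unfolding f_def using K.minpoly_conjugate(2)[OF alg] by blast
  have "W p = vb (poly p a)" if "p \<in> polys K" "deg p < deg f" for p
  proof -
    have "rem (poly p a1) = p" by (rule rem_eq) (use that in \<open>auto simp: red_def\<close>)
    then show ?thesis using a that(1) by (auto simp: U_def)
  qed
  then show thesis using that[of a \<gamma>] \<gamma> m by (simp add: f_def)
qed

text \<open>The extension is the monomial valuation at the key root \<open>a\<close>; the value \<open>\<alpha>\<close> of \<open>X - a\<close> is forced by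
  the value of the key polynomial, since the value of \<open>X - r\<close> has to be \<open>min \<alpha> (vb (a - r))\<close>.\<close>

theorem exists_common_extension: "\<exists>wb. common_extension K w vb wb"
proof -
  obtain a \<gamma> where \<gamma>: "W (minpoly K a) = Fin \<gamma>" "\<gamma> \<notin> \<Gamma>"
    and small: "\<And>p. p \<in> polys K \<Longrightarrow> deg p < deg (minpoly K a) \<Longrightarrow> W p = vb (poly p a)"
    using exists_key_root by metis
  define f where "f = minpoly K a"
  note f = K.minpoly(1-3)[OF alg, of a, folded f_def]
  have f0: "f \<noteq> 0" unfolding f_def by (rule K.minpoly_nonzero[OF alg])
  have df: "deg f > 0" unfolding f_def by (rule K.minpoly_deg_pos[OF alg])
  have small: "W p = vb (poly p a)" if "p \<in> polys K" "deg p < deg f" for p using small that by (simp add: f_def)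
  have nonroot: "poly p a \<noteq> 0" if "p \<in> polys K" "p \<noteq> 0" "deg p < deg f" for p
    using K.minpoly_min[OF alg that(1,2), of a] that(3) by (auto simp: f_def)
  define A where "A = proots f"
  define g where "g = (\<lambda>r. case vb (a - r) of Fin x \<Rightarrow> x | _ \<Rightarrow> 0)"
  have vg: "vb (a - r) = Fin (g r)" if "r \<noteq> a" for r
    by (rule v_Fin[of "a - r"]) (use that in \<open>auto simp: g_def\<close>)
  define B where "B = filter_mset (\<lambda>r. r \<noteq> a) A"
  have A: "A = replicate_mset (count A a) a + B"
    by (rule multiset_eqI) (simp add: B_def)
  have "count A a > 0" using f(3) f0 unfolding A_def by (simp add: order_gt_0_iff)
  \<comment> \<open>\<open>\<alpha>\<close> is chosen so that \<open>f\<close> gets the value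
    \<open>\<gamma>\<close>. Each occurrence of the root \<open>a\<close> contributes
    \<open>\<alpha>\<close>; in the inseparable case \<open>a\<close> may be a multiple
    root.\<close>
  then obtain \<alpha> where \<alpha>: "nmul (count A a) \<alpha> + (\<Sum>d\<in>#image_mset g B. min \<alpha> d) = \<gamma>"
    using solve_sum_min[of "count A a" "image_mset g B" \<gamma>] by blast
  have sumB: "(\<Sum>r\<in>#B. min (Fin \<alpha>) (vb (a - r))) = Fin (\<Sum>r\<in>#B. min \<alpha> (g r))"
  proof -
    have "(\<Sum>r\<in>#B'. min (Fin \<alpha>) (vb (a - r))) = Fin (\<Sum>r\<in>#B'. min \<alpha> (g r))" if "a \<notin># B'" for B'
      using that by (induction B') (auto simp: zero_extended_def vg)
    then show ?thesis by (simp add: B_def)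
  qed
  have sum_rep: "(\<Sum>r\<in>#replicate_mset n a. min (Fin \<alpha>) (vb (a - r))) = Fin (nmul n \<alpha>)" for n
    by (induction n) (auto simp: zero_extended_def)
  have sumA: "(\<Sum>r\<in>#A. min (Fin \<alpha>) (vb (a - r))) = Fin \<gamma>"
    by (subst A) (simp only: image_mset_union sum_mset.union sumB sum_rep,
      use \<alpha> in \<open>simp add: image_mset.compositionality o_def\<close>)
  have \<alpha>\<Gamma>: "\<alpha> \<notin> \<Gamma>"
  proof
    assume "\<alpha> \<in> \<Gamma>"
    moreover have "g r \<in> \<Gamma>" for r
      using mem_value_group[of "a - r"] by (auto simp: g_def split: extended.splits)
    ultimately have "(\<Sum>d\<in>#image_mset g B. min \<alpha> d) \<in> \<Gamma>"
      by (intro value_group_sum_mset) (auto simp: min_def)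
    then have "\<gamma> \<in> \<Gamma>" using \<alpha> \<open>\<alpha> \<in> \<Gamma>\<close> value_group_add value_group_nmul by metis
    then show False using \<gamma>(2) by simp
  qed
  let ?V = "monval a \<alpha>"
  have f_prod: "f = (\<Prod>r\<in>#A. [:-r, 1:])" using poly_splits(1)[OF f0] f(2) by (simp add: A_def)
  have Vf: "?V f = Fin \<gamma>"
    by (subst f_prod) (simp add: monval_prod_mset[OF \<alpha>\<Gamma>] monval_linear[OF \<alpha>\<Gamma>] sumA)
  obtain wb where wb: "valuation_on UNIV wb" "\<And>p. wb (to_fract p) = ?V p" "\<And>c. wb (ratC c) = vb c"
    using monval_extension[OF \<alpha>\<Gamma>] by metis
  interpret wb: valued_UNIV wb by (simp add: valued_UNIV_def valued_field_UNIV[OF wb(1)])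
  have V_add_neq: "?V (p + q) = min (?V p) (?V q)" if "?V p \<noteq> ?V q" for p q
    using wb.v_add_neq[of "to_fract p" "to_fract q"] that wb(2)[of "p + q"] by (simp add: wb(2))
  have Wf: "W f = Fin \<gamma>" using \<gamma>(1) by (simp add: f_def)
  \<comment> \<open>Suppose the monomial value of \<open>p\<close> is below \<open>vb (p(a))\<close>
    and divide: \<open>f = q * p + r\<close>. Under \<open>w\<close> both summands have value
    \<open>vb (r(a))\<close>, so \<open>\<gamma>\<close> is at least that; under \<open>?V\<close>
    the first one is strictly smaller, so \<open>f\<close> would have value below
    \<open>\<gamma>\<close>.\<close>
  have Vsmall: "?V p = vb (poly p a)" if "p \<in> polys K" "deg p < deg f" for p
    using that
  proof (induction "deg p" arbitrary: p rule: less_induct)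
    case less
    show ?case
    proof (cases "deg p = 0")
      case True
      then obtain c where "p = [:c:]" by (auto elim: degree_eq_zeroE)
      then show ?thesis using monval_const[OF \<alpha>\<Gamma>] by simp
    next
      case dp: False
      then have p0: "p \<noteq> 0" by auto
      show ?thesis
      proof (rule ccontr)
        assume neq: "?V p \<noteq> vb (poly p a)"
        then have lt: "?V p < vb (poly p a)" using monval_le_eval[OF \<alpha>\<Gamma>, of a p] by simp
        obtain q r where qr: "q \<in> polys K" "r \<in> polys K" "f = q * p + r" "r = 0 \<or> deg r < deg p"
          using K.polys_division[OF less.prems(1) p0 f(1)] by blast
        have q0: "q \<noteq> 0"
        proof
          assume "q = 0"
          then have "f = r" using qr(3) by simp
          then show False using qr(4) less.prems(2) f0 by auto
        qed
        have "deg (q * p) \<le> deg f"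
        proof (cases "r = 0")
          case False
          then have "deg r < deg (q * p)" using qr(4) q0 p0 by (simp add: degree_mult_eq)
          then show ?thesis using qr(3) by (simp add: degree_add_eq_left)
        qed (use qr in simp)
        then have dq: "deg q < deg f" using dp q0 p0 by (simp add: degree_mult_eq)
        have ra: "poly r a = - (poly q a * poly p a)"
          using f(3) qr(3) by (simp add: eq_neg_iff_add_eq_0 add.commute)
        have qa: "poly q a \<noteq> 0" and pa: "poly p a \<noteq> 0"
          using nonroot qr(1) q0 dq less.prems p0 by auto
        then have r0: "r \<noteq> 0" using ra by auto
        then have dr: "deg r < deg p" using qr(4) by simp
        have Wqp: "W (q * p) = vb (poly r a)"
          using W_mult[OF qr(1) less.prems(1)] small[OF qr(1) dq] small[OF less.prems] ra by (simp add: v_mult)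
        have Wr: "W r = vb (poly r a)" using small[OF qr(2)] dr less.prems(2) by simp
        have \<rho>: "vb (poly r a) \<le> Fin \<gamma>"
          using W_add[of "q * p" r] qr less.prems(1) Wqp Wr Wf by simp
        have Vr: "?V r = vb (poly r a)" by (rule less.hyps[OF dr qr(2)]) (use dr less.prems(2) in simp)
        have "?V (q * p) < vb (poly r a)"
        proof -
          obtain x where x: "vb (poly q a) = Fin x" using v_Fin qa by blast
          have "?V (q * p) = ?V q + ?V p" by (rule monval_mult[OF \<alpha>\<Gamma>])
          also have "\<dots> \<le> vb (poly q a) + ?V p" by (rule add_right_mono) (rule monval_le_eval[OF \<alpha>\<Gamma>])
          also have "\<dots> < vb (poly q a) + vb (poly p a)" using lt by (simp add: x)
          also have "\<dots> = vb (poly r a)" by (simp add: ra v_mult)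
          finally show ?thesis .
        qed
        then have "?V f < vb (poly r a)" using V_add_neq[of "q * p" r] qr(3) Vr by simp
        then show False using \<rho> Vf by simp
      qed
    qed
  qed
  have pure: "x + nmul j \<gamma> \<notin> \<Gamma>" if "x \<in> \<Gamma>" "j > 0" for x j
    using value_group_pure[OF that(2), of \<gamma>] value_group_diff[of "x + nmul j \<gamma>" x] that \<gamma>(2) by auto
  \<comment> \<open>Induction along the expansion in powers of \<open>f\<close>. The form
    \<open>x + j \<gamma>\<close> is carried along so that the value of \<open>q * f\<close> never
    meets that of the remainder, which is in \<open>\<Gamma>\<close>.\<close>
  have WV: "W h = ?V h \<and> (h \<noteq> 0 \<longrightarrow> (\<exists>x\<in>\<Gamma>. \<exists>j. W h = Fin (x + nmul j \<gamma>)))" if "h \<in> polys K" for h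
    using that
  proof (induction "deg h" arbitrary: h rule: less_induct)
    case less
    have base: "W h = ?V h \<and> (h \<noteq> 0 \<longrightarrow> (\<exists>x\<in>\<Gamma>. W h = Fin x))" if h: "h \<in> polys K" "deg h < deg f" for h
    proof (intro conjI impI)
      show "W h = ?V h" using small[OF h] Vsmall[OF h] by simp
      assume "h \<noteq> 0"
      then obtain x where "vb (poly h a) = Fin x" using v_Fin nonroot h by blast
      then show "\<exists>x\<in>\<Gamma>. W h = Fin x" using small[OF h] mem_value_group by metis
    qed
    show ?case
    proof (cases "deg h < deg f")
      case True
      then show ?thesis using base[OF less.prems] by (metis add.right_neutral nmul.simps(1))
    next
      case False
      obtain q r where qr: "q \<in> polys K" "r \<in> polys K" "h = q * f + r" "r = 0 \<or> deg r < deg f"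
        using K.polys_division[OF f(1) f0 less.prems] by blast
      have q0: "q \<noteq> 0" using qr False df by auto
      have dqf: "deg (q * f) = deg q + deg f" using q0 f0 by (rule degree_mult_eq)
      have "deg h = deg (q * f)"
      proof (cases "r = 0")
        case False
        then have "deg r < deg (q * f)" using qr(4) dqf by simp
        then show ?thesis using qr(3) by (simp add: degree_add_eq_left)
      qed (use qr in simp)
      then have "deg q < deg h" using dqf df by simp
      from less.hyps[OF this qr(1)] q0 obtain x j where q: "W q = ?V q" "x \<in> \<Gamma>" "W q = Fin (x + nmul j \<gamma>)"
        by blast
      have Wqf: "W (q * f) = Fin (x + nmul (Suc j) \<gamma>)"
        using W_mult[OF qr(1) f(1)] q(3) Wf by (simp add: algebra_simps)
      have Vqf: "?V (q * f) = Fin (x + nmul (Suc j) \<gamma>)"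
        using monval_mult[OF \<alpha>\<Gamma>, of a q f] q(3) Vf unfolding q(1) by (simp add: algebra_simps)
      show ?thesis
      proof (cases "r = 0")
        case True
        then show ?thesis using Wqf Vqf q(2) qr(3) by (auto simp del: nmul.simps)
      next
        case False
        then obtain y where y: "W r = ?V r" "y \<in> \<Gamma>" "W r = Fin y" using base[OF qr(2)] qr(4) by blast
        have ne: "Fin (x + nmul (Suc j) \<gamma>) \<noteq> Fin y" using pure[OF q(2), of "Suc j"] y(2) by auto
        have 1: "W h = min (Fin (x + nmul (Suc j) \<gamma>)) (Fin y)"
          using W_add_neq[of "q * f" r] qr f(1) Wqf y(3) ne by simp
        have 2: "?V h = min (Fin (x + nmul (Suc j) \<gamma>)) (Fin y)"
          using V_add_neq[of "q * f" r] qr(3) Vqf y ne by simp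
        have "y = y + nmul 0 \<gamma>" by simp
        then have "\<exists>x\<in>\<Gamma>. \<exists>j. W h = Fin (x + nmul j \<gamma>)"
          using 1 q(2) y(2) by (metis min_def)
        then show ?thesis using 1 2 by simp
      qed
    qed
  qed
  have "wb \<phi> = w \<phi>" if \<phi>: "\<phi> \<in> ratfuns K" for \<phi>
  proof -
    obtain p q where pq: "p \<in> polys K" "q \<in> polys K" "q \<noteq> 0" "\<phi> = to_fract p / to_fract q"
      using ratfunsE[OF \<phi>] .
    obtain x where x: "W q = Fin x" using W_Fin[OF pq(2,3)] .
    have "w \<phi> = W p + Fin (- x)" using w.v_divide[OF polyK polyK x] pq by simp
    moreover have "wb \<phi> = ?V p + Fin (- x)"
      using wb.v_divide[of "to_fract p" "to_fract q" x] wb(2) WV[OF pq(2)] x pq(4) by simp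
    ultimately show ?thesis using WV[OF pq(1)] by simp
  qed
  then show ?thesis using wb unfolding common_extension_def by blast
qed

end

section \<open>Limits and pairs of definition\<close>

lemma sum_mset_constant: "(\<And>x. x \<in># A \<Longrightarrow> f x = c) \<Longrightarrow> (\<Sum>x\<in>#A. f x) = nmul (size A) c"
  by (induction A) auto

locale pcs_setup = value_transcendental_setup vb K v w
  for vb :: "'a::alg_closed_field \<Rightarrow> 'g::divisible_ordered_ab_group extended" and K v w +
  fixes z :: "'i::{wellorder, no_top} \<Rightarrow> 'a"
  assumes zK: "z \<nu> \<in> K" and pcvb: "pseudo_convergent vb z" and at: "algebraic_type K v z"
    and limX: "\<forall>\<^sub>F \<nu> in at_top. w (ratX - ratC (z \<nu>)) = pcs_delta vb z \<nu>"
begin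

sublocale pcs vb z by unfold_locales (rule pcvb)

abbreviation "is_lim \<equiv> pcs_limit vb z"

lemma degdom_pos_iff: "f \<noteq> 0 \<Longrightarrow> degdom vb z f > 0 \<longleftrightarrow> (\<exists>r. poly f r = 0 \<and> is_lim r)"
  by (auto simp: degdom_def nonempty_has_size[symmetric] filter_mset_eq_mempty_iff)

text \<open>For a non-limit \<open>r\<close>, the eventual value of \<open>r - z \<nu>\<close>. It
  does not involve \<open>wb\<close>, so the constant in \<open>eventually_eval\<close> is the same
  for all common extensions.\<close>

definition outer_value :: "'a \<Rightarrow> 'g extended" where
  "outer_value r = vb (r - z (SOME \<nu>. vb (r - z \<nu>) < \<delta> \<nu>))"

text \<open>Each root that is a limit contributes \<open>\<delta> \<nu>\<close>, each other root
  eventually the constant \<open>outer_value\<close>; all constants lie in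
  \<open>\<Gamma>\<close>.\<close>

lemma eventually_eval:
  assumes "f \<noteq> 0"
  obtains C where "C \<in> \<Gamma>" "\<forall>\<^sub>F \<nu> in at_top. vb (poly f (z \<nu>)) = Fin C + nmul (degdom vb z f) (\<delta> \<nu>)"
    "Fin C = vb (lcf f) + (\<Sum>r\<in>#filter_mset (\<lambda>r. \<not> is_lim r) (proots f). outer_value r)"
proof -
  define s where "s = (\<lambda>r. SOME \<nu>. vb (r - z \<nu>) < \<delta> \<nu>)"
  have s: "vb (r - z (s r)) < \<delta> (s r)" if "\<not> is_lim r" for r
    unfolding s_def by (rule someI_ex) (use nonlimitE[OF that] in blast)
  have const: "\<exists>c\<in>\<Gamma>. (\<Sum>r\<in>#N. vb (r - z (s r))) = Fin c \<and>
      (\<forall>\<^sub>F \<nu> in at_top. (\<Sum>r\<in>#N. vb (z \<nu> - r)) = Fin c)" if "\<forall>r\<in>#N. \<not> is_lim r" for N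
    using that
  proof (induction N)
    case empty
    then show ?case by (intro bexI[of _ 0]) (auto simp: zero_extended_def)
  next
    case (add r N)
    then obtain c where c: "c \<in> \<Gamma>" "(\<Sum>r\<in>#N. vb (r - z (s r))) = Fin c"
      "\<forall>\<^sub>F \<nu> in at_top. (\<Sum>r\<in>#N. vb (z \<nu> - r)) = Fin c" by auto
    have sr: "vb (r - z (s r)) < \<delta> (s r)" using s add.prems by simp
    then have "r - z (s r) \<noteq> 0" by auto
    then obtain g where g: "vb (r - z (s r)) = Fin g" using v_Fin by blast
    have "\<forall>\<^sub>F \<nu> in at_top. vb (z \<nu> - r) = Fin g"
      using eventually_ge_at_top[of "s r"]
      by eventually_elim (use below_delta_constant[OF sr] g v_diff_commute in auto)
    with c(3) have "\<forall>\<^sub>F \<nu> in at_top. (\<Sum>r\<in>#add_mset r N. vb (z \<nu> - r)) = Fin (g + c)"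
      by eventually_elim simp
    then show ?case using c(1,2) g mem_value_group[OF g] by (intro bexI[of _ "g + c"]) auto
  qed
  have lims: "(\<Sum>r\<in>#N. vb (z \<nu> - r)) = nmul (size N) (\<delta> \<nu>)" if "\<forall>r\<in>#N. is_lim r" for N \<nu>
    using that limit_iff v_diff_commute by (intro sum_mset_constant) auto
  define A where "A = proots f"
  obtain c where c: "c \<in> \<Gamma>" "(\<Sum>r\<in>#filter_mset (\<lambda>r. \<not> is_lim r) A. vb (r - z (s r))) = Fin c"
      "\<forall>\<^sub>F \<nu> in at_top. (\<Sum>r\<in>#filter_mset (\<lambda>r. \<not> is_lim r) A. vb (z \<nu> - r)) = Fin c"
    using const[of "filter_mset (\<lambda>r. \<not> is_lim r) A"] by auto
  obtain l where l: "vb (lcf f) = Fin l" using v_Fin[of "lcf f"] assms by auto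
  have "\<forall>\<^sub>F \<nu> in at_top. vb (poly f (z \<nu>)) = Fin (l + c) + nmul (degdom vb z f) (\<delta> \<nu>)"
    using c(3)
  proof eventually_elim
    case (elim \<nu>)
    have "vb (poly f (z \<nu>)) = vb (lcf f) + (\<Sum>r\<in>#A. vb (z \<nu> - r))"
      by (simp add: poly_eq_prod_roots[OF assms] A_def v_mult v_prod_mset)
    also have "(\<Sum>r\<in>#A. vb (z \<nu> - r)) = (\<Sum>r\<in>#filter_mset is_lim A. vb (z \<nu> - r))
        + (\<Sum>r\<in>#filter_mset (\<lambda>r. \<not> is_lim r) A. vb (z \<nu> - r))"
      using arg_cong[OF multiset_partition[of A is_lim], of "\<lambda>A. \<Sum>r\<in>#A. vb (z \<nu> - r)"]
      unfolding image_mset_union sum_mset.union .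
    also have "(\<Sum>r\<in>#filter_mset is_lim A. vb (z \<nu> - r)) = nmul (degdom vb z f) (\<delta> \<nu>)"
      by (subst lims) (auto simp: degdom_def A_def)
    also have "vb (lcf f) + (nmul (degdom vb z f) (\<delta> \<nu>)
          + (\<Sum>r\<in>#filter_mset (\<lambda>r. \<not> is_lim r) A. vb (z \<nu> - r)))
        = Fin l + (nmul (degdom vb z f) (\<delta> \<nu>) + Fin c)" by (simp only: l elim)
    also have "\<dots> = Fin (l + c) + nmul (degdom vb z f) (\<delta> \<nu>)"
      by (cases "nmul (degdom vb z f) (\<delta> \<nu>)") (auto simp: algebra_simps)
    finally show ?case .
  qed
  moreover have "Fin (l + c) = vb (lcf f) + (\<Sum>r\<in>#filter_mset (\<lambda>r. \<not> is_lim r) (proots f). outer_value r)"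
    using c(2) l by (simp add: A_def s_def outer_value_def)
  moreover have "l + c \<in> \<Gamma>" using mem_value_group[OF l] c(1) by simp
  ultimately show thesis using that by blast
qed

lemma eventually_eval':
  assumes "f \<noteq> 0"
  shows "\<exists>C. \<forall>\<^sub>F \<nu> in at_top. vb (poly f (z \<nu>)) = Fin C + nmul (degdom vb z f) (\<delta> \<nu>)"
  by (rule eventually_eval[OF assms]) blast

lemma eventually_nonroot: "f \<noteq> 0 \<Longrightarrow> \<forall>\<^sub>F \<nu> in at_top. poly f (z \<nu>) \<noteq> 0"
proof -
  assume f: "f \<noteq> 0"
  obtain C where "\<forall>\<^sub>F \<nu> in at_top. vb (poly f (z \<nu>)) = Fin C + nmul (degdom vb z f) (\<delta> \<nu>)"
    using eventually_eval'[OF f] by blast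
  then show ?thesis
  proof eventually_elim
    case (elim \<nu>)
    obtain g where "\<delta> \<nu> = Fin g" using delta_Fin .
    then show ?case using elim by auto
  qed
qed

lemma strict_mono_iff_degdom:
  assumes "f \<noteq> 0"
  shows "ultimately_strict_mono (\<lambda>\<nu>. vb (poly f (z \<nu>))) \<longleftrightarrow> degdom vb z f > 0"
proof -
  obtain C where ev: "\<forall>\<^sub>F \<nu> in at_top. vb (poly f (z \<nu>)) = Fin C + nmul (degdom vb z f) (\<delta> \<nu>)"
    using eventually_eval'[OF assms] by blast
  then obtain N where N: "\<And>\<nu>. \<nu> \<ge> N \<Longrightarrow> vb (poly f (z \<nu>)) = Fin C + nmul (degdom vb z f) (\<delta> \<nu>)"
    by (auto simp: eventually_at_top_linorder)
  show ?thesis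
  proof
    assume pos: "degdom vb z f > 0"
    have "strict_mono_on {N..} (\<lambda>\<nu>. vb (poly f (z \<nu>)))"
    proof (rule strict_mono_onI)
      fix \<nu> \<mu> assume "\<nu> \<in> {N..}" "\<mu> \<in> {N..}" and lt: "\<nu> < \<mu>"
      obtain g where g: "\<delta> \<nu> = Fin g" using delta_Fin .
      obtain h where h: "\<delta> \<mu> = Fin h" using delta_Fin .
      have "g < h" using delta_less[OF lt] g h by simp
      then show "vb (poly f (z \<nu>)) < vb (poly f (z \<mu>))"
        using N \<open>\<nu> \<in> {N..}\<close> \<open>\<mu> \<in> {N..}\<close> g h nmul_strict_mono[OF pos] by simp
    qed
    then show "ultimately_strict_mono (\<lambda>\<nu>. vb (poly f (z \<nu>)))" unfolding ultimately_strict_mono_def by blast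
  next
    assume "ultimately_strict_mono (\<lambda>\<nu>. vb (poly f (z \<nu>)))"
    then obtain M where M: "strict_mono_on {M..} (\<lambda>\<nu>. vb (poly f (z \<nu>)))"
      unfolding ultimately_strict_mono_def by blast
    define \<nu> where "\<nu> = max M N"
    have "vb (poly f (z \<nu>)) < vb (poly f (z (index_succ \<nu>)))"
      by (rule strict_mono_onD[OF M]) (use index_succ[of \<nu>] in \<open>auto simp: \<nu>_def\<close>)
    moreover have "N \<le> \<nu>" "N \<le> index_succ \<nu>" using index_succ[of \<nu>] by (auto simp: \<nu>_def)
    ultimately show "degdom vb z f > 0" using N by (cases "degdom vb z f") auto
  qed
qed

text \<open>Without limits among its roots a polynomial has eventually constant value, which
  algebraic type rules out for some \<open>f\<close>.\<close>

lemma exists_limit: "\<exists>a. is_lim a"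
proof -
  obtain f where f: "f \<in> polys K" "\<not> ultimately_constant (\<lambda>\<nu>. v (poly f (z \<nu>)))"
    using at by (auto simp: algebraic_type_def)
  have vv: "v (poly f (z \<nu>)) = vb (poly f (z \<nu>))" for \<nu> using vb_eq K.poly_mem[OF f(1) zK] by simp
  have f0: "f \<noteq> 0" using f(2) by (auto simp: ultimately_constant_def)
  obtain C where ev: "\<forall>\<^sub>F \<nu> in at_top. vb (poly f (z \<nu>)) = Fin C + nmul (degdom vb z f) (\<delta> \<nu>)"
    using eventually_eval'[OF f0] by blast
  have "degdom vb z f > 0"
  proof (rule ccontr)
    assume "\<not> degdom vb z f > 0"
    then have "\<forall>\<^sub>F \<nu> in at_top. v (poly f (z \<nu>)) = Fin C" using ev by (simp add: vv)
    then show False using f(2) unfolding ultimately_constant_def by blast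
  qed
  then show ?thesis using degdom_pos_iff[OF f0] by blast
qed

text \<open>Ultimately increasing means having a limit among the roots. So \<open>Q\<close> has
  least degree among the minimal polynomials of limits and equals that of one of its roots. The
  parameter \<open>u\<close> covers both \<open>v\<close> on \<open>K\<close> and \<open>vb\<close>
  on the henselization.\<close>

lemma assoc_min_poly_limit_root:
  assumes F: "subfield_set F" "K \<subseteq> F" and u: "\<And>c. c \<in> F \<Longrightarrow> u c = vb c"
    and Q: "assoc_min_poly F u z Q"
  shows "Q \<in> polys F" "lcf Q = 1" "\<exists>a. poly Q a = 0 \<and> is_lim a"
    and "\<And>a. is_lim a \<Longrightarrow> deg Q \<le> deg (minpoly F a)"
    and "\<And>a. poly Q a = 0 \<Longrightarrow> Q = minpoly F a"
proof -
  interpret F: subfield_set F by fact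
  have algF: "algebraic_over F x" for x using algebraic_over_mono[OF F(2) alg] .
  have uu: "u (poly f (z \<nu>)) = vb (poly f (z \<nu>))" if "f \<in> polys F" for f \<nu>
    using F.poly_mem[OF that, of "z \<nu>"] zK F(2) u by blast
  have crit: "ultimately_strict_mono (\<lambda>\<nu>. u (poly f (z \<nu>))) \<longleftrightarrow> (\<exists>r. poly f r = 0 \<and> is_lim r)"
    if "f \<in> polys F" "f \<noteq> 0" for f
    using strict_mono_iff_degdom[OF that(2)] degdom_pos_iff[OF that(2)] uu[OF that(1)] by simp
  have Q': "Q \<in> polys F" "lcf Q = 1" "ultimately_strict_mono (\<lambda>\<nu>. u (poly Q (z \<nu>)))"
    and min: "\<And>f. f \<in> polys F \<Longrightarrow> lcf f = 1 \<Longrightarrow> ultimately_strict_mono (\<lambda>\<nu>. u (poly f (z \<nu>))) \<Longrightarrow> deg Q \<le> deg f"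
    using Q unfolding assoc_min_poly_def is_arg_min_def by (auto simp: not_less)
  have Q0: "Q \<noteq> 0" using Q'(2) by auto
  show "Q \<in> polys F" "lcf Q = 1" by fact+
  show ex: "\<exists>a. poly Q a = 0 \<and> is_lim a" using crit[OF Q'(1) Q0] Q'(3) by simp
  show minp: "deg Q \<le> deg (minpoly F a)" if "is_lim a" for a
    by (rule min) (use F.minpoly(1-3)[OF algF] F.minpoly_nonzero[OF algF] crit that in auto)
  obtain a where a: "poly Q a = 0" "is_lim a" using ex by blast
  note m = F.minpoly(1-3)[OF algF, of a]
  obtain k where k: "Q = minpoly F a * k" using F.minpoly_dvd[OF algF Q'(1) a(1)] by blast
  have k0: "k \<noteq> 0" using k Q0 by auto
  have "deg Q = deg (minpoly F a) + deg k" unfolding k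
    using F.minpoly_nonzero[OF algF] k0 by (rule degree_mult_eq)
  then have "deg k = 0" using minp[OF a(2)] by simp
  then obtain c where c: "k = [:c:]" by (auto elim: degree_eq_zeroE)
  have "lcf k = 1" using Q'(2) m(2) unfolding k lead_coeff_mult by simp
  then have Qa: "Q = minpoly F a" using k c by simp
  show "Q = minpoly F b" if "poly Q b = 0" for b
    using F.minpoly_conjugate(2)[OF algF, of a b] that Qa by simp
qed

text \<open>A root \<open>r\<close> is the image of a limit \<open>a\<close> under an embedding over
  \<open>F\<close>, which fixes all \<open>z \<nu>\<close> and preserves values; so
  \<open>r - z \<nu>\<close> and \<open>a - z \<nu>\<close> have the same value.\<close>

theorem degdom_assoc_min_poly_henselian:
  assumes F: "subfield_set F" "K \<subseteq> F" "henselian F vb" and Q: "assoc_min_poly F vb z Q"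
  shows "degdom vb z Q = deg Q"
proof -
  have algF: "algebraic_over F x" for x using algebraic_over_mono[OF F(2) alg] .
  note Q' = assoc_min_poly_limit_root[OF F(1,2) refl Q]
  obtain a where a: "poly Q a = 0" "is_lim a" using Q'(3) by blast
  have Q0: "Q \<noteq> 0" using Q'(2) by auto
  have "is_lim r" if r: "poly Q r = 0" for r
  proof -
    have "poly (minpoly F a) r = 0" using Q'(5)[OF a(1)] r by simp
    then obtain \<sigma> where \<sigma>: "field_emb \<sigma>" "\<forall>x\<in>F. \<sigma> x = x" "\<sigma> a = r"
      using conjugate_embedding[OF F(1) algF] by blast
    interpret \<sigma>: field_emb \<sigma> by fact
    have "vb (r - z \<nu>) = vb (a - z \<nu>)" for \<nu>
    proof -
      have "\<sigma> (a - z \<nu>) = r - z \<nu>" using \<sigma>(2,3) zK F(2) by auto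
      then show ?thesis
        using henselian_embedding_value[OF valued_UNIV_axioms F(1,3) algF \<sigma>(1), of "a - z \<nu>"] \<sigma>(2) by simp
    qed
    then show ?thesis using a(2) by (simp add: limit_iff)
  qed
  then have "filter_mset is_lim (proots Q) = proots Q"
    using Q0 by (simp add: filter_mset_eq_conv)
  then show ?thesis using poly_splits(2)[OF Q0] by (simp add: degdom_def)
qed

end

locale common_ext = pcs_setup vb K v w z
  for vb :: "'a::alg_closed_field \<Rightarrow> 'g::divisible_ordered_ab_group extended" and K v w
    and z :: "'i::{wellorder, no_top} \<Rightarrow> 'a" +
  fixes wb :: "'a poly fract \<Rightarrow> 'g extended"
  assumes ce: "common_extension K w vb wb"
begin

sublocale wb: valued_UNIV wb
  using ce by (simp add: common_extension_def valued_UNIV_def valued_field_UNIV)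

lemma wb_const [simp]: "wb (ratC c) = vb c" and wb_eq: "\<phi> \<in> ratfuns K \<Longrightarrow> wb \<phi> = w \<phi>"
  using ce by (simp_all add: common_extension_def)

abbreviation "xv b \<equiv> wb (ratX - ratC b)"

lemma wb_diff_const: "wb (ratC a - ratC b) = vb (a - b)"
  using wb_const[of "a - b"] by simp

lemma pcs_wb: "pcs wb (\<lambda>\<nu>. ratC (z \<nu>))"
  using pcvb unfolding pcs_def pcs_axioms_def pseudo_convergent_def
  by (simp add: wb_diff_const wb.valued_UNIV_axioms)

text \<open>The same sequence viewed in \<open>'a(X)\<close>, so that the results on limits apply to
  \<open>X\<close> itself.\<close>

sublocale X: pcs wb "\<lambda>\<nu>. ratC (z \<nu>)" by (rule pcs_wb)

lemma X_delta [simp]: "pcs_delta wb (\<lambda>\<nu>. ratC (z \<nu>)) = \<delta>"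
  by (simp add: pcs_delta_def wb_diff_const fun_eq_iff)

lemma xv_z: "xv (z \<nu>) = \<delta> \<nu>"
proof -
  have "pcs_limit wb (\<lambda>\<nu>. ratC (z \<nu>)) ratX"
    unfolding pcs_limit_def using limX
  proof eventually_elim
    case (elim \<nu>)
    have "ratX - ratC (z \<nu>) \<in> ratfuns K"
      using w.diff_mem[OF ratX_mem_ratfuns[OF K] ratC_mem_ratfuns[OF K zK]] .
    then show ?case using elim by (simp add: wb_eq)
  qed
  then show ?thesis by (simp add: X.limit_iff)
qed

lemma xv_diff: "ratX - ratC b = (ratX - ratC a) + (ratC a - ratC b)"
  by simp

lemma limit_xv: assumes "is_lim b" shows "\<delta> \<nu> < xv b"
proof -
  let ?\<mu> = "index_succ \<nu>"
  have "min (xv (z ?\<mu>)) (vb (z ?\<mu> - b)) \<le> xv b"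
    unfolding xv_diff[of b "z ?\<mu>"] using wb.v_add[of "ratX - ratC (z ?\<mu>)" "ratC (z ?\<mu>) - ratC b"]
    by (simp add: wb_diff_const)
  then have "\<delta> ?\<mu> \<le> xv b" using assms v_diff_commute[of "z ?\<mu>" b] by (simp add: xv_z limit_iff)
  then show ?thesis using delta_less[OF index_succ[of \<nu>]] by simp
qed

lemma nonlimit_xv: assumes "vb (b - z \<nu>) < \<delta> \<nu>" shows "xv b = vb (b - z \<nu>)"
proof -
  have "wb ((ratC (z \<nu>) - ratC b) + (ratX - ratC (z \<nu>))) = wb (ratC (z \<nu>) - ratC b)"
    by (rule wb.v_add_less) (use assms v_diff_commute[of "z \<nu>" b] in \<open>auto simp: wb_diff_const xv_z\<close>)
  then show ?thesis using v_diff_commute[of "z \<nu>" b] by (simp add: wb_diff_const)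
qed

lemma outer_value: "\<not> is_lim b \<Longrightarrow> xv b = outer_value b"
  unfolding outer_value_def by (rule nonlimit_xv) (rule someI_ex, meson nonlimitE)

lemma limit_iff_xv: "is_lim b \<longleftrightarrow> (\<forall>\<nu>. \<delta> \<nu> < xv b)"
  using limit_xv nonlimitE[of b] nonlimit_xv[of b] by (metis less_asym)

lemma xv_Fin: obtains g where "xv b = Fin g"
  by (rule wb.v_Fin[of "ratX - ratC b"]) (use ratX_neq_ratC[of b] in auto)

lemma wb_poly: "f \<noteq> 0 \<Longrightarrow> wb (to_fract f) = vb (lcf f) + (\<Sum>r\<in>#proots f. xv r)"
  by (subst to_fract_splits) (simp_all add: wb.v_mult wb.v_prod_mset)

text \<open>By \<open>pair_of_definition_iff\<close> this characterizes the first members of pairs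
  of definition, without reference to polynomials.\<close>

definition transcendental_at :: "'a \<Rightarrow> bool" where
  "transcendental_at b \<longleftrightarrow> xv b \<notin> Fin ` \<Gamma>"

lemma not_trans: assumes "\<not> transcendental_at b" obtains g where "xv b = Fin g" "g \<in> \<Gamma>"
  using assms by (auto simp: transcendental_at_def)

lemma poly_not_trans:
  assumes "f \<noteq> 0" "\<And>r. poly f r = 0 \<Longrightarrow> \<not> transcendental_at r" shows "wb (to_fract f) \<in> Fin ` \<Gamma>"
proof -
  have "\<exists>c\<in>\<Gamma>. (\<Sum>r\<in>#A. xv r) = Fin c" if "\<forall>r\<in>#A. \<not> transcendental_at r" for A
    using that
  proof (induction A)
    case empty
    then show ?case by (intro bexI[of _ 0]) (auto simp: zero_extended_def)
  next
    case (add r A)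
    then obtain c where c: "c \<in> \<Gamma>" "(\<Sum>r\<in>#A. xv r) = Fin c" by auto
    obtain g where g: "xv r = Fin g" "g \<in> \<Gamma>" using not_trans[of r] add.prems by auto
    show ?case using c g by (intro bexI[of _ "g + c"]) auto
  qed
  from this[of "proots f"] obtain c where c: "c \<in> \<Gamma>" "(\<Sum>r\<in>#proots f. xv r) = Fin c"
    using assms by auto
  obtain l where l: "vb (lcf f) = Fin l" using v_Fin[of "lcf f"] assms(1) by auto
  show ?thesis using wb_poly[OF assms(1)] c l mem_value_group[OF l] by auto
qed

lemma exists_trans: "\<exists>a. transcendental_at a"
proof -
  obtain f g where f: "f \<in> polys K" "f \<noteq> 0" "W f = Fin g" "g \<notin> \<Gamma>"
    using exists_transcendental_poly by blast
  then have "wb (to_fract f) \<notin> Fin ` \<Gamma>" using wb_eq by auto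
  then show ?thesis using poly_not_trans[OF f(2)] by blast
qed

text \<open>\<open>vb (a - b)\<close> is in \<open>\<Gamma>\<close> or infinite and so differs from
  \<open>xv a\<close>; the ultrametric inequality becomes an equality.\<close>

lemma xv_min: assumes "transcendental_at a" shows "xv b = min (xv a) (vb (a - b))"
proof -
  have "xv a \<noteq> vb (a - b)"
  proof
    assume eq: "xv a = vb (a - b)"
    obtain g where "xv a = Fin g" using xv_Fin .
    then show False using assms eq mem_value_group[of "a - b" g] by (auto simp: transcendental_at_def)
  qed
  then show ?thesis
    unfolding xv_diff[of b a] using wb.v_add_neq[of "ratX - ratC a" "ratC a - ratC b"]
    by (simp add: wb_diff_const)
qed

lemma trans_xv_eq: assumes "transcendental_at a" "transcendental_at b" shows "xv a = xv b"
  using xv_min[OF assms(1), of b] xv_min[OF assms(2), of a] v_diff_commute[of a b]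
  by (auto simp: min_def split: if_splits)

text \<open>By \<open>xv_min\<close>, \<open>xv a\<close> is at least \<open>xv b\<close> for some
  limit \<open>b\<close>, hence exceeds all \<open>\<delta> \<nu>\<close>.\<close>

lemma trans_limit: assumes "transcendental_at a" shows "is_lim a"
proof -
  obtain b where b: "is_lim b" using exists_limit by blast
  have "xv b \<le> xv a" using xv_min[OF assms, of b] by simp
  then show ?thesis using b by (auto simp: limit_iff_xv intro: less_le_trans)
qed

text \<open>All transcendental roots contribute the same \<open>\<alpha>\<close>, so their total is
  a positive multiple of it and cannot fall back into \<open>\<Gamma>\<close>.\<close>

lemma poly_trans:
  assumes "f \<noteq> 0" "poly f a = 0" "transcendental_at a" shows "wb (to_fract f) \<notin> Fin ` \<Gamma>"
proof -
  obtain \<alpha> where \<alpha>: "xv a = Fin \<alpha>" using xv_Fin .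
  have "\<alpha> \<notin> \<Gamma>" using assms(3) \<alpha> by (auto simp: transcendental_at_def)
  have sum: "\<exists>c\<in>\<Gamma>. (\<Sum>r\<in>#A. xv r) = Fin (c + nmul (size (filter_mset transcendental_at A)) \<alpha>)" for A
  proof (induction A)
    case empty
    then show ?case by (intro bexI[of _ 0]) (auto simp: zero_extended_def)
  next
    case (add r A)
    then obtain c where c: "c \<in> \<Gamma>" "(\<Sum>r\<in>#A. xv r) = Fin (c + nmul (size (filter_mset transcendental_at A)) \<alpha>)" by blast
    show ?case
    proof (cases "transcendental_at r")
      case True
      then have "xv r = Fin \<alpha>" using trans_xv_eq[OF assms(3)] \<alpha> by simp
      then show ?thesis using c True by (intro bexI[of _ c]) (auto simp: algebra_simps)
    next
      case False
      then obtain g where g: "xv r = Fin g" "g \<in> \<Gamma>" using not_trans by blast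
      then show ?thesis using c False by (intro bexI[of _ "g + c"]) (auto simp: algebra_simps)
    qed
  qed
  obtain c where c: "c \<in> \<Gamma>"
    "(\<Sum>r\<in>#proots f. xv r) = Fin (c + nmul (size (filter_mset transcendental_at (proots f))) \<alpha>)" using sum by blast
  obtain l where l: "vb (lcf f) = Fin l" using v_Fin[of "lcf f"] assms(1) by auto
  define k where "k = size (filter_mset transcendental_at (proots f))"
  have "a \<in># filter_mset transcendental_at (proots f)" using assms by simp
  then have k: "k > 0" unfolding k_def by (metis empty_not_add_mset multi_member_split nonempty_has_size)
  have "wb (to_fract f) = Fin (l + c + nmul k \<alpha>)" using wb_poly[OF assms(1)] c l by (simp add: k_def add.assoc)
  moreover have "l + c + nmul k \<alpha> \<notin> \<Gamma>"
  proof
    assume "l + c + nmul k \<alpha> \<in> \<Gamma>"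
    then have "(l + c + nmul k \<alpha>) - (l + c) \<in> \<Gamma>" using c(1) mem_value_group[OF l] by (intro value_group_diff) auto
    then show False using value_group_pure[OF k, of \<alpha>] \<open>\<alpha> \<notin> \<Gamma>\<close> by simp
  qed
  ultimately show ?thesis by auto
qed

text \<open>If \<open>xv a\<close> were in \<open>\<Gamma>\<close>, the formula for
  \<open>X - b = (a - b) + (X - a)\<close> with transcendental \<open>b\<close> would give a value
  in \<open>\<Gamma>\<close>. Conversely, if it is outside, terms of different degree have different
  finite values.\<close>

lemma pair_of_definition_iff: "pair_of_definition vb wb a (xv a) \<longleftrightarrow> transcendental_at a"
proof
  assume pair: "pair_of_definition vb wb a (xv a)"
  show "transcendental_at a"
  proof (rule ccontr)
    assume "\<not> transcendental_at a"
    then obtain g where g: "xv a = Fin g" "g \<in> \<Gamma>" using not_trans by blast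
    obtain b where b: "transcendental_at b" using exists_trans by blast
    define c where "c = (\<lambda>i::nat. if i = 0 then a - b else if i = 1 then 1 else 0)"
    have "wb (\<Sum>i\<le>1. ratC (c i) * (ratX - ratC a) ^ i) = (MIN i\<in>{..1}. vb (c i) + (\<Sum>j<i. xv a))"
      using pair unfolding pair_of_definition_def by blast
    moreover have "(\<Sum>i\<le>1. ratC (c i) * (ratX - ratC a) ^ i) = ratX - ratC b"
      by (simp add: c_def)
    moreover have "(MIN i\<in>{..1::nat}. vb (c i) + (\<Sum>j<i. xv a)) = min (vb (a - b)) (xv a)"
    proof -
      have "{..1::nat} = {0, 1}" by auto
      then show ?thesis by (simp add: c_def)
    qed
    ultimately have "xv b = min (vb (a - b)) (xv a)" by simp
    moreover have "min (vb (a - b)) (xv a) \<in> Fin ` \<Gamma>"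
    proof (cases "vb (a - b) < xv a")
      case True
      then have "a - b \<noteq> 0" by auto
      then obtain h where "vb (a - b) = Fin h" using v_Fin[OF UNIV_I] by blast
      then show ?thesis using True mem_value_group by (auto simp: min_def)
    next
      case False
      then show ?thesis using g by (auto simp: min_def)
    qed
    ultimately show False using b by (simp add: transcendental_at_def)
  qed
next
  assume tr: "transcendental_at a"
  obtain \<alpha> where \<alpha>: "xv a = Fin \<alpha>" using xv_Fin .
  have "\<alpha> \<notin> \<Gamma>" using tr \<alpha> by (auto simp: transcendental_at_def)
  show "pair_of_definition vb wb a (xv a)"
    unfolding pair_of_definition_def sum_lessThan_const
  proof (intro allI)
    fix c :: "nat \<Rightarrow> 'a" and n :: nat
    define t where "t = (\<lambda>i. ratC (c i) * (ratX - ratC a) ^ i)"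
    have vt: "wb (t i) = vb (c i) + nmul i (xv a)" for i by (simp add: t_def wb.v_mult wb.v_power)
    have m: "(MIN i\<in>{..n}. vb (c i) + nmul i (xv a)) = (MIN i\<in>{..n}. wb (t i))" by (simp add: vt)
    have "(MIN i\<in>{..n}. wb (t i)) \<in> (\<lambda>i. wb (t i)) ` {..n}" by (rule Min_in) auto
    then obtain i where i: "(MIN i\<in>{..n}. wb (t i)) = wb (t i)" "i \<in> {..n}" by (rule imageE)
    have le: "wb (t i) \<le> wb (t j)" if "j \<le> n" for j
      unfolding i(1)[symmetric] using that by (intro Min_le) auto
    have "wb (sum t {..n}) = wb (t i)"
    proof (cases "wb (t i) = \<infinity>")
      case True
      then have "t j = 0" if "j \<le> n" for j using le[OF that] by simp
      then show ?thesis using True by simp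
    next
      case False
      show ?thesis
      proof (rule wb.v_sum_unique_min)
        have main: "wb (t j) \<noteq> wb (t k)" if "j < k" "wb (t j) \<noteq> \<infinity>" for j k
        proof
          assume eq: "wb (t j) = wb (t k)"
          have "t j \<noteq> 0" using that(2) by auto
          have "t k \<noteq> 0" using that(2) unfolding eq by auto
          then have "c j \<noteq> 0" "c k \<noteq> 0" using \<open>t j \<noteq> 0\<close> by (auto simp: t_def)
          then obtain g h where gh: "vb (c j) = Fin g" "vb (c k) = Fin h" using v_Fin by (metis UNIV_I)
          have "nmul k \<alpha> = nmul (k - j) \<alpha> + nmul j \<alpha>" using nmul_add_left[of "k - j" j \<alpha>] that(1) by simp
          then have "nmul (k - j) \<alpha> = g - h" using eq gh by (simp add: vt \<alpha> algebra_simps)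
          then show False using value_group_pure[of "k - j" \<alpha>] \<open>\<alpha> \<notin> \<Gamma>\<close> that(1) gh mem_value_group by simp
        qed
        fix j assume j: "j \<in> {..n}" "j \<noteq> i"
        then have "wb (t i) \<noteq> wb (t j)"
          using main[of i j] main[of j i] False by (cases i j rule: linorder_cases) metis+
        then show "wb (t i) < wb (t j)" using le[of j] j by simp
      qed (use i False in auto)
    qed
    then show "wb (\<Sum>i\<le>n. ratC (c i) * (ratX - ratC a) ^ i) = (MIN i\<in>{..n}. vb (c i) + nmul i (xv a))"
      unfolding m i(1) by (simp add: t_def)
  qed
qed

end

section \<open>The cut condition and the induced valuation\<close>

context common_ext
begin

lemma eventually_eval_wb:
  assumes "f \<noteq> 0"
  obtains C where "C \<in> \<Gamma>" "\<forall>\<^sub>F \<nu> in at_top. vb (poly f (z \<nu>)) = Fin C + nmul (degdom vb z f) (\<delta> \<nu>)"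
    "wb (to_fract f) = Fin C + (\<Sum>r\<in>#filter_mset is_lim (proots f). xv r)"
proof -
  obtain C where C: "C \<in> \<Gamma>" "\<forall>\<^sub>F \<nu> in at_top. vb (poly f (z \<nu>)) = Fin C + nmul (degdom vb z f) (\<delta> \<nu>)"
    "Fin C = vb (lcf f) + (\<Sum>r\<in>#filter_mset (\<lambda>r. \<not> is_lim r) (proots f). outer_value r)"
    by (rule eventually_eval[OF assms])
  have eq: "(\<Sum>r\<in>#filter_mset (\<lambda>r. \<not> is_lim r) (proots f). outer_value r)
      = (\<Sum>r\<in>#filter_mset (\<lambda>r. \<not> is_lim r) (proots f). xv r)"
    by (rule arg_cong[where f = sum_mset], rule image_mset_cong) (simp add: outer_value)
  have split: "(\<Sum>r\<in>#proots f. xv r) = (\<Sum>r\<in>#filter_mset is_lim (proots f). xv r)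
      + (\<Sum>r\<in>#filter_mset (\<lambda>r. \<not> is_lim r) (proots f). xv r)"
    using arg_cong[OF multiset_partition[of "proots f" is_lim], of "\<lambda>A. \<Sum>r\<in>#A. xv r"]
    unfolding image_mset_union sum_mset.union .
  have "wb (to_fract f) = Fin C + (\<Sum>r\<in>#filter_mset is_lim (proots f). xv r)"
    unfolding C(3) wb_poly[OF assms] eq split by (simp add: ac_simps)
  then show thesis using that C(1,2) by blast
qed

text \<open>All transcendental \<open>a\<close> share one value \<open>xv a\<close>; the condition
  says that this value and the sequence \<open>\<delta>\<close> have the same strict upper bounds in
  \<open>\<Gamma>\<close>.\<close>

definition tight :: bool where
  "tight \<longleftrightarrow> (\<forall>a. transcendental_at a \<longrightarrow>
     (\<forall>\<beta>\<in>\<Gamma>. xv a < Fin \<beta> \<longleftrightarrow> (\<forall>\<nu>. \<delta> \<nu> < Fin \<beta>)))"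

text \<open>A limit \<open>b\<close> with \<open>xv b = g\<close> in \<open>\<Gamma>\<close> gives
  an upper bound \<open>g\<close> of the \<open>\<delta> \<nu>\<close> that is not above
  \<open>xv a\<close>, since \<open>xv b \<le> xv a\<close>. Conversely, shifting \<open>a\<close>
  by a constant of value \<open>\<beta>\<close> above all \<open>\<delta> \<nu>\<close> gives
  another limit, and if that is transcendental, then \<open>xv a < Fin \<beta>\<close>.\<close>

lemma tight_iff_limits: "tight \<longleftrightarrow> (\<forall>a. is_lim a \<longleftrightarrow> transcendental_at a)"
proof
  assume t: tight
  show "\<forall>a. is_lim a \<longleftrightarrow> transcendental_at a"
  proof (intro allI iffI)
    fix b assume b: "is_lim b"
    show "transcendental_at b"
    proof (rule ccontr)
      assume "\<not> transcendental_at b"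
      then obtain g where g: "xv b = Fin g" "g \<in> \<Gamma>" using not_trans by blast
      obtain a where a: "transcendental_at a" using exists_trans by blast
      have "\<forall>\<nu>. \<delta> \<nu> < Fin g" using b limit_iff_xv g(1) by simp
      then have "xv a < Fin g" using t a g(2) unfolding tight_def by blast
      then show False using xv_min[OF a, of b] g(1) by (simp add: min_def split: if_splits)
    qed
  qed (rule trans_limit)
next
  assume lim: "\<forall>a. is_lim a \<longleftrightarrow> transcendental_at a"
  show tight unfolding tight_def
  proof (intro allI impI ballI iffI)
    fix a \<beta> assume a: "transcendental_at a" and \<beta>: "\<beta> \<in> \<Gamma>"
    show "\<delta> \<nu> < Fin \<beta>" if "xv a < Fin \<beta>" for \<nu>
      using that limit_xv[OF trans_limit[OF a], of \<nu>] by simp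
    assume *: "\<forall>\<nu>. \<delta> \<nu> < Fin \<beta>"
    obtain c where c: "vb c = Fin \<beta>" using value_group_nonzeroE[OF \<beta>] by blast
    define b where "b = a - c"
    have "is_lim b" using limit_diff[OF trans_limit[OF a], of b] * c by (simp add: b_def)
    then have "xv b = xv a" using lim trans_xv_eq[OF a] by simp
    then have "xv a \<le> Fin \<beta>" using xv_min[OF a, of b] c by (simp add: b_def min_def split: if_splits)
    moreover have "xv a \<noteq> Fin \<beta>" using a \<beta> by (auto simp: transcendental_at_def)
    ultimately show "xv a < Fin \<beta>" by simp
  qed
qed

text \<open>If the cut of \<open>X - a\<close> is too large, a power of the minimal polynomial of \<open>a\<close>, divided by a
  suitable constant, is integral for \<open>w\<close> but not along the sequence.\<close>

lemma vE_imp_tight: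
  assumes i: "valuation_ring (ratfuns K) w = vE_ring K v z" shows tight
proof (rule ccontr)
  assume "\<not> tight"
  then obtain a \<beta> where a: "transcendental_at a" and \<beta>: "\<beta> \<in> \<Gamma>"
    and ne: "(xv a < Fin \<beta>) \<noteq> (\<forall>\<nu>. \<delta> \<nu> < Fin \<beta>)" unfolding tight_def by blast
  have "\<delta> \<nu> < Fin \<beta>" if "xv a < Fin \<beta>" for \<nu>
    using that limit_xv[OF trans_limit[OF a], of \<nu>] by simp
  \<comment> \<open>One implication always holds, so the failure consists in a
    \<open>\<beta>\<close> of \<open>\<Gamma>\<close> above all \<open>\<delta> \<nu>\<close> but
    not above \<open>xv a\<close>.\<close>
  then have \<beta>\<delta>: "\<delta> \<nu> < Fin \<beta>" and \<beta>x: "Fin \<beta> \<le> xv a" for \<nu>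
    using ne by (auto simp: not_less[symmetric])
  define f where "f = minpoly K a"
  note f = K.minpoly(1-3)[OF alg, of a, folded f_def]
  have f0: "f \<noteq> 0" unfolding f_def by (rule K.minpoly_nonzero[OF alg])
  obtain C where C: "C \<in> \<Gamma>" "\<forall>\<^sub>F \<nu> in at_top. vb (poly f (z \<nu>)) = Fin C + nmul (degdom vb z f) (\<delta> \<nu>)"
    "wb (to_fract f) = Fin C + (\<Sum>r\<in>#filter_mset is_lim (proots f). xv r)"
    by (rule eventually_eval_wb[OF f0])
  \<comment> \<open>Every limit root leaves an element of \<open>\<Gamma>\<close> above the
    \<open>\<delta> \<nu>\<close> and at most \<open>xv r\<close>: its own value, or
    \<open>\<beta>\<close> if it is transcendental.\<close>
  have root_bound: "\<exists>g\<in>\<Gamma>. Fin g \<le> xv r \<and> (\<forall>\<nu>. \<delta> \<nu> < Fin g)" if "is_lim r" for r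
  proof (cases "transcendental_at r")
    case True
    then show ?thesis using trans_xv_eq[OF a True] \<beta> \<beta>\<delta> \<beta>x by metis
  next
    case False
    then obtain g where g: "xv r = Fin g" "g \<in> \<Gamma>" using not_trans by blast
    then show ?thesis using \<open>is_lim r\<close> limit_iff_xv by (intro bexI[of _ g]) auto
  qed
  have bound: "\<exists>s\<in>\<Gamma>. Fin s \<le> (\<Sum>r\<in>#A. xv r) \<and> (A \<noteq> {#} \<longrightarrow> (\<forall>\<nu>. nmul (size A) (\<delta> \<nu>) < Fin s))"
    if "\<forall>r\<in>#A. is_lim r" for A
    using that
  proof (induction A)
    case empty
    then show ?case by (intro bexI[of _ 0]) (auto simp: zero_extended_def)
  next
    case (add r A)
    then obtain s where s: "s \<in> \<Gamma>" "Fin s \<le> (\<Sum>r\<in>#A. xv r)" "A \<noteq> {#} \<longrightarrow> (\<forall>\<nu>. nmul (size A) (\<delta> \<nu>) < Fin s)"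
      by auto
    obtain g where g: "g \<in> \<Gamma>" "Fin g \<le> xv r" "\<forall>\<nu>. \<delta> \<nu> < Fin g" using root_bound[of r] add.prems by auto
    have "nmul (size (add_mset r A)) (\<delta> \<nu>) < Fin (g + (if A = {#} then 0 else s))" for \<nu>
    proof -
      obtain d where d: "\<delta> \<nu> = Fin d" using delta_Fin .
      show ?thesis using g(3) s(3) by (cases "A = {#}") (auto simp: d dest!: spec[of _ \<nu>] intro: add_strict_mono)
    qed
    moreover have "Fin (g + (if A = {#} then 0 else s)) \<le> (\<Sum>r\<in>#add_mset r A. xv r)"
      using extended_add_mono[OF g(2) s(2)] g(2) by auto
    ultimately show ?case using g(1) s(1) by (intro bexI[of _ "g + (if A = {#} then 0 else s)"]) auto
  qed
  define A where "A = filter_mset is_lim (proots f)"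
  have "a \<in># A" using f(3) f0 trans_limit[OF a] by (simp add: A_def)
  then have A: "A \<noteq> {#}" by auto
  obtain s where s: "s \<in> \<Gamma>" "Fin s \<le> (\<Sum>r\<in>#A. xv r)" "\<forall>\<nu>. nmul (size A) (\<delta> \<nu>) < Fin s"
    using bound[of A] A by (auto simp: A_def)
  \<comment> \<open>The threshold \<open>C + s\<close> need not be the value of an element of
    \<open>K\<close>, but a positive multiple is; hence the power \<open>f ^ n\<close>.\<close>
  obtain n where n: "n > 0" "nmul n (C + s) \<in> value_group K v"
    using value_group_torsion[of "C + s"] C(1) s(1) by auto
  then obtain d where d: "d \<in> K" "v d = Fin (nmul n (C + s))" by (auto simp: value_group_def)
  have vd: "vb d = Fin (nmul n (C + s))" using vb_eq d by simp
  then have d0: "d \<noteq> 0" by auto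
  define \<phi> where "\<phi> = to_fract (f ^ n) / to_fract [:d:]"
  have pK: "f ^ n \<in> polys K" "[:d:] \<in> polys K" using f(1) d(1) by auto
  have \<phi>K: "\<phi> \<in> ratfuns K" unfolding \<phi>_def by (intro w.divide_mem polyK pK)
  have "wb (to_fract f) = Fin C + (\<Sum>r\<in>#A. xv r)" using C(3) by (simp add: A_def)
  moreover have "(\<Sum>r\<in>#A. xv r) \<noteq> \<infinity>"
  proof -
    have "(\<Sum>r\<in>#A. xv r) \<noteq> \<infinity>" for A
      by (induction A) (auto simp: zero_extended_def, metis xv_Fin plus_extended.simps extended.exhaust extended.distinct)
    then show ?thesis .
  qed
  ultimately obtain x where x: "wb (to_fract f) = Fin x" "C + s \<le> x"
    using s(2) by (cases "\<Sum>r\<in>#A. xv r") auto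
  have "wb \<phi> = Fin (nmul n x - nmul n (C + s))"
    unfolding \<phi>_def using wb.v_divide[of "to_fract (f ^ n)" "to_fract [:d:]" "nmul n (C + s)"] vd x(1)
    by (simp add: to_fract_power wb.v_power)
  moreover have "nmul n (C + s) \<le> nmul n x" by (rule nmul_mono[OF x(2)])
  ultimately have "0 \<le> w \<phi>" using wb_eq[OF \<phi>K] by (simp add: zero_extended_def)
  then have "\<phi> \<in> vE_ring K v z" using \<phi>K i by (auto simp: valuation_ring_def)
  then obtain p q where pq: "p \<in> polys K" "q \<in> polys K" "q \<noteq> 0" "\<phi> = Fract p q"
    "\<forall>\<^sub>F \<nu> in at_top. poly q (z \<nu>) \<noteq> 0 \<and> 0 \<le> v (poly p (z \<nu>) / poly q (z \<nu>))"
    by (auto simp: vE_ring_def)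
  have "to_fract (f ^ n) * to_fract q = to_fract p * to_fract [:d:]"
    using pq(3,4) d0 by (simp add: \<phi>_def Fract_conv_to_fract frac_eq_eq)
  then have eq: "f ^ n * q = p * [:d:]" by (simp only: to_fract_mult[symmetric] to_fract_eq_iff)
  \<comment> \<open>An absurd predicate collects the contradiction: along the sequence
    \<open>f ^ n\<close> stays strictly below the value of \<open>d\<close>.\<close>
  have "\<forall>\<^sub>F \<nu> in at_top. z \<nu> \<noteq> z \<nu>"
    using pq(5) C(2)
  proof eventually_elim
    case (elim \<nu>)
    obtain g where g: "\<delta> \<nu> = Fin g" using delta_Fin .
    have size_A: "size A = degdom vb z f" by (simp add: A_def degdom_def)
    have "poly f (z \<nu>) ^ n * poly q (z \<nu>) = poly p (z \<nu>) * d"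
      using arg_cong[OF eq, of "\<lambda>p. poly p (z \<nu>)"] by (simp add: mult.commute)
    then have e: "poly p (z \<nu>) / poly q (z \<nu>) = poly f (z \<nu>) ^ n / d"
      using elim d0 by (simp add: frac_eq_eq)
    have "poly f (z \<nu>) ^ n / d \<in> K" using K.poly_mem[OF f(1) zK] d(1) by simp
    then have "0 \<le> vb (poly f (z \<nu>) ^ n / d)" using elim e vb_eq by simp
    also have "\<dots> = nmul n (vb (poly f (z \<nu>))) + Fin (- nmul n (C + s))"
      using v_divide[of "poly f (z \<nu>) ^ n" d] vd by (simp add: v_power)
    also have "\<dots> = Fin (nmul n (C + nmul (size A) g) - nmul n (C + s))"
      using elim(2) by (simp add: g size_A)
    finally have "nmul n (C + s) \<le> nmul n (C + nmul (size A) g)" by (simp add: zero_extended_def)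
    moreover have "C + nmul (size A) g < C + s" using s(3) g by (auto dest: spec[of _ \<nu>])
    then have "nmul n (C + nmul (size A) g) < nmul n (C + s)" by (rule nmul_strict_mono[OF n(1)])
    ultimately show "z \<nu> \<noteq> z \<nu>" by simp
  qed
  then show False by simp
qed

text \<open>After evaluation, \<open>w\<close> and the sequence compare the same two affine
  expressions with constants in \<open>\<Gamma>\<close>, once at \<open>\<alpha>\<close> and once at
  \<open>d \<nu>\<close>. By tightness, \<open>\<alpha>\<close> and eventually
  \<open>d \<nu>\<close> lie on the same side of each element of \<open>\<Gamma>\<close>.\<close>

lemma tight_imp_vE:
  assumes t: tight shows "valuation_ring (ratfuns K) w = vE_ring K v z"
proof -
  have lim: "is_lim a \<longleftrightarrow> transcendental_at a" for a using t tight_iff_limits by blast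
  obtain a where a: "transcendental_at a" using exists_trans by blast
  obtain \<alpha> where \<alpha>: "xv a = Fin \<alpha>" using xv_Fin .
  define d where "d = (\<lambda>\<nu>. case \<delta> \<nu> of Fin x \<Rightarrow> x | _ \<Rightarrow> 0)"
  have d: "\<delta> \<nu> = Fin (d \<nu>)" for \<nu> by (rule delta_Fin[of \<nu>]) (simp add: d_def)
  have d_less: "d \<nu> < d \<mu>" if "\<nu> < \<mu>" for \<nu> \<mu> using delta_less[OF that] by (simp add: d)
  have cut: "\<alpha> < \<beta> \<longleftrightarrow> (\<forall>\<nu>. d \<nu> < \<beta>)" if "\<beta> \<in> \<Gamma>" for \<beta>
    using t a that \<alpha> unfolding tight_def by (auto simp: d)
  have \<alpha>\<Gamma>: "\<alpha> \<notin> \<Gamma>" using a \<alpha> by (auto simp: transcendental_at_def)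
  have le_ev: "\<beta> \<le> \<alpha> \<longleftrightarrow> (\<forall>\<^sub>F \<nu> in at_top. \<beta> \<le> d \<nu>)" if \<beta>: "\<beta> \<in> \<Gamma>" for \<beta>
  proof
    assume "\<beta> \<le> \<alpha>"
    then have "\<not> (\<forall>\<nu>. d \<nu> < \<beta>)" using cut[OF \<beta>] by (metis leD)
    then obtain \<nu> where \<nu>: "\<beta> \<le> d \<nu>" by (auto simp: not_less)
    show "\<forall>\<^sub>F \<nu> in at_top. \<beta> \<le> d \<nu>"
      using eventually_gt_at_top[of \<nu>] by eventually_elim (use \<nu> d_less in \<open>force dest: less_imp_le\<close>)
  next
    assume "\<forall>\<^sub>F \<nu> in at_top. \<beta> \<le> d \<nu>"
    then obtain \<nu> where "\<beta> \<le> d \<nu>" by (auto simp: eventually_at_top_linorder)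
    then have "\<not> \<alpha> < \<beta>" using cut[OF \<beta>] by (auto simp: not_less)
    then show "\<beta> \<le> \<alpha>" by simp
  qed
  have ge_ev: "\<alpha> \<le> \<beta> \<longleftrightarrow> (\<forall>\<^sub>F \<nu> in at_top. d \<nu> \<le> \<beta>)" if \<beta>: "\<beta> \<in> \<Gamma>" for \<beta>
  proof
    assume "\<alpha> \<le> \<beta>"
    then have "\<alpha> < \<beta>" using \<alpha>\<Gamma> \<beta> by (metis order_le_less)
    then show "\<forall>\<^sub>F \<nu> in at_top. d \<nu> \<le> \<beta>" using cut[OF \<beta>] by (intro always_eventually) (auto intro: less_imp_le)
  next
    assume "\<forall>\<^sub>F \<nu> in at_top. d \<nu> \<le> \<beta>"
    then obtain N where N: "\<And>\<nu>. \<nu> \<ge> N \<Longrightarrow> d \<nu> \<le> \<beta>" by (auto simp: eventually_at_top_linorder)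
    have "d \<nu> < \<beta>" for \<nu>
    proof -
      obtain \<mu> where \<mu>: "max \<nu> N < \<mu>" using gt_ex by blast
      then have "d \<nu> < d \<mu>" "d \<mu> \<le> \<beta>" using d_less[of \<nu> \<mu>] N[of \<mu>] by auto
      then show ?thesis by simp
    qed
    then show "\<alpha> \<le> \<beta>" using cut[OF \<beta>] by (auto intro: less_imp_le)
  qed
  \<comment> \<open>Solving for the variable, with division by the difference of \<open>m\<close>
    and \<open>n\<close>, turns the inequality into a comparison with one \<open>\<beta>\<close> of
    \<open>\<Gamma>\<close>; the sign of the difference decides between \<open>le_ev\<close> and
    \<open>ge_ev\<close>.\<close>
  have compare: "n_le \<longleftrightarrow> (\<forall>\<^sub>F \<nu> in at_top. e + nmul n (d \<nu>) \<le> c + nmul m (d \<nu>))"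
    if ce: "c \<in> \<Gamma>" "e \<in> \<Gamma>" and n_le: "n_le \<longleftrightarrow> e + nmul n \<alpha> \<le> c + nmul m \<alpha>" for n_le c e m n
  proof (cases m n rule: linorder_cases)
    case less
    have split: "nmul n x = nmul (n - m) x + nmul m x" for x :: 'g
      using nmul_add_left[of "n - m" m x] less by simp
    obtain \<beta> where \<beta>: "nmul (n - m) \<beta> = c - e" using nmul_divisible[of "n - m" "c - e"] less by auto
    have "\<beta> \<in> \<Gamma>" by (rule value_group_pure[of "n - m"]) (use less \<beta> ce in auto)
    have "e + nmul n x \<le> c + nmul m x \<longleftrightarrow> x \<le> \<beta>" for x
    proof -
      have "e + nmul n x \<le> c + nmul m x \<longleftrightarrow> nmul (n - m) x \<le> nmul (n - m) \<beta>"
        unfolding split \<beta> by (simp add: algebra_simps)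
      then show ?thesis using nmul_le_iff[of "n - m"] less by simp
    qed
    then show ?thesis using ge_ev[OF \<open>\<beta> \<in> \<Gamma>\<close>] n_le by simp
  next
    case equal
    then show ?thesis using n_le by simp
  next
    case greater
    have split: "nmul m x = nmul (m - n) x + nmul n x" for x :: 'g
      using nmul_add_left[of "m - n" n x] greater by simp
    obtain \<beta> where \<beta>: "nmul (m - n) \<beta> = e - c" using nmul_divisible[of "m - n" "e - c"] greater by auto
    have "\<beta> \<in> \<Gamma>" by (rule value_group_pure[of "m - n"]) (use greater \<beta> ce in auto)
    have "e + nmul n x \<le> c + nmul m x \<longleftrightarrow> \<beta> \<le> x" for x
    proof -
      have "e + nmul n x \<le> c + nmul m x \<longleftrightarrow> nmul (m - n) \<beta> \<le> nmul (m - n) x"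
        unfolding split \<beta> by (simp add: algebra_simps)
      then show ?thesis using nmul_le_iff[of "m - n"] greater by simp
    qed
    then show ?thesis using le_ev[OF \<open>\<beta> \<in> \<Gamma>\<close>] n_le by simp
  qed
  have vals: "\<exists>C\<in>\<Gamma>. W p = Fin (C + nmul (degdom vb z p) \<alpha>) \<and>
      (\<forall>\<^sub>F \<nu> in at_top. vb (poly p (z \<nu>)) = Fin (C + nmul (degdom vb z p) (d \<nu>)))"
    if p: "p \<in> polys K" "p \<noteq> 0" for p
  proof -
    obtain C where C: "C \<in> \<Gamma>" "\<forall>\<^sub>F \<nu> in at_top. vb (poly p (z \<nu>)) = Fin C + nmul (degdom vb z p) (\<delta> \<nu>)"
      "wb (to_fract p) = Fin C + (\<Sum>r\<in>#filter_mset is_lim (proots p). xv r)"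
      by (rule eventually_eval_wb[OF p(2)])
    have "(\<Sum>r\<in>#filter_mset is_lim (proots p). xv r) = nmul (degdom vb z p) (Fin \<alpha>)"
      unfolding degdom_def by (rule sum_mset_constant) (use lim trans_xv_eq[OF a] \<alpha> in auto)
    then have "W p = Fin (C + nmul (degdom vb z p) \<alpha>)" using C(3) wb_eq[OF polyK[OF p(1)]] by simp
    then show ?thesis using C(1,2) by (intro bexI[of _ C]) (auto simp: d)
  qed
  have main: "0 \<le> w (to_fract p / to_fract q) \<longleftrightarrow>
      (\<forall>\<^sub>F \<nu> in at_top. poly q (z \<nu>) \<noteq> 0 \<and> 0 \<le> v (poly p (z \<nu>) / poly q (z \<nu>)))"
    if p: "p \<in> polys K" and q: "q \<in> polys K" "q \<noteq> 0" for p q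
  proof (cases "p = 0")
    case True
    have "v 0 = \<infinity>" using vb_eq[of 0] by simp
    then show ?thesis using True eventually_nonroot[OF q(2)] by simp
  next
    case False
    obtain C where C: "C \<in> \<Gamma>" "W p = Fin (C + nmul (degdom vb z p) \<alpha>)"
      "\<forall>\<^sub>F \<nu> in at_top. vb (poly p (z \<nu>)) = Fin (C + nmul (degdom vb z p) (d \<nu>))"
      using vals[OF p False] by blast
    obtain E where E: "E \<in> \<Gamma>" "W q = Fin (E + nmul (degdom vb z q) \<alpha>)"
      "\<forall>\<^sub>F \<nu> in at_top. vb (poly q (z \<nu>)) = Fin (E + nmul (degdom vb z q) (d \<nu>))"
      using vals[OF q] by blast
    have "w (to_fract p / to_fract q) = W p + Fin (- (E + nmul (degdom vb z q) \<alpha>))"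
      by (rule w.v_divide[OF polyK[OF p] polyK[OF q(1)] E(2)])
    then have 1: "0 \<le> w (to_fract p / to_fract q) \<longleftrightarrow>
        E + nmul (degdom vb z q) \<alpha> \<le> C + nmul (degdom vb z p) \<alpha>"
      using C(2) by (simp add: zero_extended_def algebra_simps)
    have "\<forall>\<^sub>F \<nu> in at_top. (E + nmul (degdom vb z q) (d \<nu>) \<le> C + nmul (degdom vb z p) (d \<nu>)) =
        (poly q (z \<nu>) \<noteq> 0 \<and> 0 \<le> v (poly p (z \<nu>) / poly q (z \<nu>)))"
      using C(3) E(3)
    proof eventually_elim
      case (elim \<nu>)
      have "poly p (z \<nu>) / poly q (z \<nu>) \<in> K" using K.poly_mem[OF p zK] K.poly_mem[OF q(1) zK] by simp
      then have "v (poly p (z \<nu>) / poly q (z \<nu>)) = vb (poly p (z \<nu>) / poly q (z \<nu>))" using vb_eq by simp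
      also have "\<dots> = Fin (C + nmul (degdom vb z p) (d \<nu>)) + Fin (- (E + nmul (degdom vb z q) (d \<nu>)))"
        unfolding elim(1)[symmetric] by (rule v_divide) (use elim in auto)
      finally have e: "v (poly p (z \<nu>) / poly q (z \<nu>))
          = Fin (C + nmul (degdom vb z p) (d \<nu>)) + Fin (- (E + nmul (degdom vb z q) (d \<nu>)))" .
      have "poly q (z \<nu>) \<noteq> 0" using elim(2) by auto
      then show ?case unfolding e by (simp add: zero_extended_def algebra_simps)
    qed
    then show ?thesis
      unfolding compare[OF C(1) E(1) 1, symmetric, THEN sym] by (rule eventually_cong)
  qed
  show ?thesis
  proof (rule Set.set_eqI)
    fix \<phi>
    show "\<phi> \<in> valuation_ring (ratfuns K) w \<longleftrightarrow> \<phi> \<in> vE_ring K v z"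
    proof
      assume "\<phi> \<in> valuation_ring (ratfuns K) w"
      then have \<phi>: "\<phi> \<in> ratfuns K" "0 \<le> w \<phi>" by (auto simp: valuation_ring_def)
      obtain p q where pq: "p \<in> polys K" "q \<in> polys K" "q \<noteq> 0" "\<phi> = to_fract p / to_fract q"
        using ratfunsE[OF \<phi>(1)] .
      then show "\<phi> \<in> vE_ring K v z"
        using main[OF pq(1-3)] \<phi>(2) unfolding vE_ring_def Fract_conv_to_fract by blast
    next
      assume "\<phi> \<in> vE_ring K v z"
      then obtain p q where pq: "p \<in> polys K" "q \<in> polys K" "q \<noteq> 0" "\<phi> = to_fract p / to_fract q"
        "\<forall>\<^sub>F \<nu> in at_top. poly q (z \<nu>) \<noteq> 0 \<and> 0 \<le> v (poly p (z \<nu>) / poly q (z \<nu>))"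
        unfolding vE_ring_def Fract_conv_to_fract by blast
      then show "\<phi> \<in> valuation_ring (ratfuns K) w"
        using main[OF pq(1-3)] w.divide_mem[OF polyK[OF pq(1)] polyK[OF pq(2)]]
        by (simp add: valuation_ring_def)
    qed
  qed
qed

lemma tight_iff_vE: "tight \<longleftrightarrow> valuation_ring (ratfuns K) w = vE_ring K v z"
  using tight_imp_vE vE_imp_tight by blast

end

text \<open>The powers of \<open>b\<close> with exponents below the degree of the minimal polynomial
  are a basis: independent by minimality, spanning by division with remainder.\<close>

lemma ext_degree_eq:
  fixes K :: "'b::field set"
  assumes K: "subfield_set K" and alg: "algebraic_over K b"
  shows "ext_degree K b = deg (minpoly K b)"
proof -
  interpret K: subfield_set K by fact
  let ?R = "ring_of_type_algebra :: 'b ring"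
  interpret R: field ?R by (rule field_from_type_algebra)
  have sf: "is_subfield K" using K by (simp add: subfield_iff_subfield_set)
  define d where "d = deg (minpoly K b)"
  define Us where "Us = map (\<lambda>i. b ^ i) [0..<d]"
  \<comment> \<open>\<open>combine\<close> stops at the end of the shorter list, hence the
    \<open>min\<close>.\<close>
  have comb: "R.combine Ks (map f [m..<m + n]) = (\<Sum>i<min (length Ks) n. Ks ! i * f (m + i))"
    for Ks f m n
  proof (induction n arbitrary: Ks m)
    case 0
    then show ?case by (cases Ks) auto
  next
    case (Suc n)
    show ?case
    proof (cases Ks)
      case (Cons k Ks')
      have "[m..<m + Suc n] = m # [Suc m..<Suc m + n]" by (simp add: upt_rec)
      then have "R.combine Ks (map f [m..<m + Suc n])
          = k * f m + (\<Sum>i<min (length Ks') n. Ks' ! i * f (Suc m + i))"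
        using Suc.IH[of Ks' "Suc m"] Cons by simp
      also have "\<dots> = (\<Sum>i<Suc (min (length Ks') n). Ks ! i * f (m + i))"
        by (subst sum.lessThan_Suc_shift) (simp add: Cons)
      finally show ?thesis by (simp add: Cons)
    qed simp
  qed
  have comb': "R.combine Ks Us = (\<Sum>i<min (length Ks) d. Ks ! i * b ^ i)" for Ks
    using comb[of Ks "\<lambda>i. b ^ i" 0 d] by (simp add: Us_def)
  have poly_sum': "poly (\<Sum>i<n. Polynomial.monom (c i) i) b = (\<Sum>i<n. c i * b ^ i)" for c n
    by (simp add: poly_sum poly_monom)
  define E where "E = {poly p b |p. p \<in> polys K}"
  have "R.independent K Us"
  proof (rule R.trivial_combine_imp_independent[OF sf])
    fix Ks assume Ks: "set Ks \<subseteq> K" "R.combine Ks Us = \<zero>\<^bsub>?R\<^esub>"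
    define n where "n = min (length Ks) d"
    define p where "p = (\<Sum>i<n. Polynomial.monom (Ks ! i) i)"
    have cp: "cf p i = (if i < n then Ks ! i else 0)" for i by (simp add: p_def coeff_sum)
    have "p \<in> polys K" using Ks(1) by (auto simp: polys_def cp n_def)
    moreover have "poly p b = 0" using Ks(2) comb'[of Ks] poly_sum' by (simp add: p_def n_def)
    moreover have "p \<noteq> 0 \<Longrightarrow> deg p < d"
    proof -
      assume "p \<noteq> 0"
      then have "cf p (deg p) \<noteq> 0" by simp
      then show "deg p < d" unfolding cp by (auto simp: n_def split: if_splits)
    qed
    ultimately have "p = 0" using K.minpoly_min[OF alg] by (force simp: d_def)
    then have "Ks ! i = 0" if "i < n" for i using cp[of i] that by simp
    then show "set (take (length Us) Ks) \<subseteq> {\<zero>\<^bsub>?R\<^esub>}" by (auto simp: in_set_conv_nth Us_def n_def)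
  qed simp
  moreover have "R.Span K Us = E"
  proof
    show "R.Span K Us \<subseteq> E"
    proof
      fix x assume "x \<in> R.Span K Us"
      then obtain Ks where Ks: "length Ks = length Us" "set Ks \<subseteq> K" "x = R.combine Ks Us"
        using R.Span_eq_combine_set_length_version[OF sf, of Us] by auto
      define p where "p = (\<Sum>i<d. Polynomial.monom (Ks ! i) i)"
      have "p \<in> polys K" using Ks by (auto simp: polys_def p_def coeff_sum Us_def)
      moreover have "x = poly p b" using Ks comb' poly_sum' by (simp add: p_def Us_def)
      ultimately show "x \<in> E" by (auto simp: E_def)
    qed
    show "E \<subseteq> R.Span K Us"
    proof
      fix x assume "x \<in> E"
      then obtain p where p: "p \<in> polys K" "x = poly p b" by (auto simp: E_def)
      obtain q r where qr: "q \<in> polys K" "r \<in> polys K" "p = q * minpoly K b + r" "r = 0 \<or> deg r < d"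
        using K.polys_division[OF K.minpoly(1)[OF alg] K.minpoly_nonzero[OF alg] p(1)] by (auto simp: d_def)
      have xr: "x = poly r b" using p(2) qr(3) K.minpoly(3)[OF alg] by simp
      define Ks where "Ks = map (cf r) [0..<d]"
      have "R.combine Ks Us = (\<Sum>i<d. cf r i * b ^ i)" by (simp add: comb' Ks_def)
      also have "\<dots> = poly r b"
      proof (cases "r = 0")
        case False
        then have "{..deg r} \<subseteq> {..<d}" using qr(4) by auto
        then show ?thesis unfolding poly_altdef by (intro sum.mono_neutral_right) (auto simp: coeff_eq_0)
      qed simp
      finally have "x = R.combine Ks Us" using xr by simp
      moreover have "set Ks \<subseteq> K" using qr(2) by (auto simp: Ks_def polys_def)
      moreover have "length Ks = length Us" by (simp add: Ks_def Us_def)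
      ultimately show "x \<in> R.Span K Us" using R.Span_eq_combine_set_length_version[OF sf, of Us] by auto
    qed
  qed
  ultimately have "R.dimension (length Us) K E" by (rule R.dimensionI[OF sf])
  then have dim: "R.dimension d K E" by (simp add: Us_def)
  have "generate_field ?R (insert b K) = E"
  proof
    have "subfield_set E" unfolding E_def by (rule K.subfield_set_simple_extension[OF alg])
    moreover have "insert b K \<subseteq> E"
      using K.simple_extension_superset K.simple_extension_generator by (simp add: E_def)
    ultimately show "generate_field ?R (insert b K) \<subseteq> E"
      using R.generate_field_min_subfield1[of "insert b K" E] by (simp add: subfield_iff_subfield_set)
    have "is_subfield (generate_field ?R (insert b K))" by (rule R.generate_field_is_subfield) simp
    then interpret Gf: subfield_set "generate_field ?R (insert b K)" by (simp add: subfield_iff_subfield_set)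
    have "insert b K \<subseteq> generate_field ?R (insert b K)" by (auto intro: generate_field.incl)
    then show "E \<subseteq> generate_field ?R (insert b K)"
      unfolding E_def using polys_mono[of K "generate_field ?R (insert b K)"] Gf.poly_mem by blast
  qed
  then show ?thesis unfolding ext_degree_def d_def[symmetric]
    using R.dimI[OF sf dim] by (simp add: over_def)
qed

section \<open>Implicit constant fields\<close>

lemma field_emb_to_ac: "field_emb (to_ac :: 'b::field \<Rightarrow> _)"
  by unfold_locales auto

lemma field_emb_comp: "field_emb f \<Longrightarrow> field_emb g \<Longrightarrow> field_emb (\<lambda>x. f (g x))"
  unfolding field_emb_def by auto

lemma (in field_emb) subfield_set_image: "subfield_set F \<Longrightarrow> subfield_set (\<sigma> ` F)"
proof -
  assume "subfield_set F"
  then interpret subfield_set F .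
  show ?thesis
  proof
    show "0 \<in> \<sigma> ` F" by (rule image_eqI[of _ _ 0]) auto
    show "1 \<in> \<sigma> ` F" by (rule image_eqI[of _ _ 1]) auto
    fix x y assume "x \<in> \<sigma> ` F" "y \<in> \<sigma> ` F"
    then obtain a b where *: "a \<in> F" "x = \<sigma> a" "b \<in> F" "y = \<sigma> b" by blast
    show "x + y \<in> \<sigma> ` F" by (rule image_eqI[of _ _ "a + b"]) (use * in auto)
    show "x * y \<in> \<sigma> ` F" by (rule image_eqI[of _ _ "a * b"]) (use * in auto)
    show "- x \<in> \<sigma> ` F" by (rule image_eqI[of _ _ "- a"]) (use * in auto)
    show "inverse x \<in> \<sigma> ` F" by (rule image_eqI[of _ _ "inverse a"]) (use * in auto)
  qed
qed

lemma (in field_emb) subfield_set_vimage: "subfield_set F \<Longrightarrow> subfield_set {x. \<sigma> x \<in> F}"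
proof -
  assume "subfield_set F"
  then interpret subfield_set F .
  show ?thesis by unfold_locales auto
qed

lemma (in field_emb) polys_image:
  assumes "f \<in> polys (\<sigma> ` F)" obtains g where "g \<in> polys F" "f = map_poly \<sigma> g"
proof -
  \<comment> \<open>A right inverse of \<open>\<sigma>\<close> on the image; 0 is treated separately
    so that \<open>map_poly\<close> acts on each coefficient.\<close>
  define h where "h = (\<lambda>x. if x = 0 then 0 else SOME a. a \<in> F \<and> \<sigma> a = x)"
  have h: "(x \<noteq> 0 \<longrightarrow> h x \<in> F) \<and> \<sigma> (h x) = x" if "x \<in> \<sigma> ` F" for x
    using that someI_ex[of "\<lambda>a. a \<in> F \<and> \<sigma> a = x"] by (auto simp: h_def)
  have c: "cf (map_poly h f) i = h (cf f i)" for i by (simp add: coeff_map_poly h_def)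
  have "0 \<in> F"
  proof -
    have "cf f (Suc (deg f)) \<in> \<sigma> ` F" using assms by (simp add: polys_def)
    moreover have "cf f (Suc (deg f)) = 0" by (simp add: coeff_eq_0)
    ultimately show ?thesis by auto
  qed
  then have "h x \<in> F" if "x \<in> \<sigma> ` F" for x using h[OF that] by (cases "x = 0") (auto simp: h_def)
  then have "map_poly h f \<in> polys F" using assms by (auto simp: polys_def c)
  moreover have "f = map_poly \<sigma> (map_poly h f)"
    using h assms by (auto simp: poly_eq_iff c polys_def)
  ultimately show thesis using that by blast
qed

lemma (in field_emb) polys_map_poly: "f \<in> polys F \<Longrightarrow> map_poly \<sigma> f \<in> polys (\<sigma> ` F)"
  by (auto simp: polys_def)

lemma root_map_poly:
  fixes \<sigma> :: "'a::alg_closed_field \<Rightarrow> 'b::field"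
  assumes "field_emb \<sigma>" "f \<noteq> 0" "poly (map_poly \<sigma> f) y = 0"
  obtains x where "y = \<sigma> x" "poly f x = 0"
proof -
  interpret field_emb \<sigma> by fact
  have "y \<in># proots (map_poly \<sigma> f)" using assms(2,3) by simp
  then have "\<exists>r\<in>#proots f. y = \<sigma> r" unfolding proots_map_poly[OF assms(1)] by auto
  then show thesis using that assms(2) by auto
qed

text \<open>The lifted root is a root of a polynomial with coefficients from the algebraically
  closed domain, all of whose roots are images under \<open>\<sigma>\<close>.\<close>

lemma henselian_vimage:
  fixes \<sigma> :: "'a::alg_closed_field \<Rightarrow> 'b::alg_closed_field"
  assumes "field_emb \<sigma>" "henselian N u"
  shows "henselian {x. \<sigma> x \<in> N} (\<lambda>x. u (\<sigma> x))"
  unfolding henselian_def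
proof (intro ballI impI)
  interpret field_emb \<sigma> by fact
  fix f a assume f: "f \<in> polys {x. \<sigma> x \<in> N}" and a: "a \<in> valuation_ring {x. \<sigma> x \<in> N} (\<lambda>x. u (\<sigma> x))"
    and *: "lcf f = 1 \<and> (\<forall>i. 0 \<le> u (\<sigma> (cf f i))) \<and> 0 < u (\<sigma> (poly f a)) \<and> u (\<sigma> (poly (pderiv f) a)) = 0"
  have "map_poly \<sigma> f \<in> polys N" using f by (auto simp: polys_def)
  moreover have "\<sigma> a \<in> valuation_ring N u" using a by (auto simp: valuation_ring_def)
  moreover have "poly (pderiv (map_poly \<sigma> f)) (\<sigma> a) = \<sigma> (poly (pderiv f) a)"
    by (simp add: map_poly_pderiv[symmetric])
  ultimately obtain b where b: "b \<in> N" "poly (map_poly \<sigma> f) b = 0" "0 < u (b - \<sigma> a)"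
    using assms(2) * unfolding henselian_def by (metis cf_map_poly deg_map_poly hom_one poly_map_poly)
  have "f \<noteq> 0" using * by auto
  then obtain x where x: "b = \<sigma> x" "poly f x = 0" using root_map_poly[OF assms(1) _ b(2)] by blast
  then show "\<exists>b\<in>{x. \<sigma> x \<in> N}. poly f b = 0 \<and> 0 < u (\<sigma> (b - a))" using b by (intro bexI[of _ x]) auto
qed

text \<open>The fixed elements of \<open>\<tau>\<close> in the henselization form a henselian field
  containing \<open>F\<close>: \<open>\<tau>\<close> sends a Hensel root to one near the same
  \<open>a\<close>, and that root is unique. Minimality of the henselization does the rest.\<close>

lemma henselization_fixed:
  fixes u :: "'b::alg_closed_field \<Rightarrow> 'g::linordered_ab_group_add extended"
  assumes u: "valued_UNIV u" and \<tau>: "field_emb \<tau>" "\<And>x. u (\<tau> x) = u x" "\<And>x. x \<in> F \<Longrightarrow> \<tau> x = x"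
    and y: "y \<in> henselization F u"
  shows "\<tau> y = y"
proof -
  interpret valued_UNIV u by fact
  interpret \<tau>: field_emb \<tau> by fact
  define M where "M = henselization F u"
  have M: "subfield_set M" "henselian M u" "F \<subseteq> M"
    unfolding M_def by (rule subfield_set_henselization[OF u] henselian_henselization[OF u]
        subset_henselization[OF u])+
  interpret M: subfield_set M by (rule M)
  have "henselization F u \<subseteq> {x \<in> M. \<tau> x = x}"
  proof (rule henselization_minimal[OF u])
    show "subfield_set {x \<in> M. \<tau> x = x}" by unfold_locales auto
    show "F \<subseteq> {x \<in> M. \<tau> x = x}" using M(3) \<tau>(3) by auto
    show "henselian {x \<in> M. \<tau> x = x} u"
      unfolding henselian_def
    proof (intro ballI impI)
      fix f a assume f: "f \<in> polys {x \<in> M. \<tau> x = x}" and a: "a \<in> valuation_ring {x \<in> M. \<tau> x = x} u"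
        and *: "lcf f = 1 \<and> (\<forall>i. 0 \<le> u (cf f i)) \<and> 0 < u (poly f a) \<and> u (poly (pderiv f) a) = 0"
      have "f \<in> polys M" "a \<in> valuation_ring M u" using f a by (auto simp: polys_def valuation_ring_def)
      then obtain b where b: "b \<in> M" "poly f b = 0" "0 < u (b - a)"
        using M(2) * unfolding henselian_def by blast
      have fixed: "map_poly \<tau> f = f" using f by (auto simp: poly_eq_iff polys_def)
      have "poly f (\<tau> b) = 0" using \<tau>.poly_map_poly[of f b] fixed b(2) by simp
      moreover have "0 < u (\<tau> b - a)" using \<tau>(2)[of "b - a"] a b(3) by (simp add: valuation_ring_def)
      ultimately have "\<tau> b = b"
        using hensel_root_unique[of f a "\<tau> b" b] * a b by (auto simp: valuation_ring_def)
      then show "\<exists>b\<in>{x \<in> M. \<tau> x = x}. poly f b = 0 \<and> 0 < u (b - a)" using b by blast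
    qed
  qed
  then show ?thesis using y by blast
qed

text \<open>Compare the leading coefficients in \<open>c * q = p\<close>.\<close>

lemma ratC_mem_ratfunsD:
  assumes H: "subfield_set H" and c: "ratC (c :: 'a::field) \<in> ratfuns H" shows "c \<in> H"
proof -
  interpret subfield_set H by fact
  obtain p q where pq: "p \<in> polys H" "q \<in> polys H" "q \<noteq> 0" "ratC c = to_fract p / to_fract q"
    using ratfunsE[OF c] .
  then have "ratC c * to_fract q = to_fract p" by simp
  then have "to_fract ([:c:] * q) = to_fract p" by (simp only: to_fract_mult)
  then have "[:c:] * q = p" by (simp only: to_fract_eq_iff)
  then have "c * lcf q = cf p (deg q)" by auto
  then have "c = cf p (deg q) / lcf q" using pq(3) by (simp add: field_simps)
  then show ?thesis using pq coeff_mem by simp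
qed

lemma ratfuns_mono: "H \<subseteq> H' \<Longrightarrow> ratfuns H \<subseteq> ratfuns H'"
  using polys_mono[of H H'] unfolding ratfuns_def by blast

context common_ext
begin

text \<open>Values of \<open>r - z \<nu>\<close> are invariant, so \<open>\<sigma>\<close> preserves
  limits and the values at non-limits. By tightness limits are exactly the transcendental elements,
  and these share one value.\<close>

lemma embedding_preserves_wb:
  assumes t: tight and \<sigma>: "field_emb \<sigma>" "\<And>c. c \<in> K \<Longrightarrow> \<sigma> c = c" "\<And>x. vb (\<sigma> x) = vb x"
  shows "wb (to_fract (map_poly \<sigma> p)) = wb (to_fract p)"
proof (cases "p = 0")
  case False
  interpret \<sigma>: field_emb \<sigma> by fact
  have lim: "is_lim a \<longleftrightarrow> transcendental_at a" for a using t tight_iff_limits by blast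
  have diff: "vb (\<sigma> r - z \<nu>) = vb (r - z \<nu>)" for r \<nu>
    using \<sigma>(3)[of "r - z \<nu>"] \<sigma>(2)[OF zK] by simp
  have xv: "xv (\<sigma> r) = xv r" for r
  proof (cases "is_lim r")
    case True
    then have "is_lim (\<sigma> r)" by (simp add: limit_iff diff)
    then show ?thesis using True lim trans_xv_eq by blast
  next
    case False
    then obtain \<nu> where \<nu>: "vb (r - z \<nu>) < \<delta> \<nu>" using nonlimitE by blast
    then have "vb (\<sigma> r - z \<nu>) < \<delta> \<nu>" by (simp add: diff)
    then show ?thesis using nonlimit_xv[of "\<sigma> r" \<nu>] nonlimit_xv[OF \<nu>] by (simp add: diff)
  qed
  note roots = proots_map_poly[OF \<sigma>(1), of p]
  have "wb (to_fract (map_poly \<sigma> p)) = vb (lcf (map_poly \<sigma> p)) + (\<Sum>r\<in>#proots (map_poly \<sigma> p). xv r)"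
    by (rule wb_poly) (use False in simp)
  also have "\<dots> = vb (lcf p) + (\<Sum>r\<in>#proots p. xv r)"
    unfolding roots by (simp add: \<sigma>(3) image_mset.compositionality o_def xv)
  also have "\<dots> = wb (to_fract p)" by (rule wb_poly[OF False, symmetric])
  finally show ?thesis .
qed simp

end

abbreviation const_ac :: "'a::field \<Rightarrow> 'a poly fract alg_closure" where
  "const_ac c \<equiv> to_ac (ratC c)"

lemma field_emb_const_ac: "field_emb (const_ac :: 'a::field \<Rightarrow> _)"
  by (rule field_emb_comp[OF field_emb_to_ac field_emb_ratC])

text \<open>A \<open>v\<close>-preserving embedding of the constants over the henselization extends coefficientwise to
  rational functions, and from there to the algebraic closure; it must fix the henselization of
  \<open>K(X)\<close> pointwise.\<close>

lemma (in common_ext) henselization_constants: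
  fixes u :: "'a poly fract alg_closure \<Rightarrow> 'g::divisible_ordered_ab_group extended"
  assumes t: tight and u: "valued_UNIV u" and uwb: "\<And>\<phi>. u (to_ac \<phi>) = wb \<phi>"
    and c: "const_ac c \<in> henselization (to_ac ` ratfuns K) u"
  shows "c \<in> henselization K vb"
proof (rule ccontr)
  assume cH: "c \<notin> henselization K vb"
  interpret u: valued_UNIV u by fact
  interpret ac: field_emb "to_ac :: 'a poly fract \<Rightarrow> _" by (rule field_emb_to_ac)
  interpret e: field_emb "const_ac :: 'a \<Rightarrow> _" by (rule field_emb_const_ac)
  define H where "H = henselization K vb"
  have H: "subfield_set H" "henselian H vb" "K \<subseteq> H" unfolding H_def
    by (rule subfield_set_henselization[OF valued_UNIV_axioms] henselian_henselization[OF valued_UNIV_axioms]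
        subset_henselization[OF valued_UNIV_axioms])+
  interpret H: subfield_set H by (rule H)
  have algH: "algebraic_over H x" for x using algebraic_over_mono[OF H(3) alg] .
  define P where "P = minpoly H c"
  note P = H.minpoly(1-3)[OF algH, of c, folded P_def]
  have P0: "P \<noteq> 0" unfolding P_def by (rule H.minpoly_nonzero[OF algH])
  show False
  proof (cases "\<exists>c'. poly P c' = 0 \<and> c' \<noteq> c")
    case True
    then obtain c' where c': "poly P c' = 0" "c' \<noteq> c" by blast
    obtain \<sigma> where \<sigma>: "field_emb \<sigma>" "\<forall>x\<in>H. \<sigma> x = x" "\<sigma> c = c'"
      using conjugate_embedding[OF H(1) algH, of c c'] c'(1) by (auto simp: P_def)
    interpret \<sigma>: field_emb \<sigma> by fact
    have \<sigma>v: "vb (\<sigma> x) = vb x" for x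
      using henselian_embedding_value[OF valued_UNIV_axioms H(1,2) algH \<sigma>(1)] \<sigma>(2) by blast
    \<comment> \<open>The graph of the coefficientwise action on polynomials with arbitrary
      constants; it must reach \<open>c\<close>, not only the polynomials over
      \<open>K\<close>.\<close>
    define G0 where "G0 = range (\<lambda>p. (to_ac (to_fract p), to_ac (to_fract (map_poly \<sigma> p))))"
    have G0I: "(to_ac (to_fract p), to_ac (to_fract (map_poly \<sigma> p))) \<in> G0" for p by (auto simp: G0_def)
    have ring: "pair_ring G0"
    proof
      show "(0, 0) \<in> G0" using G0I[of 0] by simp
      show "(1, 1) \<in> G0" using G0I[of 1] by (simp add: one_pCons)
      fix x x' y y' assume "(x, x') \<in> G0" "(y, y') \<in> G0"
      then obtain p q where *: "x = to_ac (to_fract p)" "x' = to_ac (to_fract (map_poly \<sigma> p))"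
        "y = to_ac (to_fract q)" "y' = to_ac (to_fract (map_poly \<sigma> q))" by (auto simp: G0_def)
      show "(x + y, x' + y') \<in> G0" "(x * y, x' * y') \<in> G0"
        using G0I[of "p + q"] G0I[of "p * q"] by (simp_all add: *)
      have "map_poly \<sigma> (- p) = - map_poly \<sigma> p" by (auto simp: poly_eq_iff)
      then show "(- x, - x') \<in> G0" using G0I[of "- p"] by (simp add: *)
    qed
    have "wb (to_fract (map_poly \<sigma> p)) = wb (to_fract p)" for p
      by (rule embedding_preserves_wb[OF t \<sigma>(1) _ \<sigma>v]) (use \<sigma>(2) H(3) in blast)
    then have inv: "pair_invariant u G0" by (auto simp: pair_invariant_def G0_def uwb)
    have fi: "field_invariant u" by (rule field_invariant_valuation[OF u.valued_field_axioms])
    \<comment> \<open>Its domain is the whole of \<open>'a(X)\<close>, over which the algebraic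
      closure is algebraic.\<close>
    define G1 where "G1 = {(a / c, b / d) |a b c d. (a, b) \<in> G0 \<and> (c, d) \<in> G0 \<and> c \<noteq> 0}"
    note loc = pair_invariant_localization[OF ring inv fi, folded G1_def]
    have dom: "range to_ac \<subseteq> fst ` G1"
    proof
      fix y :: "'a poly fract alg_closure" assume "y \<in> range to_ac"
      then obtain \<phi> where y: "y = to_ac \<phi>" by blast
      obtain p q where pq: "\<phi> = to_fract p / to_fract q" "q \<noteq> 0"
        by (cases \<phi>) (auto simp: Fract_conv_to_fract)
      have "(to_ac (to_fract p) / to_ac (to_fract q),
          to_ac (to_fract (map_poly \<sigma> p)) / to_ac (to_fract (map_poly \<sigma> q))) \<in> G1"
        unfolding G1_def using G0I pq(2) by fastforce
      then show "y \<in> fst ` G1" using y pq(1) by (metis fst_conv image_eqI to_ac_divide)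
    qed
    have "algebraic_over (fst ` G1) y" for y
    proof -
      obtain p :: "'a poly fract poly" where p: "p \<noteq> 0" "poly (map_poly to_ac p) y = 0"
        by (rule alg_closure_algebraic)
      have "map_poly to_ac p \<in> polys (fst ` G1)" using dom by (auto simp: polys_def)
      then show ?thesis unfolding algebraic_over_def using p by (intro bexI[of _ "map_poly to_ac p"]) auto
    qed
    then obtain \<tau> where \<tau>: "field_emb \<tau>" "\<forall>(x, y)\<in>G1. \<tau> x = y" "\<forall>x. u (\<tau> x) = u x"
      using extend_valued_embedding[OF loc(1,2) u] by blast
    interpret \<tau>: field_emb \<tau> by fact
    have \<tau>p: "\<tau> (to_ac (to_fract p)) = to_ac (to_fract (map_poly \<sigma> p))" for p
      using bspec[OF \<tau>(2) subsetD[OF loc(3) G0I[of p]]] by simp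
    have "\<tau> x = x" if x: "x \<in> to_ac ` ratfuns K" for x
    proof -
      obtain \<phi> where \<phi>: "\<phi> \<in> ratfuns K" "x = to_ac \<phi>" using x by blast
      obtain p q where pq: "p \<in> polys K" "q \<in> polys K" "\<phi> = to_fract p / to_fract q"
        using ratfunsE[OF \<phi>(1)] by metis
      have "map_poly \<sigma> f = f" if "f \<in> polys K" for f
        by (rule map_poly_fixed[OF \<sigma>(1) that]) (use \<sigma>(2) H(3) in blast)
      then show ?thesis using pq by (simp add: \<phi>(2) \<tau>p)
    qed
    then have "\<tau> (const_ac c) = const_ac c"
      using henselization_fixed[OF u \<tau>(1) _ _ c] \<tau>(3) by blast
    moreover have "\<tau> (const_ac c) = const_ac c'" using \<tau>p[of "[:c:]"] \<sigma>(3) by simp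
    ultimately show False using c'(2) e.hom_eq_iff by metis
  next
    \<comment> \<open>Here \<open>c\<close> is purely inseparable over \<open>H\<close>. It is
      excluded even from the henselization of the larger field \<open>H(X)\<close>, where all
      coefficients of \<open>P\<close> are available.\<close>
    case False
    then have root: "r = c" if "poly P r = 0" for r using that by blast
    define F where "F = to_ac ` ratfuns H"
    have F: "subfield_set F" unfolding F_def by (rule ac.subfield_set_image[OF subfield_set_ratfuns[OF H(1)]])
    have "const_ac c \<notin> F"
    proof
      assume "const_ac c \<in> F"
      then have "ratC c \<in> ratfuns H" by (auto simp: F_def)
      then show False using ratC_mem_ratfunsD[OF H(1)] cH by (simp add: H_def)
    qed
    moreover have "map_poly const_ac P \<in> polys F"
      using P(1) ratC_mem_ratfuns[OF H(1)] by (auto simp: polys_def F_def)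
    moreover have "map_poly const_ac P \<noteq> 0" using P0 by simp
    moreover have "poly (map_poly const_ac P) (const_ac c) = 0"
      using e.poly_map_poly[of P c] P(3) by simp
    moreover have "r = const_ac c" if "poly (map_poly const_ac P) r = 0" for r
      using root_map_poly[OF field_emb_const_ac P0 that] root by metis
    ultimately have "const_ac c \<notin> henselization F u"
      by (rule henselization_omits_purely_inseparable[OF u F])
    moreover have "henselization (to_ac ` ratfuns K) u \<subseteq> henselization F u"
    proof (rule henselization_minimal[OF u])
      show "to_ac ` ratfuns K \<subseteq> henselization F u"
        using subset_henselization[OF u, of F] ratfuns_mono[OF H(3)] by (auto simp: F_def)
    qed (rule subfield_set_henselization[OF u] henselian_henselization[OF u])+
    ultimately show False using c by blast
  qed
qed

text \<open>Constants inside the henselization of \<open>K(X)\<close> form a henselian field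
  containing \<open>K\<close>. In the other direction, whatever is algebraic over \<open>K\<close>
  is already a constant, and \<open>henselization_constants\<close> applies.\<close>

lemma (in common_ext) implicit_constant_field:
  fixes u :: "'a poly fract alg_closure \<Rightarrow> 'g::divisible_ordered_ab_group extended"
  assumes t: tight and u: "valued_UNIV u" and uwb: "\<And>\<phi>. u (to_ac \<phi>) = wb \<phi>"
  shows "IC K u = const_ac ` henselization K vb"
proof
  interpret e: field_emb "const_ac :: 'a \<Rightarrow> _" by (rule field_emb_const_ac)
  define M where "M = henselization (to_ac ` ratfuns K) u"
  show "const_ac ` henselization K vb \<subseteq> IC K u"
  proof
    fix y assume "y \<in> const_ac ` henselization K vb"
    then obtain c where c: "c \<in> henselization K vb" "y = const_ac c" by blast
    have "henselization K vb \<subseteq> {x. const_ac x \<in> M}"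
    proof (rule henselization_minimal[OF valued_UNIV_axioms])
      show "subfield_set {x. const_ac x \<in> M}"
        unfolding M_def by (rule e.subfield_set_vimage[OF subfield_set_henselization[OF u]])
      show "K \<subseteq> {x. const_ac x \<in> M}"
        using subset_henselization[OF u, of "to_ac ` ratfuns K"] ratC_mem_ratfuns[OF K] by (auto simp: M_def)
      have "henselian {x. const_ac x \<in> M} (\<lambda>x. u (const_ac x))"
        unfolding M_def by (rule henselian_vimage[OF field_emb_const_ac henselian_henselization[OF u]])
      then show "henselian {x. const_ac x \<in> M} vb" by (simp add: uwb)
    qed
    moreover have "algebraic_over (const_ac ` K) y"
    proof -
      obtain f where f: "f \<in> polys K" "f \<noteq> 0" "poly f c = 0" using alg[of c] by (auto simp: algebraic_over_def)
      show ?thesis unfolding algebraic_over_def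
        by (rule bexI[OF _ e.polys_map_poly[OF f(1)]]) (use f c(2) e.poly_map_poly[of f c] in auto)
    qed
    ultimately show "y \<in> IC K u" using c by (auto simp: IC_def M_def)
  qed
  show "IC K u \<subseteq> const_ac ` henselization K vb"
  proof
    fix y assume "y \<in> IC K u"
    then have y: "y \<in> henselization (to_ac ` ratfuns K) u" "algebraic_over (const_ac ` K) y"
      by (auto simp: IC_def)
    obtain f where f: "f \<in> polys (const_ac ` K)" "f \<noteq> 0" "poly f y = 0"
      using y(2) by (auto simp: algebraic_over_def)
    obtain g where g: "g \<in> polys K" "f = map_poly const_ac g" using e.polys_image[OF f(1)] .
    then obtain c where "y = const_ac c"
      using root_map_poly[OF field_emb_const_ac, of g y] f by auto
    then show "y \<in> const_ac ` henselization K vb" using henselization_constants[OF t u uwb] y(1) by blast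
  qed
qed

text \<open>If \<open>a - b\<close> has value at least \<open>xv a\<close>, then
  \<open>xv b = xv a\<close>, so \<open>b\<close> is a limit, and \<open>Q\<close> has least degree
  among minimal polynomials of limits.\<close>

lemma (in common_ext) minimal_pair_of_definition:
  assumes Q: "Q = minpoly K a" "\<And>b. is_lim b \<Longrightarrow> deg Q \<le> deg (minpoly K b)"
    and a: "transcendental_at a"
  shows "minimal_pair_of_definition K vb wb a (xv a)"
  unfolding minimal_pair_of_definition_def
proof (intro conjI allI impI)
  show "pair_of_definition vb wb a (xv a)" using a pair_of_definition_iff by simp
  fix b assume "xv a \<le> vb (a - b)"
  then have "xv b = xv a" using xv_min[OF a, of b] by (simp add: min_def)
  then have "is_lim b" using trans_limit[OF a] by (simp add: limit_iff_xv)
  then show "ext_degree K a \<le> ext_degree K b"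
    using Q by (simp add: ext_degree_eq[OF K alg])
qed

theorem theorem7p2:
  fixes K :: "'a::alg_closed_field set"
    and v vb :: "'a \<Rightarrow> 'g::divisible_ordered_ab_group extended"
    and w :: "'a poly fract \<Rightarrow> 'g extended"
    and z :: "'i::{wellorder, no_top} \<Rightarrow> 'a"
    and Q Qh :: "'a poly"
  defines "Kh \<equiv> henselization K vb"
  defines "cond_i \<equiv> valuation_ring (ratfuns K) w = vE_ring K v z"
    and "cond_ii \<equiv> \<exists>wb. common_extension K w vb wb \<and>
           (\<forall>a. pcs_limit vb z a \<longleftrightarrow> pair_of_definition vb wb a (wb (ratX - ratC a)))"
    and "cond_iii \<equiv> \<forall>wb a. common_extension K w vb wb \<and>
             pair_of_definition vb wb a (wb (ratX - ratC a)) \<longrightarrow>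
           (\<forall>\<beta> \<in> value_group UNIV vb.
              Fin \<beta> > wb (ratX - ratC a) \<longleftrightarrow> (\<forall>\<nu>. Fin \<beta> > pcs_delta v z \<nu>))"
    and "cond_iv \<equiv> \<exists>wb a. common_extension K w vb wb \<and> poly Q a = 0 \<and>
           minimal_pair_of_definition K vb wb a (wb (ratX - ratC a))"
    and "cond_v \<equiv> \<exists>wb a. common_extension K w vb wb \<and> poly Q a = 0 \<and>
           pair_of_definition vb wb a (wb (ratX - ratC a))"
    and "cond_vi \<equiv> w (to_fract Q) \<notin> Fin ` value_group UNIV vb"
    and "cond_vii \<equiv> \<forall>u :: 'a poly fract alg_closure \<Rightarrow> 'g extended.
           valuation_on UNIV u \<and> (\<forall>\<phi> \<in> ratfuns K. u (to_ac \<phi>) = w \<phi>) \<longrightarrow>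
           IC K u = (\<lambda>c. to_ac (ratC c)) ` henselization K (\<lambda>c. u (to_ac (ratC c)))"
  assumes "is_subfield K" and "\<forall>x. algebraic_over K x"
    and "valuation_on K v"
    and "valuation_on UNIV vb" and "\<forall>c \<in> K. vb c = v c"
    and "valuation_on (ratfuns K) w" and "\<forall>c \<in> K. w (ratC c) = v c"
    and "value_transcendental K v w"
    and "range z \<subseteq> K" and "pseudo_convergent v z" and "algebraic_type K v z"
    and "assoc_min_poly K v z Q" and "assoc_min_poly Kh vb z Qh"
    and "pcs_limit w (\<lambda>\<nu>. ratC (z \<nu>)) ratX"
  shows "degdom vb z Qh = Polynomial.degree Qh \<and>
    (cond_i \<longleftrightarrow> cond_ii) \<and> (cond_ii \<longleftrightarrow> cond_iii) \<and> (cond_iii \<longrightarrow> cond_iv) \<and>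
    (cond_iv \<longleftrightarrow> cond_v) \<and> (cond_v \<longleftrightarrow> cond_vi) \<and> (cond_iii \<longrightarrow> cond_vii)"
proof -
  have K: "subfield_set K" using assms by (simp add: subfield_iff_subfield_set)
  have alg: "algebraic_over K x" for x using assms by blast
  have zK: "z \<nu> \<in> K" for \<nu> using \<open>range z \<subseteq> K\<close> by blast
  have zz: "z \<nu> - z \<mu> \<in> K" for \<nu> \<mu> using subfield_set.diff_mem[OF K] zK by blast
  have delta: "pcs_delta v' z = pcs_delta v z" if "\<And>c. c \<in> K \<Longrightarrow> v' c = v c" for v'
    using that zz by (simp add: pcs_delta_def fun_eq_iff)
  have limX: "\<forall>\<^sub>F \<nu> in at_top. w (ratX - ratC (z \<nu>)) = pcs_delta v z \<nu>"
  proof -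
    have "pcs_delta w (\<lambda>\<nu>. ratC (z \<nu>)) \<nu> = pcs_delta v z \<nu>" for \<nu>
      using \<open>\<forall>c \<in> K. w (ratC c) = v c\<close> zz by (simp only: pcs_delta_def ratC_simps(2)[symmetric])
    then show ?thesis
      using \<open>pcs_limit w (\<lambda>\<nu>. ratC (z \<nu>)) ratX\<close> unfolding pcs_limit_def by simp
  qed
  \<comment> \<open>Stated for any extension \<open>v'\<close> of \<open>v\<close>: besides
    \<open>vb\<close>, the valuation that \<open>u\<close> induces on the constants is needed for
    (vii).\<close>
  have inst: "pcs_setup v' K v w z"
    if v': "valuation_on UNIV v'" "\<And>c. c \<in> K \<Longrightarrow> v' c = v c" for v'
  proof -
    have "valued_field UNIV v'" by (rule valued_field_UNIV[OF v'(1)])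
    then interpret valued_closed v' by (simp add: valued_closed_def valued_UNIV_def)
    have "pseudo_convergent v' z"
      using \<open>pseudo_convergent v z\<close> zz v'(2) by (simp add: pseudo_convergent_def)
    moreover have "\<forall>\<^sub>F \<nu> in at_top. w (ratX - ratC (z \<nu>)) = pcs_delta v' z \<nu>"
      using limX delta[OF v'(2)] by simp
    moreover have "value_transcendental_setup v' K v w"
      by (intro value_transcendental_setup.intro value_transcendental_setup_axioms.intro
          valued_closed_axioms K alg) (use assms v'(2) in auto)
    ultimately show ?thesis
      using zK \<open>algebraic_type K v z\<close> by (intro pcs_setup.intro pcs_setup_axioms.intro)
  qed
  have vbv: "vb c = v c" if "c \<in> K" for c using \<open>\<forall>c \<in> K. vb c = v c\<close> that by blast
  have vbU: "valuation_on UNIV vb" by fact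
  interpret S: pcs_setup vb K v w z by (rule inst[OF vbU vbv])
  have ext: "common_ext vb K v w z wb" if "common_extension K w vb wb" for wb
    using that S.pcs_setup_axioms by (simp add: common_ext_def common_ext_axioms_def)
  obtain wb0 where wb0: "common_extension K w vb wb0" using S.exists_common_extension by blast

  have degdom: "degdom vb z Qh = Polynomial.degree Qh"
    using \<open>assoc_min_poly Kh vb z Qh\<close> unfolding Kh_def
    by (rule S.degdom_assoc_min_poly_henselian[rotated 3])
      (rule subfield_set_henselization[OF S.valued_UNIV_axioms] subset_henselization[OF S.valued_UNIV_axioms]
        henselian_henselization[OF S.valued_UNIV_axioms])+

  \<comment> \<open>The right side does not mention \<open>wb\<close>, so the left side holds for
    one common extension if and only if it holds for all.\<close>
  have ii_wb: "(\<forall>a. pcs_limit vb z a \<longleftrightarrow> pair_of_definition vb wb a (wb (ratX - ratC a))) \<longleftrightarrow> cond_i"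
    if "common_extension K w vb wb" for wb
  proof -
    interpret C: common_ext vb K v w z wb by (rule ext[OF that])
    show ?thesis
      using C.tight_iff_limits C.tight_iff_vE by (simp add: C.pair_of_definition_iff cond_i_def)
  qed
  have i_ii: "cond_i \<longleftrightarrow> cond_ii" using ii_wb wb0 unfolding cond_ii_def by blast
  have iii_wb: "(\<forall>a. pair_of_definition vb wb a (wb (ratX - ratC a)) \<longrightarrow>
      (\<forall>\<beta> \<in> value_group UNIV vb. Fin \<beta> > wb (ratX - ratC a) \<longleftrightarrow> (\<forall>\<nu>. Fin \<beta> > pcs_delta v z \<nu>)))
      \<longleftrightarrow> cond_i" if "common_extension K w vb wb" for wb
  proof -
    interpret C: common_ext vb K v w z wb by (rule ext[OF that])
    show ?thesis
      using C.tight_iff_vE by (simp add: C.pair_of_definition_iff cond_i_def C.tight_def delta[OF vbv])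
  qed
  have i_iii: "cond_i \<longleftrightarrow> cond_iii" using iii_wb wb0 unfolding cond_iii_def by blast

  have Q: "Q \<in> polys K" "lcf Q = 1" "\<exists>a. poly Q a = 0 \<and> pcs_limit vb z a"
    "\<And>a. pcs_limit vb z a \<Longrightarrow> deg Q \<le> deg (minpoly K a)" "\<And>a. poly Q a = 0 \<Longrightarrow> Q = minpoly K a"
    using S.assoc_min_poly_limit_root[of K v Q] K vbv \<open>assoc_min_poly K v z Q\<close> by simp_all
  have Q0: "Q \<noteq> 0" using Q(2) by auto
  have iii_v: "cond_v" if "cond_iii"
  proof -
    obtain a where a: "poly Q a = 0" "pcs_limit vb z a" using Q(3) by blast
    have "pair_of_definition vb wb0 a (wb0 (ratX - ratC a))"
      using that i_iii ii_wb[OF wb0] a(2) by blast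
    then show ?thesis using a(1) wb0 unfolding cond_v_def by blast
  qed
  have v_iv: "cond_iv" if v: "cond_v"
  proof -
    obtain wb a where *: "common_extension K w vb wb" "poly Q a = 0"
      "pair_of_definition vb wb a (wb (ratX - ratC a))" using v unfolding cond_v_def by blast
    interpret C: common_ext vb K v w z wb by (rule ext[OF *(1)])
    have "minimal_pair_of_definition K vb wb a (wb (ratX - ratC a))"
      using C.minimal_pair_of_definition[of Q a] Q(4) Q(5)[OF *(2)] *(3) C.pair_of_definition_iff by blast
    then show ?thesis using * unfolding cond_iv_def by blast
  qed
  have iv_v: "cond_v" if "cond_iv"
    using that unfolding cond_iv_def cond_v_def minimal_pair_of_definition_def by blast
  have v_vi: "cond_v \<longleftrightarrow> cond_vi"
  proof
    assume "cond_v"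
    then obtain wb a where *: "common_extension K w vb wb" "poly Q a = 0"
      "pair_of_definition vb wb a (wb (ratX - ratC a))" unfolding cond_v_def by blast
    interpret C: common_ext vb K v w z wb by (rule ext[OF *(1)])
    have "wb (to_fract Q) \<notin> Fin ` value_group UNIV vb"
      using C.poly_trans[OF Q0 *(2)] *(3) C.pair_of_definition_iff by blast
    then show cond_vi using C.wb_eq[OF S.polyK[OF Q(1)]] by (simp add: cond_vi_def)
  next
    assume vi: cond_vi
    \<comment> \<open>Here the existence of a common extension is essential, since (vi) does not
      supply one.\<close>
    interpret C: common_ext vb K v w z wb0 by (rule ext[OF wb0])
    have "wb0 (to_fract Q) \<notin> Fin ` value_group UNIV vb"
      using vi C.wb_eq[OF S.polyK[OF Q(1)]] by (simp add: cond_vi_def)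
    then obtain a where "poly Q a = 0" "C.transcendental_at a" using C.poly_not_trans[OF Q0] by blast
    then show cond_v using wb0 C.pair_of_definition_iff unfolding cond_v_def by blast
  qed
  have iii_vii: "cond_vii" if "cond_iii"
    unfolding cond_vii_def
  proof (intro allI impI)
    fix u :: "'a poly fract alg_closure \<Rightarrow> 'g extended"
    assume u: "valuation_on UNIV u \<and> (\<forall>\<phi> \<in> ratfuns K. u (to_ac \<phi>) = w \<phi>)"
    define v' where "v' = (\<lambda>c. u (to_ac (ratC c)))"
    define wb' where "wb' = (\<lambda>\<phi>. u (to_ac \<phi>))"
    interpret u: valued_UNIV u using valued_field_UNIV[of u] u by (simp add: valued_UNIV_def)
    have pull: "valuation_on UNIV (\<lambda>x. u (f x))" if f: "field_emb f" for f :: "'c::field \<Rightarrow> _"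
    proof -
      interpret field_emb f by fact
      have "u (f x) \<in> range Fin" if "x \<noteq> 0" for x
        by (rule u.v_Fin[of "f x"]) (use that in auto)
      then show ?thesis unfolding valuation_on_def by (simp add: u.v_mult u.v_add)
    qed
    have v'U: "valuation_on UNIV v'" unfolding v'_def by (rule pull[OF field_emb_const_ac])
    have wb'U: "valuation_on UNIV wb'" unfolding wb'_def by (rule pull[OF field_emb_to_ac])
    have v'v: "v' c = v c" if "c \<in> K" for c
      using u ratC_mem_ratfuns[OF K that] \<open>\<forall>c \<in> K. w (ratC c) = v c\<close> that by (simp add: v'_def)
    have ce': "common_extension K w v' wb'"
      using wb'U u by (simp add: common_extension_def v'_def wb'_def)
    interpret C: common_ext v' K v w z wb'
      using inst[OF v'U v'v] ce' by (simp add: common_ext_def common_ext_axioms_def)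
    \<comment> \<open>\<open>cond_i\<close> is the bridge from \<open>vb\<close> to
      \<open>v'\<close>: it yields tightness for the extension induced by \<open>u\<close>.\<close>
    have "cond_i" using that i_iii by blast
    then have tight: "C.tight" using C.tight_iff_vE by (simp add: cond_i_def)
    have "IC K u = (\<lambda>c. to_ac (ratC c)) ` henselization K v'"
      by (rule C.implicit_constant_field[OF tight u.valued_UNIV_axioms]) (simp add: wb'_def)
    then show "IC K u = (\<lambda>c. to_ac (ratC c)) ` henselization K (\<lambda>c. u (to_ac (ratC c)))"
      by (simp only: v'_def)
  qed
  show ?thesis using degdom i_ii i_iii iii_v v_iv iv_v v_vi iii_vii by blast
qed

end
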